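(* Let $\Lambda=kQ/I$ be a cyclic Nakayama algebra given by an irredundant system of relations $\alpha_{k_{2i}}\cdots\alpha_{k_{2i-1}+1}\alpha_{k_{2i-1}}=0$, $1\le i\le r$. The following are equivalent: 1. $\operatorname{fin.dim}\Lambda=1$; 2. $\{k_1,k_3,\ldots,k_{2r-1}\}=\{k_2,k_4,\ldots,k_{2r}\}$; 3. $\mathcal{B}(\Lambda)=\nabla(\Lambda)$ (as sets of isomorphism classes of modules).
   Context: All modules are finitely generated. Let $k$ be a field. Cyclic Nakayama algebra: let $Q$ be the cyclic oriented quiver with vertices $1,\dots,n$, with arrows $\alpha_i:i\to i+1$ for $1\le i\le n-1$ and $\alpha_n:n\to 1$; indices are read modulo $n$. A cyclic Nakayama algebra is a bound quiver algebra $\Lambda=kQ/I$, where $I$ is the ideal generated by an irredundant system of $r\ge 1$ zero relations $\alpha_{k_{2i}}\cdots\alpha_{k_{2i-1}+1}\alpha_{k_{2i-1}}=0$, $1\le i\le r$, with $k_1,\dots,k_{2r}\in\{1,\dots,n\}$ and $k_1<k_3<\cdots<k_{2r-1}<k_1$ in cyclic order (the $i$-th relation is a path whose first arrow is $\alpha_{k_{2i-1}}$ and last arrow is $\alpha_{k_{2i}}$; it may wind around the cycle). $S_i$ is the simple module at vertex $i$ and $P_i$ its projective cover; modules are such that $P_i$ is uniserial with composition factors, from top to socle, $S_i,S_{i+1},S_{i+2},\dots$, and $P_{k_{2i-1}}$ has socle $S_{k_{2i}}$. The simple modules occurring as socles of indecomposable projective modules are exactly $S_{k_2},S_{k_4},\dots,S_{k_{2r}}$,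 and $k_2<k_4<\cdots<k_{2r}<k_2$ in cyclic order. The set $\mathcal{B}(\Lambda)=\{\Delta_1,\dots,\Delta_r\}$: $\Delta_j$ is the uniserial $\Lambda$-module with top $S_{k_{2(j-1)}+1}$ and socle $S_{k_{2j}}$ (where $k_0:=k_{2r}$), with composition factors from top to socle $S_{k_{2(j-1)}+1},S_{k_{2(j-1)}+2},\dots,S_{k_{2j}}$, stopping at the first occurrence of $S_{k_{2j}}$. The set $\nabla(\Lambda)=\{\nabla_1,\dots,\nabla_r\}$: $\nabla_j$ is the uniserial module with top $S_{k_{2j-1}+1}$ and socle $S_{k_{2j+1}}$ (where $k_{2r+1}:=k_1$), with composition factors from top to socle $S_{k_{2j-1}+1},S_{k_{2j-1}+2},\dots,S_{k_{2j+1}}$, stopping at the first occurrence of $S_{k_{2j+1}}$. The finitistic dimension is $\operatorname{fin.dim}\Lambda=\sup\{\operatorname{pdim}M\mid M\text{ a finitely generated }\Lambda\text{-module with }\operatorname{pdim}M<\infty\}$, where $\operatorname{pdim}$ denotes projective dimension.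
   Formalization: The implication from 2 (equivalently 3) to 1 is stated only for r < n: when r = n the algebra is self-injective, so fin.dim is 0 although 2 and 3 hold, e.g. k[x]/(x^2). The implication from 1 to 2 and the equivalence of 2 and 3 are stated for all r. *)

theory Defs
  imports "HOL-Algebra.QuotRing" "HOL-Algebra.Module" "HOL-Library.Extended_Nat"
begin

section \<open>Left modules over a ring that need not be commutative\<close>

text \<open>The locale \<^locale>\<open>module\<close> of the library asks for a commutative ring.  We keep its record
  type, of which the fields \<open>mult\<close> and \<open>one\<close> carry no information for a module.\<close>

locale left_module = R?: ring R + M?: abelian_group M for R and M (structure) +
  assumes smult_closed:
      "\<lbrakk>a \<in> carrier R; x \<in> carrier M\<rbrakk> \<Longrightarrow> a \<odot>\<^bsub>M\<^esub> x \<in> carrier M"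
    and smult_l_distr:
      "\<lbrakk>a \<in> carrier R; b \<in> carrier R; x \<in> carrier M\<rbrakk> \<Longrightarrow>
      (a \<oplus>\<^bsub>R\<^esub> b) \<odot>\<^bsub>M\<^esub> x = a \<odot>\<^bsub>M\<^esub> x \<oplus>\<^bsub>M\<^esub> b \<odot>\<^bsub>M\<^esub> x"
    and smult_r_distr:
      "\<lbrakk>a \<in> carrier R; x \<in> carrier M; y \<in> carrier M\<rbrakk> \<Longrightarrow>
      a \<odot>\<^bsub>M\<^esub> (x \<oplus>\<^bsub>M\<^esub> y) = a \<odot>\<^bsub>M\<^esub> x \<oplus>\<^bsub>M\<^esub> a \<odot>\<^bsub>M\<^esub> y"
    and smult_assoc:
      "\<lbrakk>a \<in> carrier R; b \<in> carrier R; x \<in> carrier M\<rbrakk> \<Longrightarrow>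
      (a \<otimes>\<^bsub>R\<^esub> b) \<odot>\<^bsub>M\<^esub> x = a \<odot>\<^bsub>M\<^esub> (b \<odot>\<^bsub>M\<^esub> x)"
    and smult_one:
      "x \<in> carrier M \<Longrightarrow> \<one>\<^bsub>R\<^esub> \<odot>\<^bsub>M\<^esub> x = x"

definition mod_hom :: "('r, 'q) ring_scheme \<Rightarrow> ('r, 'a) module \<Rightarrow> ('r, 'b) module \<Rightarrow> ('a \<Rightarrow> 'b) set"
  where "mod_hom R M N = {h. h \<in> carrier M \<rightarrow> carrier N \<and>
    (\<forall>x\<in>carrier M. \<forall>y\<in>carrier M. h (x \<oplus>\<^bsub>M\<^esub> y) = h x \<oplus>\<^bsub>N\<^esub> h y) \<and>
    (\<forall>a\<in>carrier R. \<forall>x\<in>carrier M. h (a \<odot>\<^bsub>M\<^esub> x) = a \<odot>\<^bsub>N\<^esub> h x)}"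

definition mod_iso :: "('r, 'q) ring_scheme \<Rightarrow> ('r, 'a) module \<Rightarrow> ('r, 'b) module \<Rightarrow> bool"
  where "mod_iso R M N \<longleftrightarrow> (\<exists>h\<in>mod_hom R M N. bij_betw h (carrier M) (carrier N))"

definition fin_gen :: "('r, 'q) ring_scheme \<Rightarrow> ('r, 'a) module \<Rightarrow> bool"
  where "fin_gen R M \<longleftrightarrow> (\<exists>S. finite S \<and> S \<subseteq> carrier M \<and>
    (\<forall>H. submodule H R M \<and> S \<subseteq> H \<longrightarrow> H = carrier M))"

definition quotient_module :: "('r, 'a) module \<Rightarrow> 'a set \<Rightarrow> ('r, 'a set) module"
  where "quotient_module M N =
    \<lparr>carrier = a_rcosets\<^bsub>M\<^esub> N, mult = undefined, one = undefined, zero = N, add = set_add M,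
     smult = (\<lambda>a X. \<Union>x\<in>X. N +>\<^bsub>M\<^esub> (a \<odot>\<^bsub>M\<^esub> x))\<rparr>"

definition simple_module :: "('r, 'q) ring_scheme \<Rightarrow> ('r, 'a) module \<Rightarrow> bool"
  where "simple_module R M \<longleftrightarrow> left_module R M \<and> carrier M \<noteq> {\<zero>\<^bsub>M\<^esub>} \<and>
    (\<forall>H. submodule H R M \<longrightarrow> H = {\<zero>\<^bsub>M\<^esub>} \<or> H = carrier M)"

definition uniserial_module :: "('r, 'q) ring_scheme \<Rightarrow> ('r, 'a) module \<Rightarrow> bool"
  where "uniserial_module R M \<longleftrightarrow> left_module R M \<and>
    (\<forall>H K. submodule H R M \<and> submodule K R M \<longrightarrow> H \<subseteq> K \<or> K \<subseteq> H)"


section \<open>Projective and finitistic dimension\<close>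

text \<open>Modules are finitely generated, hence quotients of some \<open>R\<^sup>m\<close>.  Choosing a representative in
  every coset, each of them is isomorphic to a module whose carrier consists of elements of type
  \<open>nat \<Rightarrow> 'r\<close>.  We therefore use this type wherever a quantifier runs over all finitely
  generated modules over a ring with elements of type \<open>'r\<close>.\<close>

definition free_module :: "('r, 'q) ring_scheme \<Rightarrow> nat \<Rightarrow> ('r, nat \<Rightarrow> 'r) module"
  where "free_module R m =
    \<lparr>carrier = {x. (\<forall>i<m. x i \<in> carrier R) \<and> (\<forall>i\<ge>m. x i = \<zero>\<^bsub>R\<^esub>)},
     mult = undefined, one = undefined, zero = (\<lambda>i. \<zero>\<^bsub>R\<^esub>),
     add = (\<lambda>x y i. x i \<oplus>\<^bsub>R\<^esub> y i), smult = (\<lambda>a x i. a \<otimes>\<^bsub>R\<^esub> x i)\<rparr>"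

text \<open>A finitely generated module is projective if it is a direct summand of some \<open>R\<^sup>m\<close>.\<close>

definition fg_projective :: "('r, 'q) ring_scheme \<Rightarrow> ('r, 'a) module \<Rightarrow> bool"
  where "fg_projective R P \<longleftrightarrow> left_module R P \<and>
    (\<exists>m. \<exists>i\<in>mod_hom R P (free_module R m). \<exists>p\<in>mod_hom R (free_module R m) P.
      \<forall>x\<in>carrier P. p (i x) = x)"

text \<open>\<open>\<dots> \<rightarrow> P 2 \<rightarrow> P 1 \<rightarrow> P 0 \<rightarrow> M \<rightarrow> 0\<close> with maps \<open>d i : P (i + 1) \<rightarrow> P i\<close> and \<open>\<epsilon> : P 0 \<rightarrow> M\<close>.\<close>

definition proj_resolution ::
    "('r, 'q) ring_scheme \<Rightarrow> ('r, 'a) module \<Rightarrow> (nat \<Rightarrow> ('r, nat \<Rightarrow> 'r) module) \<Rightarrow>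
     (nat \<Rightarrow> (nat \<Rightarrow> 'r) \<Rightarrow> (nat \<Rightarrow> 'r)) \<Rightarrow> ((nat \<Rightarrow> 'r) \<Rightarrow> 'a) \<Rightarrow> bool"
  where "proj_resolution R M P d \<epsilon> \<longleftrightarrow>
    (\<forall>i. fg_projective R (P i)) \<and>
    \<epsilon> \<in> mod_hom R (P 0) M \<and> (\<forall>i. d i \<in> mod_hom R (P (Suc i)) (P i)) \<and>
    \<epsilon> ` carrier (P 0) = carrier M \<and>
    d 0 ` carrier (P 1) = a_kernel (P 0) M \<epsilon> \<and>
    (\<forall>i. d (Suc i) ` carrier (P (Suc (Suc i))) = a_kernel (P (Suc i)) (P i) (d i))"

definition pdim :: "('r, 'q) ring_scheme \<Rightarrow> ('r, 'a) module \<Rightarrow> enat"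
  where "pdim R M = Inf {enat l |l. \<exists>P d \<epsilon>. proj_resolution R M P d \<epsilon> \<and>
    (\<forall>i>l. carrier (P i) = {\<zero>\<^bsub>P i\<^esub>})}"

definition fin_dim :: "('r, 'q) ring_scheme \<Rightarrow> enat"
  where "fin_dim R = Sup {pdim R M |M :: ('r, nat \<Rightarrow> 'r) module.
    left_module R M \<and> fin_gen R M \<and> pdim R M < \<infinity>}"

definition iso_class :: "('r, 'q) ring_scheme \<Rightarrow> ('r, 'a) module \<Rightarrow> ('r, nat \<Rightarrow> 'r) module set"
  where "iso_class R M = {N. left_module R N \<and> mod_iso R M N}"


section \<open>The path algebra of the cyclic quiver\<close>

text \<open>The representative of \<open>m\<close> modulo \<open>N\<close> in \<open>{1..N}\<close>.\<close>

definition cyc :: "nat \<Rightarrow> nat \<Rightarrow> nat"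
  where "cyc N m = (m + N - 1) mod N + 1"

text \<open>The quiver has vertices \<open>1, \<dots>, n\<close> and one arrow \<open>\<alpha>\<^sub>i : i \<rightarrow> cyc n (i + 1)\<close> for each vertex, so a
  path is determined by its starting vertex \<open>i\<close> and its number of arrows \<open>l\<close>, and is encoded as
  \<open>(i, l)\<close>; it ends at \<open>cyc n (i + l)\<close>.  Paths are composed from right to left, as in
  \<open>\<alpha>\<^sub>2 \<alpha>\<^sub>1\<close>: the product \<open>p q\<close> is \<open>q\<close> followed by \<open>p\<close>.  Thus \<open>\<Lambda> e\<^sub>i\<close> is
  spanned by the paths starting at \<open>i\<close>, and the left module \<open>P\<^sub>i = \<Lambda> e\<^sub>i\<close> has the composition factors
  \<open>S\<^sub>i, S\<^sub>i\<^sub>+\<^sub>1, \<dots>\<close> from top to socle.\<close>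

type_synonym 'k paths = "nat \<times> nat \<Rightarrow> 'k"

definition path :: "nat \<Rightarrow> nat \<Rightarrow> 'k::field paths"
  where "path i l = (\<lambda>p. if p = (i, l) then 1 else 0)"

definition path_algebra :: "'k::field itself \<Rightarrow> nat \<Rightarrow> 'k paths ring"
  where "path_algebra K n =
    \<lparr>carrier = {f. finite {p. f p \<noteq> 0} \<and> {p. f p \<noteq> 0} \<subseteq> {1..n} \<times> UNIV},
     mult = (\<lambda>f g (i, l). \<Sum>m\<le>l. f (cyc n (i + m), l - m) * g (i, m)),
     one = (\<lambda>(i, l). if i \<in> {1..n} \<and> l = 0 then 1 else 0),
     zero = (\<lambda>p. 0), add = (\<lambda>f g p. f p + g p)\<rparr>"


section \<open>Cyclic Nakayama algebras\<close>

text \<open>The \<open>i\<close>-th relation is the path with first arrow \<open>\<alpha>\<close> at \<open>k (2 * i - 1)\<close> and last arrow \<open>\<alpha>\<close>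
  at \<open>k (2 * i)\<close>.  As it may wind around the cycle, these two arrows do not determine it, and its
  number of arrows \<open>len i\<close> is part of the data.\<close>

definition relation :: "'k::field itself \<Rightarrow> (nat \<Rightarrow> nat) \<Rightarrow> (nat \<Rightarrow> nat) \<Rightarrow> nat \<Rightarrow> 'k paths"
  where "relation K k len i = path (k (2 * i - 1)) (len i)"

definition cyclically_increasing :: "nat list \<Rightarrow> bool"
  where "cyclically_increasing xs \<longleftrightarrow> (\<exists>m. sorted_wrt (<) (rotate m xs))"

text \<open>The condition \<open>len i \<ge> 2\<close> says that the relations generate an admissible ideal, as
  required of a bound quiver algebra.\<close>

definition irredundant_system ::
    "'k::field itself \<Rightarrow> nat \<Rightarrow> nat \<Rightarrow> (nat \<Rightarrow> nat) \<Rightarrow> (nat \<Rightarrow> nat) \<Rightarrow> bool"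
  where "irredundant_system K n r k len \<longleftrightarrow>
    n \<ge> 1 \<and> r \<ge> 1 \<and> (\<forall>m\<in>{1..2 * r}. k m \<in> {1..n}) \<and>
    (\<forall>i\<in>{1..r}. len i \<ge> 2 \<and> cyc n (k (2 * i - 1) + (len i - 1)) = k (2 * i)) \<and>
    cyclically_increasing (map (\<lambda>i. k (2 * i - 1)) [1..<r + 1]) \<and>
    (\<forall>i\<in>{1..r}. relation K k len i \<notin>
      genideal (path_algebra K n) (relation K k len ` ({1..r} - {i})))"

definition relation_ideal ::
    "'k::field itself \<Rightarrow> nat \<Rightarrow> nat \<Rightarrow> (nat \<Rightarrow> nat) \<Rightarrow> (nat \<Rightarrow> nat) \<Rightarrow> 'k paths set"
  where "relation_ideal K n r k len = genideal (path_algebra K n) (relation K k len ` {1..r})"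

definition nakayama_algebra ::
    "'k::field itself \<Rightarrow> nat \<Rightarrow> nat \<Rightarrow> (nat \<Rightarrow> nat) \<Rightarrow> (nat \<Rightarrow> nat) \<Rightarrow> 'k paths set ring"
  where "nakayama_algebra K n r k len = path_algebra K n Quot relation_ideal K n r k len"

text \<open>The idempotent of \<open>\<Lambda>\<close> at the vertex \<open>i\<close>.\<close>

definition vertex_idem ::
    "'k::field itself \<Rightarrow> nat \<Rightarrow> nat \<Rightarrow> (nat \<Rightarrow> nat) \<Rightarrow> (nat \<Rightarrow> nat) \<Rightarrow> nat \<Rightarrow> 'k paths set"
  where "vertex_idem K n r k len i = relation_ideal K n r k len +>\<^bsub>path_algebra K n\<^esub> path i 0"

text \<open>\<open>S \<cong> S\<^sub>i\<close>: up to isomorphism, \<open>S\<^sub>i\<close> is the only simple module on which \<open>e\<^sub>i\<close> acts nontrivially.\<close>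

definition is_simple_at ::
    "'k::field itself \<Rightarrow> nat \<Rightarrow> nat \<Rightarrow> (nat \<Rightarrow> nat) \<Rightarrow> (nat \<Rightarrow> nat) \<Rightarrow> nat \<Rightarrow>
     ('k paths set, 'a) module \<Rightarrow> bool"
  where "is_simple_at K n r k len i S \<longleftrightarrow> simple_module (nakayama_algebra K n r k len) S \<and>
    (\<exists>x\<in>carrier S. vertex_idem K n r k len i \<odot>\<^bsub>S\<^esub> x \<noteq> \<zero>\<^bsub>S\<^esub>)"

text \<open>\<open>M\<close> is uniserial with composition factors, from top to socle, \<open>S\<^sub>a, S\<^sub>a\<^sub>+\<^sub>1, \<dots>, S\<^sub>b\<close> (indices
  modulo \<open>n\<close>), stopping at the first occurrence of \<open>S\<^sub>b\<close>.  The filtration \<open>F\<close> is the composition series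
  of \<open>M\<close>, so its first factor is the top and its last factor is the socle.\<close>

definition uniserial_from_to ::
    "'k::field itself \<Rightarrow> nat \<Rightarrow> nat \<Rightarrow> (nat \<Rightarrow> nat) \<Rightarrow> (nat \<Rightarrow> nat) \<Rightarrow> nat \<Rightarrow> nat \<Rightarrow>
     ('k paths set, 'a) module \<Rightarrow> bool"
  where "uniserial_from_to K n r k len a b M \<longleftrightarrow>
    uniserial_module (nakayama_algebra K n r k len) M \<and>
    (\<exists>F. let l = Suc (LEAST t. cyc n (a + t) = b) in
      F 0 = carrier M \<and> F l = {\<zero>\<^bsub>M\<^esub>} \<and>
      (\<forall>t<l. submodule (F t) (nakayama_algebra K n r k len) M \<and> F (Suc t) \<subseteq> F t \<and>
        is_simple_at K n r k len (cyc n (a + t))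
          (quotient_module (M\<lparr>carrier := F t\<rparr>) (F (Suc t)))))"

text \<open>\<open>\<B>(\<Lambda>)\<close> and \<open>\<nabla>(\<Lambda>)\<close> as sets of isomorphism classes.  The indices of \<open>k\<close> are read
  modulo \<open>2 * r\<close>, that is, \<open>k 0 = k (2 * r)\<close> and \<open>k (2 * r + 1) = k 1\<close>.\<close>

definition base_set ::
    "'k::field itself \<Rightarrow> nat \<Rightarrow> nat \<Rightarrow> (nat \<Rightarrow> nat) \<Rightarrow> (nat \<Rightarrow> nat) \<Rightarrow>
     ('k paths set, nat \<Rightarrow> 'k paths set) module set set"
  where "base_set K n r k len =
    {iso_class (nakayama_algebra K n r k len) \<Delta> |\<Delta> :: ('k paths set, nat \<Rightarrow> 'k paths set) module.
      \<exists>j\<in>{1..r}. uniserial_from_to K n r k len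
        (k (cyc (2 * r) (2 * (j - 1))) + 1) (k (2 * j)) \<Delta>}"

definition nabla_set ::
    "'k::field itself \<Rightarrow> nat \<Rightarrow> nat \<Rightarrow> (nat \<Rightarrow> nat) \<Rightarrow> (nat \<Rightarrow> nat) \<Rightarrow>
     ('k paths set, nat \<Rightarrow> 'k paths set) module set set"
  where "nabla_set K n r k len =
    {iso_class (nakayama_algebra K n r k len) N |N :: ('k paths set, nat \<Rightarrow> 'k paths set) module.
      \<exists>j\<in>{1..r}. uniserial_from_to K n r k len
        (k (2 * j - 1) + 1) (k (cyc (2 * r) (2 * j + 1))) N}"

text \<open>The case \<open>r = n\<close>, in which all \<open>len i\<close> are equal, is that of the self-injective algebras.
  For these \<open>{k 1, k 3, \<dots>} = {k 2, k 4, \<dots>} = {1..n}\<close> and both \<open>\<B>(\<Lambda>)\<close> and \<open>\<nabla>(\<Lambda>)\<close> consist of all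
  simple modules, but the finitistic dimension is 0.  So neither of these two conditions implies that
  the finitistic dimension is 1 unless \<open>r < n\<close>.\<close>

end

theory Submission
  imports Defs
begin

text \<open>
  The ideal of relations is spanned by the paths that contain a relation.  So \<open>\<Lambda>\<close> has as basis the
  paths of length less than \<open>L i\<close> starting at \<open>i\<close>, where \<open>L i\<close> is the length of \<open>P\<^sub>i\<close>, and computations in
  \<open>\<Lambda>\<close> become computations with coefficients along paths (locale \<open>nakayama_coeffs\<close>).  The sum \<open>\<alpha>\<close> of all
  arrows generates the radical on both sides, hence the radical of any module \<open>M\<close> is \<open>\<alpha> M\<close>.
  Call \<open>O = {k\<^sub>1, k\<^sub>3, \<dots>}\<close> the first arrows of the relations and \<open>E = {k\<^sub>2, k\<^sub>4, \<dots>}\<close> the last ones.  If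
  \<open>i \<notin> O\<close>, then \<open>P\<^sub>i\<^sub>+\<^sub>1\<close> is the radical of \<open>P\<^sub>i\<close>, whereas \<open>L i \<le> L (i + 1)\<close> if \<open>i \<in> O\<close>; the socles of the
  \<open>P\<^sub>i\<close> are the \<open>S\<^sub>e\<close> with \<open>e \<in> E\<close>.  By irredundancy both sets have \<open>r\<close> elements.

  If \<open>O \<noteq> E\<close>, there is a last arrow \<open>b = k\<^sub>2\<^sub>j\<close> outside \<open>O\<close>.  The module \<open>M = P\<^sub>a / soc P\<^sub>a\<close> with \<open>a = k\<^sub>2\<^sub>j\<^sub>-\<^sub>1\<close> has
  first syzygy \<open>S\<^sub>b\<close> and second syzygy \<open>rad P\<^sub>b \<cong> P\<^sub>b\<^sub>+\<^sub>1\<close>, so its projective dimension is at most 2, and it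
  is not smaller because no projective module is simple (\<open>uni_mod_socle_pd\<close>).  So the finitistic dimension
  is not 1.

  If \<open>O = E\<close>, let \<open>K \<rightarrow> P \<rightarrow> Q\<close> be exact at \<open>P\<close>, with \<open>K \<rightarrow> P\<close> injective and all three modules
  projective.  An element \<open>z = \<alpha> y\<close> of \<open>K\<close> with \<open>y \<in> P\<close> lies in \<open>\<alpha> K\<close>: the part of \<open>y\<close> at vertices outside
  \<open>E\<close> has its image in the socle of \<open>Q\<close>, hence belongs to \<open>K\<close>; and the remaining part of \<open>z\<close> sits at
  vertices \<open>i + 1\<close> with \<open>i \<in> E = O\<close>, where it is annihilated by the longest nonzero path because
  \<open>L i \<le> L (i + 1)\<close>, and so it cannot be a generator of \<open>K\<close> (\<open>kernel_reflects_radical\<close>).  Thus \<open>K / rad K\<close> embeds into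
  \<open>P / rad P\<close>, the inclusion of \<open>K\<close> splits (\<open>split_mono\<close>), and the image of \<open>P \<rightarrow> Q\<close> is projective.
  Therefore finite projective resolutions can be shortened to length 1.  If moreover
  \<open>r < n\<close>, then \<open>S\<^sub>a\<close> with \<open>a \<notin> O\<close> has the resolution \<open>0 \<rightarrow> P\<^sub>a\<^sub>+\<^sub>1 \<rightarrow> P\<^sub>a\<close>, and it is not projective because it does not occur
  in the socle of \<open>\<Lambda>\<close>.

  Finally, \<open>\<Delta>\<close> runs from \<open>e + 1\<close> to the element of \<open>E\<close> following \<open>e\<close>, and \<open>\<nabla>\<close> runs from \<open>o + 1\<close> to the element
  of \<open>O\<close> following \<open>o\<close> (\<open>next_soc_ix\<close>, \<open>next_top_ix\<close>).  So \<open>O = E\<close> gives the same modules; conversely the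
  tops of the modules in \<open>\<nabla>(\<Lambda>)\<close> and \<open>\<B>(\<Lambda>)\<close> determine \<open>O\<close> and \<open>E\<close>.
\<close>


section \<open>Modules over a ring that need not be commutative\<close>

context left_module
begin

declare smult_closed [simp, intro] smult_one [simp]

lemma smult_zero_left [simp]:
  assumes "x \<in> carrier M"
  shows "\<zero>\<^bsub>R\<^esub> \<odot>\<^bsub>M\<^esub> x = \<zero>\<^bsub>M\<^esub>"
proof -
  have "\<zero>\<^bsub>R\<^esub> \<odot>\<^bsub>M\<^esub> x \<oplus>\<^bsub>M\<^esub> \<zero>\<^bsub>R\<^esub> \<odot>\<^bsub>M\<^esub> x = \<zero>\<^bsub>R\<^esub> \<odot>\<^bsub>M\<^esub> x"
    using smult_l_distr[of "\<zero>\<^bsub>R\<^esub>" "\<zero>\<^bsub>R\<^esub>" x] assms by simp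
  then show ?thesis
    using assms by (metis M.add.r_cancel_one' R.zero_closed smult_closed)
qed

lemma smult_zero_right [simp]:
  assumes "a \<in> carrier R"
  shows "a \<odot>\<^bsub>M\<^esub> \<zero>\<^bsub>M\<^esub> = \<zero>\<^bsub>M\<^esub>"
proof -
  have "a \<odot>\<^bsub>M\<^esub> \<zero>\<^bsub>M\<^esub> \<oplus>\<^bsub>M\<^esub> a \<odot>\<^bsub>M\<^esub> \<zero>\<^bsub>M\<^esub> = a \<odot>\<^bsub>M\<^esub> \<zero>\<^bsub>M\<^esub>"
    using smult_r_distr[of a "\<zero>\<^bsub>M\<^esub>" "\<zero>\<^bsub>M\<^esub>"] assms by simp
  then show ?thesis
    using assms by (metis M.add.r_cancel_one' M.zero_closed smult_closed)
qed

lemma smult_minus_right: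
  assumes "a \<in> carrier R" "x \<in> carrier M"
  shows "a \<odot>\<^bsub>M\<^esub> (\<ominus>\<^bsub>M\<^esub> x) = \<ominus>\<^bsub>M\<^esub> (a \<odot>\<^bsub>M\<^esub> x)"
proof -
  have "a \<odot>\<^bsub>M\<^esub> (\<ominus>\<^bsub>M\<^esub> x) \<oplus>\<^bsub>M\<^esub> a \<odot>\<^bsub>M\<^esub> x = \<zero>\<^bsub>M\<^esub>"
    using smult_r_distr[of a "\<ominus>\<^bsub>M\<^esub> x" x] assms by (simp add: M.l_neg)
  then show ?thesis
    using assms by (simp add: M.minus_equality)
qed

lemma smult_minus_left:
  assumes "a \<in> carrier R" "x \<in> carrier M"
  shows "(\<ominus>\<^bsub>R\<^esub> a) \<odot>\<^bsub>M\<^esub> x = \<ominus>\<^bsub>M\<^esub> (a \<odot>\<^bsub>M\<^esub> x)"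
proof -
  have "(\<ominus>\<^bsub>R\<^esub> a) \<odot>\<^bsub>M\<^esub> x \<oplus>\<^bsub>M\<^esub> a \<odot>\<^bsub>M\<^esub> x = \<zero>\<^bsub>M\<^esub>"
    using smult_l_distr[of "\<ominus>\<^bsub>R\<^esub> a" a x] assms by (simp add: R.l_neg)
  then show ?thesis
    using assms by (simp add: M.minus_equality)
qed

lemma smult_diff_left:
  assumes "a \<in> carrier R" "b \<in> carrier R" "x \<in> carrier M"
  shows "(a \<ominus>\<^bsub>R\<^esub> b) \<odot>\<^bsub>M\<^esub> x = a \<odot>\<^bsub>M\<^esub> x \<ominus>\<^bsub>M\<^esub> b \<odot>\<^bsub>M\<^esub> x"
  using assms by (simp add: M.minus_eq R.minus_eq smult_l_distr smult_minus_left)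

lemma finsum_smult:
  assumes "finite B" "a \<in> carrier R" "f \<in> B \<rightarrow> carrier M"
  shows "a \<odot>\<^bsub>M\<^esub> finsum M f B = finsum M (\<lambda>b. a \<odot>\<^bsub>M\<^esub> f b) B"
  using assms by (induction B rule: finite_induct) (auto simp: smult_r_distr Pi_def)

lemma submodule_as_module:
  assumes "submodule H R M"
  shows "left_module R (M\<lparr>carrier := H\<rparr>)"
proof -
  interpret H: submodule H R M by fact
  have H: "x \<in> carrier M" if "x \<in> H" for x using H.subset that by auto
  have neg: "\<ominus>\<^bsub>M\<^esub> x \<in> H" if "x \<in> H" for x
    using H.m_inv_closed[OF that] by (simp add: a_inv_def)
  have "abelian_group (M\<lparr>carrier := H\<rparr>)"
  proof (rule abelian_groupI, goal_cases)
    case (1 x y)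
    then show ?case using H.m_closed[of x y] by simp
  next
    case 2
    then show ?case using H.one_closed by simp
  next
    case (3 x y z)
    then show ?case using H by (simp add: M.a_assoc)
  next
    case (4 x y)
    then show ?case using H by (simp add: M.a_comm)
  next
    case (5 x)
    then show ?case using H by simp
  next
    case (6 x)
    then show ?case using neg[of x] H[of x] by (intro bexI[of _ "\<ominus>\<^bsub>M\<^esub> x"]) (simp_all add: M.l_neg)
  qed
  then show ?thesis
    by (intro left_module.intro left_module_axioms.intro R.ring_axioms)
      (simp_all add: H H.smult_closed smult_l_distr smult_r_distr smult_assoc)
qed

end

lemma submodule_closed:
  assumes "submodule H R M"
  shows "H \<subseteq> carrier M" "\<zero>\<^bsub>M\<^esub> \<in> H" "\<And>x y. x \<in> H \<Longrightarrow> y \<in> H \<Longrightarrow> x \<oplus>\<^bsub>M\<^esub> y \<in> H"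
    "\<And>x. x \<in> H \<Longrightarrow> \<ominus>\<^bsub>M\<^esub> x \<in> H" "\<And>a x. a \<in> carrier R \<Longrightarrow> x \<in> H \<Longrightarrow> a \<odot>\<^bsub>M\<^esub> x \<in> H"
proof -
  interpret H: submodule H R M by fact
  show "H \<subseteq> carrier M" "\<zero>\<^bsub>M\<^esub> \<in> H" "\<And>x y. x \<in> H \<Longrightarrow> y \<in> H \<Longrightarrow> x \<oplus>\<^bsub>M\<^esub> y \<in> H"
    "\<And>a x. a \<in> carrier R \<Longrightarrow> x \<in> H \<Longrightarrow> a \<odot>\<^bsub>M\<^esub> x \<in> H"
    using H.subset H.one_closed H.m_closed[of x y for x y] H.smult_closed
    by (simp_all add: a_inv_def[symmetric])
  show "\<ominus>\<^bsub>M\<^esub> x \<in> H" if "x \<in> H" for x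
    using H.m_inv_closed[OF that] by (simp add: a_inv_def)
qed

lemma (in left_module) submoduleI:
  assumes "H \<subseteq> carrier M" "\<zero>\<^bsub>M\<^esub> \<in> H" "\<And>x y. x \<in> H \<Longrightarrow> y \<in> H \<Longrightarrow> x \<oplus>\<^bsub>M\<^esub> y \<in> H"
    "\<And>a x. a \<in> carrier R \<Longrightarrow> x \<in> H \<Longrightarrow> a \<odot>\<^bsub>M\<^esub> x \<in> H"
  shows "submodule H R M"
proof -
  have neg: "\<ominus>\<^bsub>M\<^esub> x \<in> H" if "x \<in> H" for x
  proof -
    have "(\<ominus>\<^bsub>R\<^esub> \<one>\<^bsub>R\<^esub>) \<odot>\<^bsub>M\<^esub> x \<in> H" using that by (intro assms(4)) auto
    then show ?thesis using that assms(1) by (auto simp: smult_minus_left subset_iff)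
  qed
  show ?thesis
    by (intro submodule.intro submodule_axioms.intro M.add.subgroupI)
      (use assms neg in \<open>auto simp: a_inv_def[symmetric]\<close>)
qed


section \<open>Homomorphisms\<close>

lemma mod_homI:
  assumes "\<And>x. x \<in> carrier M \<Longrightarrow> h x \<in> carrier N"
    "\<And>x y. x \<in> carrier M \<Longrightarrow> y \<in> carrier M \<Longrightarrow> h (x \<oplus>\<^bsub>M\<^esub> y) = h x \<oplus>\<^bsub>N\<^esub> h y"
    "\<And>a x. a \<in> carrier R \<Longrightarrow> x \<in> carrier M \<Longrightarrow> h (a \<odot>\<^bsub>M\<^esub> x) = a \<odot>\<^bsub>N\<^esub> h x"
  shows "h \<in> mod_hom R M N"
  using assms by (auto simp: mod_hom_def)

lemma mod_hom_closed: "h \<in> mod_hom R M N \<Longrightarrow> x \<in> carrier M \<Longrightarrow> h x \<in> carrier N"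
  by (auto simp: mod_hom_def)

lemma mod_hom_add:
  "h \<in> mod_hom R M N \<Longrightarrow> x \<in> carrier M \<Longrightarrow> y \<in> carrier M \<Longrightarrow> h (x \<oplus>\<^bsub>M\<^esub> y) = h x \<oplus>\<^bsub>N\<^esub> h y"
  by (auto simp: mod_hom_def)

lemma mod_hom_smult:
  "h \<in> mod_hom R M N \<Longrightarrow> a \<in> carrier R \<Longrightarrow> x \<in> carrier M \<Longrightarrow> h (a \<odot>\<^bsub>M\<^esub> x) = a \<odot>\<^bsub>N\<^esub> h x"
  by (auto simp: mod_hom_def)

lemma mod_hom_zero:
  assumes "left_module R M" "left_module R N" "h \<in> mod_hom R M N"
  shows "h \<zero>\<^bsub>M\<^esub> = \<zero>\<^bsub>N\<^esub>"
proof -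
  interpret M: left_module R M by fact
  interpret N: left_module R N by fact
  have "h (\<zero>\<^bsub>R\<^esub> \<odot>\<^bsub>M\<^esub> \<zero>\<^bsub>M\<^esub>) = \<zero>\<^bsub>R\<^esub> \<odot>\<^bsub>N\<^esub> h \<zero>\<^bsub>M\<^esub>"
    using assms(3) by (rule mod_hom_smult) auto
  then show ?thesis using mod_hom_closed[OF assms(3), of "\<zero>\<^bsub>M\<^esub>"] by simp
qed

lemma mod_hom_diff:
  assumes "left_module R M" "left_module R N" "h \<in> mod_hom R M N"
    "x \<in> carrier M" "y \<in> carrier M"
  shows "h (x \<ominus>\<^bsub>M\<^esub> y) = h x \<ominus>\<^bsub>N\<^esub> h y"
proof -
  interpret M: left_module R M by fact
  interpret N: left_module R N by fact
  have "h (\<ominus>\<^bsub>M\<^esub> y) \<oplus>\<^bsub>N\<^esub> h y = \<zero>\<^bsub>N\<^esub>"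
    using assms mod_hom_add[OF assms(3), of "\<ominus>\<^bsub>M\<^esub> y" y]
    by (simp add: M.M.l_neg mod_hom_zero[OF assms(1,2,3)])
  then have "h (\<ominus>\<^bsub>M\<^esub> y) = \<ominus>\<^bsub>N\<^esub> h y"
    using assms mod_hom_closed[OF assms(3)] by (metis M.M.a_inv_closed N.M.minus_equality)
  then show ?thesis
    using assms by (simp add: M.M.minus_eq N.M.minus_eq mod_hom_add[OF assms(3)])
qed

lemma mod_hom_comp:
  assumes "g \<in> mod_hom R M N" "h \<in> mod_hom R N Q"
  shows "(\<lambda>x. h (g x)) \<in> mod_hom R M Q"
  using assms by (auto simp: mod_hom_def Pi_def)

lemma mod_hom_sum:
  assumes "left_module R N" "g \<in> mod_hom R M N" "h \<in> mod_hom R M N"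
  shows "(\<lambda>x. g x \<oplus>\<^bsub>N\<^esub> h x) \<in> mod_hom R M N"
proof -
  interpret N: left_module R N by fact
  note c = mod_hom_closed[OF assms(2)] mod_hom_closed[OF assms(3)]
  show ?thesis
    by (rule mod_homI)
      (simp_all add: c mod_hom_add[OF assms(2)] mod_hom_add[OF assms(3)] mod_hom_smult[OF assms(2)]
        mod_hom_smult[OF assms(3)] N.smult_r_distr N.M.a_ac)
qed

lemma mod_hom_difference:
  assumes "left_module R N" "g \<in> mod_hom R M N" "h \<in> mod_hom R M N"
  shows "(\<lambda>x. g x \<ominus>\<^bsub>N\<^esub> h x) \<in> mod_hom R M N"
proof -
  interpret N: left_module R N by fact
  note c = mod_hom_closed[OF assms(2)] mod_hom_closed[OF assms(3)]
  show ?thesis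
    by (rule mod_homI)
      (simp_all add: c mod_hom_add[OF assms(2)] mod_hom_add[OF assms(3)] mod_hom_smult[OF assms(2)]
        mod_hom_smult[OF assms(3)] N.smult_r_distr N.smult_minus_right
        N.M.a_ac N.M.minus_eq N.M.minus_add)
qed

lemma mod_hom_finsum:
  assumes "left_module R N" "finite B" "\<And>b. b \<in> B \<Longrightarrow> g b \<in> mod_hom R M N"
  shows "(\<lambda>x. finsum N (\<lambda>b. g b x) B) \<in> mod_hom R M N"
proof -
  interpret N: left_module R N by fact
  have c: "(\<lambda>b. g b x) \<in> B \<rightarrow> carrier N" if "x \<in> carrier M" for x
    using that mod_hom_closed[OF assms(3)] by blast
  show ?thesis
  proof (rule mod_homI)
    fix x y assume xy: "x \<in> carrier M" "y \<in> carrier M"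
    have "finsum N (\<lambda>b. g b (x \<oplus>\<^bsub>M\<^esub> y)) B = finsum N (\<lambda>b. g b x \<oplus>\<^bsub>N\<^esub> g b y) B"
      using xy c[OF xy(1)] c[OF xy(2)]
      by (intro N.M.finsum_cong') (auto simp: mod_hom_add[OF assms(3)])
    then show "finsum N (\<lambda>b. g b (x \<oplus>\<^bsub>M\<^esub> y)) B = finsum N (\<lambda>b. g b x) B \<oplus>\<^bsub>N\<^esub> finsum N (\<lambda>b. g b y) B"
      using N.M.finsum_addf[OF c[OF xy(1)] c[OF xy(2)]] by simp
  next
    fix a x assume ax: "a \<in> carrier R" "x \<in> carrier M"
    have "finsum N (\<lambda>b. g b (a \<odot>\<^bsub>M\<^esub> x)) B = finsum N (\<lambda>b. a \<odot>\<^bsub>N\<^esub> g b x) B"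
      using ax c[OF ax(2)] by (intro N.M.finsum_cong') (auto simp: mod_hom_smult[OF assms(3)])
    then show "finsum N (\<lambda>b. g b (a \<odot>\<^bsub>M\<^esub> x)) B = a \<odot>\<^bsub>N\<^esub> finsum N (\<lambda>b. g b x) B"
      using N.finsum_smult[OF assms(2) ax(1) c[OF ax(2)]] by simp
  qed (use c in \<open>simp add: N.M.finsum_closed\<close>)
qed

lemma mod_hom_finsum_apply:
  assumes "left_module R M" "left_module R N" "h \<in> mod_hom R M N" "finite B"
    "f \<in> B \<rightarrow> carrier M"
  shows "h (finsum M f B) = finsum N (\<lambda>b. h (f b)) B"
proof -
  interpret M: left_module R M by fact
  interpret N: left_module R N by fact
  show ?thesis
    using assms(4,5)
    by (induction B rule: finite_induct)
      (auto simp: mod_hom_zero[OF assms(1-3)] mod_hom_add[OF assms(3)] mod_hom_closed[OF assms(3)]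
        Pi_def)
qed

lemma mod_hom_image_submodule:
  assumes "left_module R M" "left_module R N" "h \<in> mod_hom R M N" "submodule H R M"
  shows "submodule (h ` H) R N"
proof -
  interpret M: left_module R M by fact
  interpret N: left_module R N by fact
  note H = submodule_closed[OF assms(4)]
  note h = mod_hom_closed[OF assms(3)] mod_hom_add[OF assms(3), symmetric]
    mod_hom_smult[OF assms(3), symmetric]
  show ?thesis
  proof (rule N.submoduleI)
    show "\<zero>\<^bsub>N\<^esub> \<in> h ` H" using H(2) mod_hom_zero[OF assms(1-3)] by (metis imageI)
    show "x \<oplus>\<^bsub>N\<^esub> y \<in> h ` H" if "x \<in> h ` H" "y \<in> h ` H" for x y
      using that H by (auto simp: h subset_iff)
  qed (use H in \<open>auto simp: h subset_iff\<close>)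
qed

lemma mod_hom_injective:
  assumes "left_module R M" "left_module R N" "h \<in> mod_hom R M N"
    "\<And>x. x \<in> carrier M \<Longrightarrow> h x = \<zero>\<^bsub>N\<^esub> \<Longrightarrow> x = \<zero>\<^bsub>M\<^esub>"
  shows "inj_on h (carrier M)"
proof -
  interpret M: left_module R M by fact
  interpret N: left_module R N by fact
  show ?thesis
  proof (rule inj_onI)
    fix x y assume xy: "x \<in> carrier M" "y \<in> carrier M" "h x = h y"
    have "h (x \<ominus>\<^bsub>M\<^esub> y) = \<zero>\<^bsub>N\<^esub>"
      using xy mod_hom_closed[OF assms(3)] by (simp add: mod_hom_diff[OF assms(1-3)] N.M.minus_eq N.M.r_neg)
    then have "x \<ominus>\<^bsub>M\<^esub> y = \<zero>\<^bsub>M\<^esub>" using xy assms(4) by simp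
    moreover have "(x \<ominus>\<^bsub>M\<^esub> y) \<oplus>\<^bsub>M\<^esub> y = x"
      using xy by (simp add: M.M.minus_eq M.M.a_assoc M.M.l_neg)
    ultimately show "x = y" using xy by simp
  qed
qed


section \<open>Projective modules\<close>

lemma free_module_simps [simp]:
  "x \<in> carrier (free_module R m) \<longleftrightarrow> (\<forall>i<m. x i \<in> carrier R) \<and> (\<forall>i\<ge>m. x i = \<zero>\<^bsub>R\<^esub>)"
  "zero (free_module R m) = (\<lambda>i. \<zero>\<^bsub>R\<^esub>)"
  "add (free_module R m) x y = (\<lambda>i. x i \<oplus>\<^bsub>R\<^esub> y i)"
  "smult (free_module R m) a x = (\<lambda>i. a \<otimes>\<^bsub>R\<^esub> x i)"
  by (simp_all add: free_module_def)

lemma (in ring) free_module_nth: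
  assumes "x \<in> carrier (free_module R m)"
  shows "x i \<in> carrier R"
  using assms by (cases "i < m") auto

lemma (in ring) free_module_left_module: "left_module R (free_module R m)"
proof -
  note c = free_module_nth
  have "abelian_group (free_module R m)"
  proof (rule abelian_groupI)
    fix x assume x: "x \<in> carrier (free_module R m)"
    show "\<exists>y\<in>carrier (free_module R m). y \<oplus>\<^bsub>free_module R m\<^esub> x = \<zero>\<^bsub>free_module R m\<^esub>"
      by (rule bexI[of _ "\<lambda>i. \<ominus>\<^bsub>R\<^esub> x i"]) (use x c[OF x] in \<open>auto simp: l_neg\<close>)
  next
    fix x y assume x: "x \<in> carrier (free_module R m)" and y: "y \<in> carrier (free_module R m)"
    show "x \<oplus>\<^bsub>free_module R m\<^esub> y = y \<oplus>\<^bsub>free_module R m\<^esub> x"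
      using c[OF x] c[OF y] by (auto simp: a_comm)
    fix z assume z: "z \<in> carrier (free_module R m)"
    show "x \<oplus>\<^bsub>free_module R m\<^esub> y \<oplus>\<^bsub>free_module R m\<^esub> z =
        x \<oplus>\<^bsub>free_module R m\<^esub> (y \<oplus>\<^bsub>free_module R m\<^esub> z)"
      using c[OF x] c[OF y] c[OF z] by (auto simp: a_assoc)
  next
    fix x assume x: "x \<in> carrier (free_module R m)"
    show "\<zero>\<^bsub>free_module R m\<^esub> \<oplus>\<^bsub>free_module R m\<^esub> x = x" using c[OF x] by auto
  qed auto
  then show ?thesis
  proof (intro left_module.intro left_module_axioms.intro ring_axioms, goal_cases)
    case (3 a b x)
    then show ?case using c[OF 3(4)] by (auto simp: l_distr)
  next
    case (4 a x y)
    then show ?case using c[OF 4(3)] c[OF 4(4)] by (auto simp: r_distr)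
  next
    case (5 a b x)
    then show ?case using c[OF 5(4)] by (auto simp: m_assoc)
  next
    case (6 x)
    then show ?case using c[OF 6(2)] by auto
  qed auto
qed

lemma fg_projective_left_module: "fg_projective R P \<Longrightarrow> left_module R P"
  by (simp add: fg_projective_def)

lemma fg_projectiveE:
  assumes "fg_projective R P"
  obtains i m p where "i \<in> mod_hom R P (free_module R m)" "p \<in> mod_hom R (free_module R m) P"
    "\<forall>x\<in>carrier P. p (i x) = x"
  using assms by (auto simp: fg_projective_def)

lemma fg_projective_trivial:
  assumes "left_module R P" "carrier P = {\<zero>\<^bsub>P\<^esub>}"
  shows "fg_projective R P"
proof -
  interpret P: left_module R P by fact
  have i: "(\<lambda>x i. \<zero>\<^bsub>R\<^esub>) \<in> mod_hom R P (free_module R 0)"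
    by (rule mod_homI) simp_all
  have p: "(\<lambda>x. \<zero>\<^bsub>P\<^esub>) \<in> mod_hom R (free_module R 0) P"
    by (rule mod_homI) simp_all
  have "\<forall>x\<in>carrier P. \<zero>\<^bsub>P\<^esub> = x" using assms(2) by simp
  with i p assms(1) show ?thesis unfolding fg_projective_def by meson
qed

text \<open>The basis vectors of the free module.\<close>

definition unit_vector :: "('r, 'q) ring_scheme \<Rightarrow> nat \<Rightarrow> nat \<Rightarrow> 'r"
  where "unit_vector R s = (\<lambda>i. if i = s then \<one>\<^bsub>R\<^esub> else \<zero>\<^bsub>R\<^esub>)"

lemma (in ring) free_module_expansion:
  assumes y: "y \<in> carrier (free_module R m)"
  shows "finsum (free_module R m) (\<lambda>s. y s \<odot>\<^bsub>free_module R m\<^esub> unit_vector R s) {..<m} = y"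
proof -
  interpret F: left_module R "free_module R m" by (rule free_module_left_module)
  note c = free_module_nth[OF y]
  have "finsum (free_module R m) (\<lambda>s. y s \<odot>\<^bsub>free_module R m\<^esub> unit_vector R s) {..<t}
      = (\<lambda>i. if i < t then y i else \<zero>)" if "t \<le> m" for t
    using that
  proof (induction t)
    case (Suc t)
    have *: "(\<lambda>s. y s \<odot>\<^bsub>free_module R m\<^esub> unit_vector R s) \<in> {..<t} \<rightarrow> carrier (free_module R m)"
      "y t \<odot>\<^bsub>free_module R m\<^esub> unit_vector R t \<in> carrier (free_module R m)"
      using Suc.prems c by (auto simp: unit_vector_def)
    show ?case
      unfolding lessThan_Suc
      using F.M.finsum_insert[OF _ _ *, simplified] Suc c
      by (auto simp: unit_vector_def fun_eq_iff less_Suc_eq)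
  qed (simp add: F.M.finsum_empty)
  from this[of m] y show ?thesis by (auto simp: fun_eq_iff)
qed

lemma free_module_lift:
  assumes "left_module R N" "\<And>s. s < m \<Longrightarrow> n s \<in> carrier N"
  shows "(\<lambda>y. finsum N (\<lambda>s. y s \<odot>\<^bsub>N\<^esub> n s) {..<m}) \<in> mod_hom R (free_module R m) N"
proof -
  interpret N: left_module R N by fact
  show ?thesis
    by (rule mod_hom_finsum[OF assms(1)])
      (auto intro!: mod_homI simp: assms(2) N.smult_l_distr N.smult_assoc)
qed

text \<open>Projective modules have the lifting property.\<close>

lemma fg_projective_lift:
  assumes P: "fg_projective R P" and N: "left_module R N" and M: "left_module R M"
    and g: "g \<in> mod_hom R N M" "g ` carrier N = carrier M" and h: "h \<in> mod_hom R P M"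
  obtains f where "f \<in> mod_hom R P N" "\<And>x. x \<in> carrier P \<Longrightarrow> g (f x) = h x"
proof -
  interpret P: left_module R P by (rule fg_projective_left_module[OF P])
  interpret N: left_module R N by fact
  interpret M: left_module R M by fact
  obtain i m p where ip: "i \<in> mod_hom R P (free_module R m)" "p \<in> mod_hom R (free_module R m) P"
    "\<forall>x\<in>carrier P. p (i x) = x"
    by (rule fg_projectiveE[OF P])
  interpret F: left_module R "free_module R m" by (rule P.R.free_module_left_module)
  have u: "unit_vector R s \<in> carrier (free_module R m)" if "s < m" for s
    using that by (auto simp: unit_vector_def)
  have "\<exists>y\<in>carrier N. g y = h (p (unit_vector R s))" if "s < m" for s
  proof -
    have "h (p (unit_vector R s)) \<in> g ` carrier N"
      unfolding g(2) by (rule mod_hom_closed[OF h mod_hom_closed[OF ip(2) u[OF that]]])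
    then show ?thesis by force
  qed
  then obtain n where n: "\<And>s. s < m \<Longrightarrow> n s \<in> carrier N"
    "\<And>s. s < m \<Longrightarrow> g (n s) = h (p (unit_vector R s))" by metis
  define f where "f x = finsum N (\<lambda>s. i x s \<odot>\<^bsub>N\<^esub> n s) {..<m}" for x
  have "f \<in> mod_hom R P N"
    unfolding f_def by (rule mod_hom_comp[OF ip(1) free_module_lift[OF N n(1)]])
  moreover have "g (f x) = h x" if x: "x \<in> carrier P" for x
  proof -
    have ix: "i x \<in> carrier (free_module R m)" using mod_hom_closed[OF ip(1) x] .
    note c = P.R.free_module_nth[OF ix]
    have hp: "(\<lambda>y. h (p y)) \<in> mod_hom R (free_module R m) M" by (rule mod_hom_comp[OF ip(2) h])
    have "g (f x) = finsum M (\<lambda>s. g (i x s \<odot>\<^bsub>N\<^esub> n s)) {..<m}"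
      unfolding f_def using c n(1) by (intro mod_hom_finsum_apply[OF N M g(1)]) auto
    also have "\<dots> = finsum M (\<lambda>s. h (p (i x s \<odot>\<^bsub>free_module R m\<^esub> unit_vector R s))) {..<m}"
    proof (rule M.M.finsum_cong')
      have F: "i x s \<odot>\<^bsub>free_module R m\<^esub> unit_vector R s \<in> carrier (free_module R m)" if "s < m" for s
        using that by (intro F.smult_closed c u)
      then show "(\<lambda>s. h (p (i x s \<odot>\<^bsub>free_module R m\<^esub> unit_vector R s))) \<in> {..<m} \<rightarrow> carrier M"
        using mod_hom_closed[OF hp] by blast
      fix s assume "s \<in> {..<m}"
      then have s: "s < m" by simp
      show "g (i x s \<odot>\<^bsub>N\<^esub> n s) = h (p (i x s \<odot>\<^bsub>free_module R m\<^esub> unit_vector R s))"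
        unfolding mod_hom_smult[OF g(1) c n(1)[OF s]] mod_hom_smult[OF hp c u[OF s]] n(2)[OF s] ..
    qed simp
    also have "\<dots> = h (p (finsum (free_module R m)
        (\<lambda>s. i x s \<odot>\<^bsub>free_module R m\<^esub> unit_vector R s) {..<m}))"
      by (intro mod_hom_finsum_apply[OF F.left_module_axioms M hp, symmetric] finite_lessThan Pi_I
          F.smult_closed c u) simp
    also have "\<dots> = h x" using bspec[OF ip(3) x] P.R.free_module_expansion[OF ix] by simp
    finally show ?thesis .
  qed
  ultimately show thesis by (rule that)
qed


section \<open>Cyclic indices\<close>

lemma cyc_mem: "n \<ge> 1 \<Longrightarrow> cyc n m \<in> {1..n}"
  by (simp add: cyc_def Suc_leI)

lemma cyc_id: "i \<in> {1..n} \<Longrightarrow> cyc n i = i"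
proof -
  assume i: "i \<in> {1..n}"
  then have "i + n - 1 = (i - 1) + n" by simp
  then have "(i + n - 1) mod n = (i - 1) mod n" by simp
  also have "\<dots> = i - 1" using i by auto
  finally show ?thesis using i by (simp add: cyc_def)
qed

lemma cyc_eq_iff:
  assumes "n \<ge> 1"
  shows "cyc n a = cyc n b \<longleftrightarrow> a mod n = b mod n"
proof -
  have "cyc n a = cyc n b \<longleftrightarrow> (a + (n - 1)) mod n = (b + (n - 1)) mod n"
    using assms by (simp add: cyc_def)
  also have "\<dots> \<longleftrightarrow> a mod n = b mod n"
  proof
    assume "(a + (n - 1)) mod n = (b + (n - 1)) mod n"
    then have "(a + (n - 1) + 1) mod n = (b + (n - 1) + 1) mod n" by (metis mod_add_left_eq)
    then show "a mod n = b mod n" using assms by simp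
  qed (metis mod_add_left_eq)
  finally show ?thesis .
qed

lemma cyc_mod: "n \<ge> 1 \<Longrightarrow> cyc n a mod n = a mod n"
  using cyc_eq_iff[of n "cyc n a" a] cyc_id cyc_mem by metis

lemma cyc_add_left: "n \<ge> 1 \<Longrightarrow> cyc n (cyc n a + b) = cyc n (a + b)"
  unfolding cyc_eq_iff by (subst (1 2) mod_add_left_eq[symmetric]) (simp only: cyc_mod)

lemma cyc_add_cancel: "n \<ge> 1 \<Longrightarrow> cyc n (a + c) = cyc n (b + c) \<longleftrightarrow> cyc n a = cyc n b"
proof -
  assume n: "n \<ge> 1"
  have "(a + c) mod n = (b + c) mod n \<longleftrightarrow> a mod n = b mod n"
  proof
    assume *: "(a + c) mod n = (b + c) mod n"
    have c: "x + c + (n * c - c) = x + n * c" for x using n by simp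
    have "(a + c + (n * c - c)) mod n = (b + c + (n * c - c)) mod n"
      by (subst (1 2) mod_add_left_eq[symmetric]) (simp only: *)
    then show "a mod n = b mod n" unfolding c by simp
  next
    assume *: "a mod n = b mod n"
    show "(a + c) mod n = (b + c) mod n"
      by (subst (1 2) mod_add_left_eq[symmetric]) (simp only: *)
  qed
  then show ?thesis using n by (simp add: cyc_eq_iff)
qed

lemma cyc_inject:
  assumes "i \<in> {1..n}" "j \<in> {1..n}" "cyc n (i + c) = cyc n (j + c)"
  shows "i = j"
  using assms cyc_add_cancel[of n i c j] cyc_id[OF assms(1)] cyc_id[OF assms(2)] by simp

lemma cyc_reach:
  assumes "n \<ge> 1" "b \<in> {1..n}"
  shows "\<exists>t<n. cyc n (a + t) = b"
proof -
  define t where "t = (b + (n - cyc n a)) mod n"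
  have "cyc n a \<le> n" using cyc_mem[OF assms(1), of a] by simp
  then have "(cyc n a + t) mod n = (b + n) mod n"
    by (simp add: t_def mod_simps)
  then have "cyc n (cyc n a + t) = cyc n b" using assms by (simp add: cyc_eq_iff)
  then show ?thesis
    using assms by (intro exI[of _ t]) (simp add: cyc_add_left cyc_id t_def)
qed


section \<open>Rings with coefficients along the paths of a cyclic quiver\<close>

text \<open>The elements of \<open>R\<close> are given by their coefficients \<open>cf\<close> along the paths \<open>(i, l)\<close> of the cyclic quiver,
  where \<open>i\<close> is the starting vertex and \<open>l\<close> the length; the path \<open>(i, l)\<close> is zero in \<open>R\<close> if \<open>l \<ge> L i\<close>.
  Then \<open>L i\<close> is the length of the projective module \<open>P\<^sub>i\<close> of the paths starting at \<open>i\<close>.\<close>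

locale nakayama_coeffs = ring R for R :: "'r ring" (structure) +
  fixes n :: nat and L :: "nat \<Rightarrow> nat" and cf :: "'r \<Rightarrow> nat \<times> nat \<Rightarrow> 'k::field"
  assumes n_pos: "n \<ge> 1"
    and L_ge2: "i \<in> {1..n} \<Longrightarrow> L i \<ge> 2"
    and L_step: "i \<in> {1..n} \<Longrightarrow> L i \<le> Suc (L (cyc n (i + 1)))"
    and cf_bij: "bij_betw cf (carrier R) {f. \<forall>i l. f (i, l) \<noteq> 0 \<longrightarrow> i \<in> {1..n} \<and> l < L i}"
    and cf_add: "x \<in> carrier R \<Longrightarrow> y \<in> carrier R \<Longrightarrow> cf (x \<oplus> y) p = cf x p + cf y p"
    and cf_one: "cf \<one> (i, l) = (if i \<in> {1..n} \<and> l = 0 then 1 else 0)"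
    and cf_mult: "x \<in> carrier R \<Longrightarrow> y \<in> carrier R \<Longrightarrow> i \<in> {1..n} \<Longrightarrow> l < L i \<Longrightarrow>
      cf (x \<otimes> y) (i, l) = (\<Sum>m\<le>l. cf x (cyc n (i + m), l - m) * cf y (i, m))"
begin

lemma cf_supp: "x \<in> carrier R \<Longrightarrow> cf x (i, l) \<noteq> 0 \<Longrightarrow> i \<in> {1..n} \<and> l < L i"
  using bij_betw_apply[OF cf_bij] by blast

lemma cf_outside: "x \<in> carrier R \<Longrightarrow> \<not> (i \<in> {1..n} \<and> l < L i) \<Longrightarrow> cf x (i, l) = 0"
  using cf_supp by blast

lemma cf_eqI:
  assumes "x \<in> carrier R" "y \<in> carrier R"
    "\<And>i l. i \<in> {1..n} \<Longrightarrow> l < L i \<Longrightarrow> cf x (i, l) = cf y (i, l)"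
  shows "x = y"
proof (rule inj_onD[OF bij_betw_imp_inj_on[OF cf_bij] _ assms(1,2)])
  show "cf x = cf y"
  proof
    fix p :: "nat \<times> nat"
    obtain i l where p: "p = (i, l)" by (cases p)
    show "cf x p = cf y p"
      using assms cf_outside[of x i l] cf_outside[of y i l]
      unfolding p by (cases "i \<in> {1..n} \<and> l < L i") simp_all
  qed
qed

text \<open>The element with given coefficients; those along zero paths are ignored.\<close>

definition mk :: "(nat \<times> nat \<Rightarrow> 'k) \<Rightarrow> 'r"
  where "mk f = inv_into (carrier R) cf (\<lambda>(i, l). if i \<in> {1..n} \<and> l < L i then f (i, l) else 0)"

lemma mk_closed [simp]: "mk f \<in> carrier R"
  and cf_mk: "cf (mk f) (i, l) = (if i \<in> {1..n} \<and> l < L i then f (i, l) else 0)"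
proof -
  let ?f = "\<lambda>(i, l). if i \<in> {1..n} \<and> l < L i then f (i, l) else 0"
  have "?f \<in> cf ` carrier R" using cf_bij by (auto simp: bij_betw_def)
  then have "mk f \<in> carrier R" "cf (mk f) = ?f"
    unfolding mk_def by (rule inv_into_into, rule f_inv_into_f)
  then show "mk f \<in> carrier R" "cf (mk f) (i, l) = (if i \<in> {1..n} \<and> l < L i then f (i, l) else 0)"
    by auto
qed

lemma cf_zero: "cf \<zero> p = 0"
  using cf_add[of \<zero> \<zero> p] by (simp only: zero_closed l_zero) (metis add_cancel_right_right)

lemma cf_minus:
  assumes "x \<in> carrier R" "y \<in> carrier R"
  shows "cf (x \<ominus> y) p = cf x p - cf y p"
proof -
  have "cf (\<ominus> y) p + cf y p = 0" using cf_add[of "\<ominus> y" y p] assms by (simp add: l_neg cf_zero)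
  then show ?thesis using assms by (simp add: minus_eq cf_add eq_neg_iff_add_eq_0)
qed

lemma cf_mult0: "x \<in> carrier R \<Longrightarrow> y \<in> carrier R \<Longrightarrow> cf (x \<otimes> y) (i, 0) = cf x (i, 0) * cf y (i, 0)"
proof (cases "i \<in> {1..n}")
  case True
  moreover assume "x \<in> carrier R" "y \<in> carrier R"
  ultimately show ?thesis using L_ge2[of i] cf_mult[of x y i 0] by (simp add: cyc_id)
next
  case False
  moreover assume "x \<in> carrier R" "y \<in> carrier R"
  ultimately show ?thesis using cf_outside[of x i 0] cf_outside[of "x \<otimes> y" i 0] by auto
qed

text \<open>Diagonal elements \<open>\<Sum>\<^sub>i g i e\<^sub>i\<close>.\<close>

definition diag :: "(nat \<Rightarrow> 'k) \<Rightarrow> 'r"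
  where "diag g = mk (\<lambda>(i, l). if l = 0 then g i else 0)"

lemma diag_closed [simp]: "diag g \<in> carrier R"
  by (simp add: diag_def)

lemma cf_diag: "cf (diag g) (i, l) = (if i \<in> {1..n} \<and> l = 0 then g i else 0)"
  using L_ge2[of i] by (auto simp: diag_def cf_mk)

lemma cf_diag_mult:
  assumes "x \<in> carrier R"
  shows "cf (diag g \<otimes> x) (i, l) = g (cyc n (i + l)) * cf x (i, l)"
proof (cases "i \<in> {1..n} \<and> l < L i")
  case True
  have "cf (diag g \<otimes> x) (i, l) = (\<Sum>m\<le>l. cf (diag g) (cyc n (i + m), l - m) * cf x (i, m))"
    using True assms by (simp add: cf_mult)
  also have "\<dots> = (\<Sum>m\<le>l. if m = l then g (cyc n (i + l)) * cf x (i, l) else 0)"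
    using cyc_mem[OF n_pos] by (intro sum.cong) (auto simp: cf_diag)
  finally show ?thesis by simp
qed (use assms in \<open>simp add: cf_outside\<close>)

lemma cf_mult_diag:
  assumes "x \<in> carrier R"
  shows "cf (x \<otimes> diag g) (i, l) = cf x (i, l) * g i"
proof (cases "i \<in> {1..n} \<and> l < L i")
  case True
  have "cf (x \<otimes> diag g) (i, l) = (\<Sum>m\<le>l. cf x (cyc n (i + m), l - m) * cf (diag g) (i, m))"
    using True assms by (simp add: cf_mult)
  also have "\<dots> = (\<Sum>m\<le>l. if m = 0 then cf x (i, l) * g i else 0)"
    using True by (intro sum.cong) (auto simp: cf_diag cyc_id)
  finally show ?thesis by simp
qed (use assms in \<open>simp add: cf_outside\<close>)

text \<open>The sum \<open>\<alpha>\<close> of all arrows generates the radical, as a left and as a right ideal.\<close>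

definition arr :: 'r
  where "arr = mk (\<lambda>(i, l). if l = 1 then 1 else 0)"

lemma arr_closed [simp]: "arr \<in> carrier R"
  by (simp add: arr_def)

lemma cf_arr: "cf arr (i, l) = (if i \<in> {1..n} \<and> l = 1 then 1 else 0)"
  using L_ge2[of i] by (auto simp: arr_def cf_mk)

lemma cf_arr_mult:
  assumes "x \<in> carrier R"
  shows "cf (arr \<otimes> x) (i, l) = (if 0 < l \<and> l < L i then cf x (i, l - 1) else 0)"
proof (cases "i \<in> {1..n} \<and> l < L i")
  case True
  have "cf (arr \<otimes> x) (i, l) = (\<Sum>m\<le>l. cf arr (cyc n (i + m), l - m) * cf x (i, m))"
    using True assms by (simp add: cf_mult)
  also have "\<dots> = (\<Sum>m\<le>l. if m = l - 1 then (if 0 < l then cf x (i, m) else 0) else 0)"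
    using cyc_mem[OF n_pos] by (intro sum.cong) (auto simp: cf_arr)
  finally show ?thesis using True by auto
qed (use assms in \<open>auto simp: cf_outside\<close>)

lemma radical_factor:
  assumes "x \<in> carrier R" "\<And>i. i \<in> {1..n} \<Longrightarrow> cf x (i, 0) = 0"
  obtains y where "y \<in> carrier R" "x = arr \<otimes> y"
proof -
  define y where "y = mk (\<lambda>(i, l). cf x (i, l + 1))"
  have "x = arr \<otimes> y"
  proof (rule cf_eqI)
    fix i l assume "i \<in> {1..n}" "l < L i"
    then show "cf x (i, l) = cf (arr \<otimes> y) (i, l)"
      using assms(2)[of i] by (cases l) (auto simp: cf_arr_mult y_def cf_mk)
  qed (use assms in \<open>auto simp: y_def\<close>)
  then show thesis by (intro that[of y]) (auto simp: y_def)
qed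

lemma mult_arr_factor:
  assumes "x \<in> carrier R"
  obtains y where "y \<in> carrier R" "x \<otimes> arr = arr \<otimes> y"
proof -
  have "cf (x \<otimes> arr) (i, 0) = 0" for i
    using assms by (simp add: cf_mult0 cf_arr)
  then obtain y where "y \<in> carrier R" "x \<otimes> arr = arr \<otimes> y"
    using assms by (auto intro: radical_factor[of "x \<otimes> arr"])
  then show thesis by (rule that)
qed

lemma arr_nilpotent: obtains D where "arr [^] (D :: nat) = \<zero>"
proof -
  define D where "D = Max (L ` {1..n})"
  have *: "cf (arr [^] t) (i, l) = 0" if "l < t" for t i l
    using that
  proof (induction t arbitrary: l)
    case (Suc t)
    have "arr [^] Suc t = arr \<otimes> arr [^] t"
      by (rule nat_pow_Suc2) simp
    then show ?case using Suc.IH[of "l - 1"] Suc.prems by (auto simp: cf_arr_mult)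
  qed simp
  have "arr [^] D = \<zero>"
  proof (rule cf_eqI)
    fix i l assume "i \<in> {1..n}" "l < L i"
    moreover from this have "L i \<le> D" unfolding D_def by (intro Max_ge) auto
    ultimately show "cf (arr [^] D) (i, l) = cf \<zero> (i, l)" by (simp add: * cf_zero)
  qed simp_all
  then show thesis by (rule that)
qed

text \<open>The path of length \<open>s\<close> starting at the vertex \<open>a\<close>.\<close>

definition bp :: "nat \<Rightarrow> nat \<Rightarrow> 'r"
  where "bp a s = mk (\<lambda>p. if p = (a, s) then 1 else 0)"

lemma bp_closed [simp]: "bp a s \<in> carrier R"
  by (simp add: bp_def)

lemma cf_bp: "cf (bp a s) (i, l) = (if i \<in> {1..n} \<and> l < L i \<and> i = a \<and> l = s then 1 else 0)"
  by (auto simp: bp_def cf_mk)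

lemma cf_bp_mult:
  assumes "x \<in> carrier R" "s < L a" "i \<in> {1..n}"
  shows "cf (bp a s \<otimes> x) (i, l) =
    (if s \<le> l \<and> l < L i \<and> cyc n (i + (l - s)) = a then cf x (i, l - s) else 0)"
proof (cases "l < L i")
  case True
  have "cf (bp a s \<otimes> x) (i, l) = (\<Sum>m\<le>l. cf (bp a s) (cyc n (i + m), l - m) * cf x (i, m))"
    using True assms by (simp add: cf_mult)
  also have "\<dots> = (\<Sum>m\<le>l. if m = l - s then
      (if s \<le> l \<and> cyc n (i + (l - s)) = a then cf x (i, l - s) else 0) else 0)"
  proof (rule sum.cong[OF refl])
    fix m assume m: "m \<in> {..l}"
    have c: "cf (bp a s) (cyc n (i + m), l - m) = (if cyc n (i + m) = a \<and> l - m = s then 1 else 0)"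
      using cyc_mem[OF n_pos, of "i + m"] assms(2) unfolding cf_bp by fastforce
    have "l - m = s \<longleftrightarrow> s \<le> l \<and> m = l - s" using m by auto
    then show "cf (bp a s) (cyc n (i + m), l - m) * cf x (i, m) = (if m = l - s then
        (if s \<le> l \<and> cyc n (i + (l - s)) = a then cf x (i, l - s) else 0) else 0)"
      unfolding c by auto
  qed
  finally show ?thesis using True by simp
qed (use assms in \<open>simp add: cf_outside\<close>)


section \<open>Splitting of maps that reflect the radical\<close>

text \<open>An endomorphism that is the identity modulo the radical has a left inverse.  If \<open>1 - V T\<close> has its image
  in \<open>\<alpha>\<^sup>t M\<close>, then \<open>V' = V + (1 - V T)\<close> satisfies \<open>1 - V' T = (1 - V T) (1 - T)\<close>, whose image is in
  \<open>\<alpha>\<^sup>t\<^sup>+\<^sup>1 M\<close>; and \<open>\<alpha>\<close> is nilpotent.\<close>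

lemma unipotent_left_inverse:
  assumes M: "left_module R M" and T: "T \<in> mod_hom R M M"
    and unip: "\<And>z. z \<in> carrier M \<Longrightarrow> \<exists>w\<in>carrier M. z \<ominus>\<^bsub>M\<^esub> T z = arr \<odot>\<^bsub>M\<^esub> w"
  obtains V where "V \<in> mod_hom R M M" "\<And>z. z \<in> carrier M \<Longrightarrow> V (T z) = z"
proof -
  interpret M: left_module R M by fact
  have id: "(\<lambda>z. z) \<in> mod_hom R M M" by (rule mod_homI) simp_all
  note T_cl = mod_hom_closed[OF T]
  have *: "\<exists>V\<in>mod_hom R M M. \<forall>z\<in>carrier M. \<exists>w\<in>carrier M. z \<ominus>\<^bsub>M\<^esub> V (T z) = (arr [^] t) \<odot>\<^bsub>M\<^esub> w"
    for t :: nat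
  proof (induction t)
    case 0
    have "(\<lambda>z. \<zero>\<^bsub>M\<^esub>) \<in> mod_hom R M M" by (rule mod_homI) simp_all
    then show ?case by (rule bexI[rotated]) (auto simp: M.M.minus_eq)
  next
    case (Suc t)
    then obtain V where V: "V \<in> mod_hom R M M"
      "\<And>z. z \<in> carrier M \<Longrightarrow> \<exists>w\<in>carrier M. z \<ominus>\<^bsub>M\<^esub> V (T z) = (arr [^] t) \<odot>\<^bsub>M\<^esub> w"
      by blast
    note V_cl = mod_hom_closed[OF V(1)]
    define W where "W z = z \<ominus>\<^bsub>M\<^esub> V (T z)" for z
    have W: "W \<in> mod_hom R M M"
      unfolding W_def by (intro mod_hom_difference M id mod_hom_comp[OF T V(1)])
    define V' where "V' z = W z \<oplus>\<^bsub>M\<^esub> V z" for z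
    have "V' \<in> mod_hom R M M"
      unfolding V'_def by (rule mod_hom_sum[OF M W V(1)])
    moreover have "\<exists>w\<in>carrier M. z \<ominus>\<^bsub>M\<^esub> V' (T z) = (arr [^] Suc t) \<odot>\<^bsub>M\<^esub> w" if z: "z \<in> carrier M" for z
    proof -
      obtain w where w: "w \<in> carrier M" "z \<ominus>\<^bsub>M\<^esub> T z = arr \<odot>\<^bsub>M\<^esub> w" using unip[OF z] by blast
      obtain v where v: "v \<in> carrier M" "W w = (arr [^] t) \<odot>\<^bsub>M\<^esub> v"
        using V(2)[OF w(1)] unfolding W_def by blast
      note c = z T_cl[OF z] V_cl[OF T_cl[OF z]] mod_hom_closed[OF W z] mod_hom_closed[OF W T_cl[OF z]]
      have "z \<ominus>\<^bsub>M\<^esub> V' (T z) = W z \<ominus>\<^bsub>M\<^esub> W (T z)"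
      proof -
        have "z = W z \<oplus>\<^bsub>M\<^esub> V (T z)"
          using c by (simp add: W_def M.M.minus_eq M.M.a_assoc M.M.l_neg)
        then have "z \<ominus>\<^bsub>M\<^esub> V' (T z) = (W z \<oplus>\<^bsub>M\<^esub> V (T z)) \<ominus>\<^bsub>M\<^esub> (W (T z) \<oplus>\<^bsub>M\<^esub> V (T z))"
          unfolding V'_def by simp
        also have "\<dots> = W z \<ominus>\<^bsub>M\<^esub> W (T z)"
          using c by (simp add: M.M.minus_eq M.M.minus_add M.M.a_ac M.M.r_neg2 M.M.r_neg1 M.M.r_neg)
        finally show ?thesis .
      qed
      also have "\<dots> = W (arr \<odot>\<^bsub>M\<^esub> w)"
        using mod_hom_diff[OF M M W z T_cl[OF z]] w(2) by simp
      also have "\<dots> = arr \<odot>\<^bsub>M\<^esub> ((arr [^] t) \<odot>\<^bsub>M\<^esub> v)"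
        using mod_hom_smult[OF W arr_closed w(1)] v(2) by simp
      also have "\<dots> = (arr [^] Suc t) \<odot>\<^bsub>M\<^esub> v"
        using v(1) by (simp only: nat_pow_Suc2[OF arr_closed] M.smult_assoc arr_closed nat_pow_closed)
      finally show ?thesis using v(1) by blast
    qed
    ultimately show ?case by blast
  qed
  obtain D :: nat where D: "arr [^] D = \<zero>" by (rule arr_nilpotent)
  obtain V where V: "V \<in> mod_hom R M M"
    "\<And>z. z \<in> carrier M \<Longrightarrow> \<exists>w\<in>carrier M. z \<ominus>\<^bsub>M\<^esub> V (T z) = (arr [^] D) \<odot>\<^bsub>M\<^esub> w"
    using *[of D] by blast
  have "V (T z) = z" if z: "z \<in> carrier M" for z
  proof -
    have c: "V (T z) \<in> carrier M" by (intro mod_hom_closed[OF V(1)] T_cl z)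
    have "z \<ominus>\<^bsub>M\<^esub> V (T z) = \<zero>\<^bsub>M\<^esub>" using V(2)[OF z] D by auto
    moreover have "(z \<ominus>\<^bsub>M\<^esub> V (T z)) \<oplus>\<^bsub>M\<^esub> V (T z) = z"
      using c z by (simp add: M.M.minus_eq M.M.a_assoc M.M.l_neg)
    ultimately show ?thesis using c by simp
  qed
  with V(1) show thesis by (rule that)
qed

text \<open>A map to a free module splits if it reflects the radical.  The coordinates of \<open>g z\<close> modulo the radical
  are the coefficients at the trivial paths of its entries.  Gaussian elimination, in the form of a largest set
  of coordinates with a dual system of elements of \<open>M\<close>, provides a retraction modulo the radical.\<close>

lemma split_mono:
  assumes M: "left_module R M" and g: "g \<in> mod_hom R M (free_module R m)"
    and refl: "\<And>z. z \<in> carrier M \<Longrightarrow> (\<forall>s<m. \<forall>j\<in>{1..n}. cf (g z s) (j, 0) = 0) \<Longrightarrow>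
      \<exists>w\<in>carrier M. z = arr \<odot>\<^bsub>M\<^esub> w"
  obtains \<rho> where "\<rho> \<in> mod_hom R (free_module R m) M" "\<And>z. z \<in> carrier M \<Longrightarrow> \<rho> (g z) = z"
proof -
  interpret M: left_module R M by fact
  note F = free_module_left_module[of m]
  interpret F: left_module R "free_module R m" by (rule F)
  define co where "co b z = cf (g z (fst b)) (snd b, 0)" for b z
  have nth: "g z s \<in> carrier R" if "z \<in> carrier M" for z s
    by (rule free_module_nth[OF mod_hom_closed[OF g that]])
  have co_add: "co b (y \<oplus>\<^bsub>M\<^esub> z) = co b y + co b z" if "y \<in> carrier M" "z \<in> carrier M" for b y z
    using that nth by (simp add: co_def mod_hom_add[OF g] cf_add)
  have co_zero: "co b \<zero>\<^bsub>M\<^esub> = 0" for b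
    by (simp add: co_def mod_hom_zero[OF M F g] cf_zero)
  have co_smult: "co b (a \<odot>\<^bsub>M\<^esub> z) = cf a (snd b, 0) * co b z" if "a \<in> carrier R" "z \<in> carrier M" for a b z
    using that nth by (simp add: co_def mod_hom_smult[OF g] cf_mult0)
  have co_minus: "co b (y \<ominus>\<^bsub>M\<^esub> z) = co b y - co b z" if "y \<in> carrier M" "z \<in> carrier M" for b y z
    using co_add[of "y \<ominus>\<^bsub>M\<^esub> z" z b] that by (simp add: M.M.minus_eq M.M.a_assoc M.M.l_neg)
  have co_finsum: "co b (finsum M f B) = (\<Sum>c\<in>B. co b (f c))" if "finite B" "f \<in> B \<rightarrow> carrier M"
    for b f and B :: "(nat \<times> nat) set"
    using that by (induction B rule: finite_induct) (auto simp: co_zero co_add Pi_def)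
  define good where "good B x \<longleftrightarrow> B \<subseteq> {..<m} \<times> {1..n} \<and> (\<forall>b\<in>B. x b \<in> carrier M) \<and>
    (\<forall>b\<in>B. \<forall>c\<in>B. co c (x b) = (if b = c then 1 else 0))" for B x
  have fin: "finite B" if "good B x" for B x
    using that finite_subset[of B "{..<m} \<times> {1..n}"] by (simp add: good_def)
  have "\<exists>B. (\<exists>x. good B x) \<and> (\<forall>B'. (\<exists>x. good B' x) \<longrightarrow> card B' \<le> card B)"
  proof (rule ex_has_greatest_nat[where k = "{}" and b = "m * n + 1"])
    show "\<exists>x. good {} x" by (simp add: good_def)
    show "\<forall>B. (\<exists>x. good B x) \<longrightarrow> card B < m * n + 1"
    proof (intro allI impI)
      fix B assume "\<exists>x. good B x"
      then have "B \<subseteq> {..<m} \<times> {1..n}" by (auto simp: good_def)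
      then have "card B \<le> card ({..<m} \<times> {1..n})" by (intro card_mono) auto
      then show "card B < m * n + 1" by simp
    qed
  qed
  then obtain B x where B: "good B x" and B_max: "\<And>B' y. good B' y \<Longrightarrow> card B' \<le> card B"
    by blast
  have x: "x b \<in> carrier M" if "b \<in> B" for b using B that by (simp add: good_def)
  \<comment> \<open>A common zero of all coordinates in \<open>B\<close> that is not in the radical would enlarge \<open>B\<close>.\<close>
  have zero_in_rad: "\<exists>w\<in>carrier M. z = arr \<odot>\<^bsub>M\<^esub> w"
    if z: "z \<in> carrier M" and z0: "\<And>b. b \<in> B \<Longrightarrow> co b z = 0" for z
  proof (rule refl[OF z], rule ccontr)
    assume "\<not> (\<forall>s<m. \<forall>j\<in>{1..n}. cf (g z s) (j, 0) = 0)"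
    then obtain s j where sj: "s < m" "j \<in> {1..n}" and nz: "co (s, j) z \<noteq> 0"
      by (auto simp: co_def)
    define e where "e c = diag (\<lambda>i. if i = j then c else 0)" for c
    have e: "e c \<in> carrier R" "cf (e c) (i, 0) = (if i = j then c else 0)" for c i
      using sj by (auto simp: e_def cf_diag)
    define y where "y = e (1 / co (s, j) z) \<odot>\<^bsub>M\<^esub> z"
    have y: "y \<in> carrier M" "co (s, j) y = 1" "\<And>b. b \<in> B \<Longrightarrow> co b y = 0"
      using z e nz z0 by (auto simp: y_def co_smult)
    define x' where "x' b = (if b = (s, j) then y else x b \<ominus>\<^bsub>M\<^esub> e (co (s, j) (x b)) \<odot>\<^bsub>M\<^esub> y)" for b
    have new: "(s, j) \<notin> B" using z0 nz by blast
    have "good (insert (s, j) B) x'"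
      unfolding good_def
    proof (intro conjI ballI)
      show "insert (s, j) B \<subseteq> {..<m} \<times> {1..n}" using B sj by (auto simp: good_def)
      fix b assume b: "b \<in> insert (s, j) B"
      show "x' b \<in> carrier M"
        using b x[of b] y(1) e(1) by (auto simp: x'_def intro!: M.M.minus_closed M.smult_closed)
      fix c assume c: "c \<in> insert (s, j) B"
      have "co c (x b) = (if b = c then 1 else 0)" if "b \<in> B" "c \<in> B"
        using B that by (auto simp: good_def)
      then show "co c (x' b) = (if b = c then 1 else 0)"
        using b c x y e new by (cases "b = (s, j)"; cases "c = (s, j)")
          (auto simp: x'_def co_minus co_smult)
    qed
    then have "card (insert (s, j) B) \<le> card B" by (rule B_max)
    then show False using new fin[OF B] by simp
  qed
  define r where "r y = finsum M (\<lambda>b. (y (fst b) \<otimes> diag (\<lambda>i. if i = snd b then 1 else 0)) \<odot>\<^bsub>M\<^esub> x b) B" for y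
  have r: "r \<in> mod_hom R (free_module R m) M"
    unfolding r_def
  proof (rule mod_hom_finsum[OF M fin[OF B]])
    fix b assume b: "b \<in> B"
    define d where "d = diag (\<lambda>i. if i = snd b then 1 else 0)"
    have d: "d \<in> carrier R" by (simp add: d_def)
    have "(\<lambda>y. (y (fst b) \<otimes> d) \<odot>\<^bsub>M\<^esub> x b) \<in> mod_hom R (free_module R m) M"
    proof (rule mod_homI)
      fix y z assume "y \<in> carrier (free_module R m)" "z \<in> carrier (free_module R m)"
      note c = free_module_nth[OF this(1)] free_module_nth[OF this(2)]
      show "((y \<oplus>\<^bsub>free_module R m\<^esub> z) (fst b) \<otimes> d) \<odot>\<^bsub>M\<^esub> x b =
          (y (fst b) \<otimes> d) \<odot>\<^bsub>M\<^esub> x b \<oplus>\<^bsub>M\<^esub> (z (fst b) \<otimes> d) \<odot>\<^bsub>M\<^esub> x b"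
        using c d x[OF b] by (simp add: l_distr M.smult_l_distr)
    next
      fix a y assume a: "a \<in> carrier R" and "y \<in> carrier (free_module R m)"
      note c = free_module_nth[OF this(2)]
      show "((a \<odot>\<^bsub>free_module R m\<^esub> y) (fst b) \<otimes> d) \<odot>\<^bsub>M\<^esub> x b = a \<odot>\<^bsub>M\<^esub> ((y (fst b) \<otimes> d) \<odot>\<^bsub>M\<^esub> x b)"
        using a c d x[OF b] by (simp add: M.smult_assoc)
    next
      fix y assume "y \<in> carrier (free_module R m)"
      note c = free_module_nth[OF this]
      show "(y (fst b) \<otimes> d) \<odot>\<^bsub>M\<^esub> x b \<in> carrier M"
        using c d x[OF b] by (intro M.smult_closed m_closed)
    qed
    then show "(\<lambda>y. (y (fst b) \<otimes> diag (\<lambda>i. if i = snd b then 1 else 0)) \<odot>\<^bsub>M\<^esub> x b)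
        \<in> mod_hom R (free_module R m) M"
      by (simp add: d_def)
  qed
  have T: "(\<lambda>z. r (g z)) \<in> mod_hom R M M" by (rule mod_hom_comp[OF g r])
  have unip: "\<exists>w\<in>carrier M. z \<ominus>\<^bsub>M\<^esub> r (g z) = arr \<odot>\<^bsub>M\<^esub> w" if z: "z \<in> carrier M" for z
  proof (rule zero_in_rad)
    show "z \<ominus>\<^bsub>M\<^esub> r (g z) \<in> carrier M" using z mod_hom_closed[OF T z] by simp
    fix b assume b: "b \<in> B"
    then have b': "snd b \<in> {1..n}" using B by (auto simp: good_def)
    have "co b (r (g z)) = (\<Sum>c\<in>B. co b ((g z (fst c) \<otimes> diag (\<lambda>i. if i = snd c then 1 else 0)) \<odot>\<^bsub>M\<^esub> x c))"
      unfolding r_def using nth[OF z] x by (intro co_finsum fin[OF B]) auto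
    also have "\<dots> = (\<Sum>c\<in>B. if c = b then co b z else 0)"
    proof (rule sum.cong[OF HOL.refl])
      fix c assume c: "c \<in> B"
      have "co b (x c) = (if c = b then 1 else 0)" using B b c by (auto simp: good_def)
      moreover have "cf (g z (fst c)) (snd b, 0) = co b z" if "c = b" using that by (simp add: co_def)
      ultimately show "co b ((g z (fst c) \<otimes> diag (\<lambda>i. if i = snd c then 1 else 0)) \<odot>\<^bsub>M\<^esub> x c)
          = (if c = b then co b z else 0)"
        using nth[OF z] x[OF c] b' by (simp add: co_smult cf_mult_diag)
    qed
    also have "\<dots> = co b z" using b fin[OF B] by simp
    finally show "co b (z \<ominus>\<^bsub>M\<^esub> r (g z)) = 0"
      using z mod_hom_closed[OF T z] by (simp add: co_minus)
  qed
  obtain V where V: "V \<in> mod_hom R M M" "\<And>z. z \<in> carrier M \<Longrightarrow> V (r (g z)) = z"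
    using unipotent_left_inverse[OF M T unip] by blast
  show thesis
    by (rule that[of "\<lambda>y. V (r y)"]) (use mod_hom_comp[OF r V(1)] V(2) in auto)
qed


section \<open>Second syzygies\<close>

text \<open>An element of a projective module is in the radical if its image in a free module is.\<close>

lemma projective_radical:
  assumes P: "left_module R P" and i: "i \<in> mod_hom R P (free_module R m)"
    and p: "p \<in> mod_hom R (free_module R m) P" and pi: "\<forall>x\<in>carrier P. p (i x) = x"
    and x: "x \<in> carrier P" and zero: "\<And>s j. s < m \<Longrightarrow> j \<in> {1..n} \<Longrightarrow> cf (i x s) (j, 0) = 0"
  shows "\<exists>y\<in>carrier P. x = arr \<odot>\<^bsub>P\<^esub> y"
proof -
  have ix: "i x \<in> carrier (free_module R m)" by (rule mod_hom_closed[OF i x])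
  have "\<exists>y\<in>carrier R. i x s = arr \<otimes> y" if "s < m" for s
    using radical_factor[OF free_module_nth[OF ix] zero[OF that]] by blast
  then obtain w where w: "\<And>s. s < m \<Longrightarrow> w s \<in> carrier R" "\<And>s. s < m \<Longrightarrow> i x s = arr \<otimes> w s"
    by metis
  define v where "v s = (if s < m then w s else \<zero>)" for s
  have v: "v \<in> carrier (free_module R m)" using w by (auto simp: v_def)
  have "i x = arr \<odot>\<^bsub>free_module R m\<^esub> v"
  proof
    fix s
    show "i x s = (arr \<odot>\<^bsub>free_module R m\<^esub> v) s"
      using ix w(2)[of s] by (cases "s < m") (simp_all add: v_def)
  qed
  then have "x = arr \<odot>\<^bsub>P\<^esub> p v"
    using mod_hom_smult[OF p arr_closed v] bspec[OF pi x] by simp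
  then show ?thesis using mod_hom_closed[OF p v] by blast
qed

text \<open>The idempotent \<open>\<Sum>\<^sub>i\<^sub>\<in>\<^sub>E e\<^sub>i\<close>.\<close>

definition chi :: "nat set \<Rightarrow> 'r"
  where "chi E = diag (\<lambda>i. if i \<in> E then 1 else 0)"

lemma chi_closed [simp]: "chi E \<in> carrier R"
  by (simp add: chi_def)

lemma cf_chi: "cf (chi E) (i, l) = (if i \<in> {1..n} \<and> i \<in> E \<and> l = 0 then 1 else 0)"
  by (simp add: chi_def cf_diag)

lemma cf_chi_mult: "x \<in> carrier R \<Longrightarrow> cf (chi E \<otimes> x) (i, l) = (if cyc n (i + l) \<in> E then cf x (i, l) else 0)"
  by (simp add: chi_def cf_diag_mult)

lemma cf_mult_chi: "x \<in> carrier R \<Longrightarrow> cf (x \<otimes> chi E) (i, l) = (if i \<in> E then cf x (i, l) else 0)"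
  by (simp add: chi_def cf_mult_diag)

lemma chi_idem: "chi E \<otimes> chi E = chi E"
  by (rule cf_eqI) (simp_all add: cf_mult_chi cf_chi)

lemma arr_chi:
  assumes "E \<subseteq> {1..n}"
  shows "arr \<otimes> chi E = chi ((\<lambda>i. cyc n (i + 1)) ` E) \<otimes> arr"
proof (rule cf_eqI)
  fix i l assume i: "i \<in> {1..n}"
  have "cyc n (i + 1) \<in> (\<lambda>i. cyc n (i + 1)) ` E \<longleftrightarrow> i \<in> E"
    using cyc_inject[OF i, of _ 1] assms by (auto simp del: One_nat_def)
  then show "cf (arr \<otimes> chi E) (i, l) = cf (chi ((\<lambda>i. cyc n (i + 1)) ` E) \<otimes> arr) (i, l)"
    by (auto simp: cf_mult_chi cf_chi_mult cf_arr)
qed simp_all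

text \<open>If all socles of indecomposable projectives are at vertices in \<open>E\<close>, then so is the socle of every
  projective module.\<close>

lemma projective_socle:
  assumes P: "fg_projective R P" and x: "x \<in> carrier P"
    and E: "\<And>i. i \<in> {1..n} \<Longrightarrow> cyc n (i + L i - 1) \<in> E"
    and "arr \<odot>\<^bsub>P\<^esub> x = \<zero>\<^bsub>P\<^esub>" "chi E \<odot>\<^bsub>P\<^esub> x = \<zero>\<^bsub>P\<^esub>"
  shows "x = \<zero>\<^bsub>P\<^esub>"
proof -
  note P' = fg_projective_left_module[OF P]
  interpret P: left_module R P by (rule P')
  obtain i m p where i: "i \<in> mod_hom R P (free_module R m)"
    and p: "p \<in> mod_hom R (free_module R m) P" and pi: "\<forall>x\<in>carrier P. p (i x) = x"
    by (rule fg_projectiveE[OF P])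
  note F = free_module_left_module[of m]
  have nth: "i x s \<in> carrier R" for s by (rule free_module_nth[OF mod_hom_closed[OF i x]])
  have "i x s = \<zero>" for s
  proof (rule cf_eqI)
    fix j l assume jl: "j \<in> {1..n}" "l < L j"
    have "arr \<otimes> i x s = \<zero>" "chi E \<otimes> i x s = \<zero>"
      using assms(4,5) mod_hom_smult[OF i arr_closed x] mod_hom_smult[OF i chi_closed x]
        mod_hom_zero[OF P' F i] by (simp_all add: fun_eq_iff) metis+
    then have a: "cf (arr \<otimes> i x s) (j, Suc l) = 0" and c: "cf (chi E \<otimes> i x s) (j, l) = 0"
      by (simp_all add: cf_zero)
    show "cf (i x s) (j, l) = cf \<zero> (j, l)"
    proof (cases "Suc l < L j")
      case True
      then show ?thesis using a nth by (simp add: cf_arr_mult cf_zero)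
    next
      case False
      then have "j + L j - 1 = j + l" using jl by simp
      then have "cyc n (j + l) \<in> E" using E[OF jl(1)] by simp
      then show ?thesis using c nth by (simp add: cf_chi_mult cf_zero)
    qed
  qed (use nth in auto)
  then have "i x = i \<zero>\<^bsub>P\<^esub>" using mod_hom_zero[OF P' F i] by auto
  then have "p (i x) = p (i \<zero>\<^bsub>P\<^esub>)" by simp
  then show ?thesis using pi x P.M.zero_closed by simp
qed

text \<open>If the kernel \<open>K\<close> of a map \<open>P \<rightarrow> Q\<close> is projective, then \<open>K \<inter> rad P = rad K\<close>, provided that
  the socles of the indecomposable projectives are at vertices in \<open>E\<close> and that \<open>P\<^sub>i\<^sub>+\<^sub>1\<close> is not
  isomorphic to the radical of \<open>P\<^sub>i\<close> for \<open>i \<in> E\<close>.\<close>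

lemma kernel_reflects_radical:
  assumes E: "E \<subseteq> {1..n}" "\<And>i. i \<in> E \<Longrightarrow> L i \<le> L (cyc n (i + 1))"
    "\<And>i. i \<in> {1..n} \<Longrightarrow> cyc n (i + L i - 1) \<in> E"
    and K: "fg_projective R K" and P: "left_module R P" and Q: "fg_projective R Q"
    and g: "g \<in> mod_hom R K P" "inj_on g (carrier K)" and f: "f \<in> mod_hom R P Q"
    and exact: "g ` carrier K = a_kernel P Q f"
    and z: "z \<in> carrier K" and y: "y \<in> carrier P" and gz: "g z = arr \<odot>\<^bsub>P\<^esub> y"
  shows "\<exists>w\<in>carrier K. z = arr \<odot>\<^bsub>K\<^esub> w"
proof -
  note K' = fg_projective_left_module[OF K] and Q' = fg_projective_left_module[OF Q]
  interpret K: left_module R K by (rule K')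
  interpret P: left_module R P by (rule P)
  interpret Q: left_module R Q by (rule Q')
  define E1 where "E1 = (\<lambda>i. cyc n (i + 1)) ` E"
  define c where "c = \<one> \<ominus> chi E"
  have c: "c \<in> carrier R" by (simp add: c_def)
  have E1: "E1 \<subseteq> {1..n}" unfolding E1_def by (rule image_subsetI) (rule cyc_mem[OF n_pos])
  have ac: "chi E1 \<otimes> arr = arr \<otimes> chi E" unfolding E1_def by (rule arr_chi[OF E(1), symmetric])
  have arrc: "arr \<otimes> c = (\<one> \<ominus> chi E1) \<otimes> arr"
    by (simp add: c_def minus_eq r_distr l_distr r_minus l_minus ac)
  have ec: "chi E \<otimes> c = \<zero>"
    by (simp add: c_def minus_eq r_distr r_minus chi_idem r_neg)
  have fg: "f (g v) = \<zero>\<^bsub>Q\<^esub>" if "v \<in> carrier K" for v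
  proof -
    have "g v \<in> a_kernel P Q f" using that unfolding exact[symmetric] by (rule imageI)
    then show ?thesis by (simp add: a_kernel_def')
  qed
  \<comment> \<open>The part \<open>u\<close> of \<open>y\<close> at vertices outside \<open>E\<close> is mapped to an element of \<open>Q\<close> annihilated by the
    radical, which vanishes because the socle of \<open>Q\<close> is at vertices in \<open>E\<close>.\<close>
  define u where "u = c \<odot>\<^bsub>P\<^esub> y"
  have u: "u \<in> carrier P" using c y by (simp add: u_def)
  have fu: "f u \<in> carrier Q" by (rule mod_hom_closed[OF f u])
  have "f u = \<zero>\<^bsub>Q\<^esub>"
  proof (rule projective_socle[OF Q fu E(3)])
    have "arr \<odot>\<^bsub>P\<^esub> u = (\<one> \<ominus> chi E1) \<odot>\<^bsub>P\<^esub> g z"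
      using c y by (simp add: u_def gz P.smult_assoc[symmetric] arrc)
    then show "arr \<odot>\<^bsub>Q\<^esub> f u = \<zero>\<^bsub>Q\<^esub>"
      using mod_hom_smult[OF f _ u, of arr] fg[OF z]
        mod_hom_smult[OF f _ mod_hom_closed[OF g(1) z], of "\<one> \<ominus> chi E1"] by simp
    have "chi E \<odot>\<^bsub>P\<^esub> u = \<zero>\<^bsub>P\<^esub>"
      using c y by (simp add: u_def P.smult_assoc[symmetric] ec)
    then show "chi E \<odot>\<^bsub>Q\<^esub> f u = \<zero>\<^bsub>Q\<^esub>"
      using mod_hom_smult[OF f _ u, of "chi E"] mod_hom_zero[OF P Q' f] by simp
  qed
  then have "u \<in> g ` carrier K" unfolding exact using u by (simp add: a_kernel_def')
  then obtain v where v: "v \<in> carrier K" "u = g v" by blast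
  define z' where "z' = z \<ominus>\<^bsub>K\<^esub> arr \<odot>\<^bsub>K\<^esub> v"
  have z': "z' \<in> carrier K" using z v(1) by (simp add: z'_def)
  have gz': "g z' = (arr \<otimes> chi E) \<odot>\<^bsub>P\<^esub> y"
  proof -
    have "arr \<ominus> arr \<otimes> c = arr \<otimes> chi E"
    proof -
      have "arr \<otimes> c = arr \<ominus> arr \<otimes> chi E" by (simp add: c_def minus_eq r_distr r_minus)
      then show ?thesis by (intro cf_eqI) (simp_all add: cf_minus)
    qed
    moreover have "g z' = (arr \<ominus> arr \<otimes> c) \<odot>\<^bsub>P\<^esub> y"
      using z v(1) c y mod_hom_diff[OF K' P g(1) z, of "arr \<odot>\<^bsub>K\<^esub> v"]
        mod_hom_smult[OF g(1) arr_closed v(1)]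
      by (simp add: z'_def gz v(2)[symmetric] u_def P.smult_diff_left P.smult_assoc)
    ultimately show ?thesis by simp
  qed
  have e1: "chi E1 \<odot>\<^bsub>K\<^esub> z' = z'"
  proof (rule inj_onD[OF g(2)])
    have "chi E1 \<otimes> (arr \<otimes> chi E) = (chi E1 \<otimes> arr) \<otimes> chi E" by (simp add: m_assoc)
    also have "\<dots> = (arr \<otimes> chi E) \<otimes> chi E" by (simp only: ac)
    also have "\<dots> = arr \<otimes> chi E" by (simp add: m_assoc chi_idem)
    finally show "g (chi E1 \<odot>\<^bsub>K\<^esub> z') = g z'"
      using mod_hom_smult[OF g(1) chi_closed z', of E1] y
      by (simp add: gz' P.smult_assoc[symmetric])
  qed (use z' in auto)
  \<comment> \<open>The longest nonzero path starting at \<open>i\<close> annihilates \<open>z'\<close>, since prolonging it backwards by the arrow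
    that ends at \<open>i\<close> gives a zero path.\<close>
  have soc: "bp i (L i - 1) \<odot>\<^bsub>K\<^esub> z' = \<zero>\<^bsub>K\<^esub>" if i: "i \<in> E1" for i
  proof (rule inj_onD[OF g(2)])
    have Li: "L i - 1 < L i" using i E1 L_ge2[of i] by (simp add: subset_iff)
    have "bp i (L i - 1) \<otimes> (arr \<otimes> chi E) = \<zero>"
    proof (rule cf_eqI)
      fix j l assume jl: "j \<in> {1..n}" "l < L j"
      show "cf (bp i (L i - 1) \<otimes> (arr \<otimes> chi E)) (j, l) = cf \<zero> (j, l)"
      proof (rule ccontr)
        assume "\<not> ?thesis"
        then have nz: "cf (bp i (L i - 1) \<otimes> (arr \<otimes> chi E)) (j, l) \<noteq> 0" by (simp add: cf_zero)
        have a: "L i - 1 \<le> l" "cyc n (j + (l - (L i - 1))) = i"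
          and b: "cf (arr \<otimes> chi E) (j, l - (L i - 1)) \<noteq> 0"
          using nz unfolding cf_bp_mult[OF m_closed[OF arr_closed chi_closed] Li jl(1)]
          by (simp_all split: if_splits)
        have *: "j \<in> E" "l - (L i - 1) = 1"
          using b by (simp_all add: cf_mult_chi cf_arr split: if_splits)
        then have i_eq: "cyc n (j + 1) = i" using a by simp
        have "L j \<le> L i" using E(2)[OF *(1)] unfolding i_eq .
        then show False using * a jl by simp
      qed
    qed simp_all
    then show "g (bp i (L i - 1) \<odot>\<^bsub>K\<^esub> z') = g \<zero>\<^bsub>K\<^esub>"
      using mod_hom_smult[OF g(1) bp_closed z', of i "L i - 1"] y mod_hom_zero[OF K' P g(1)]
      by (simp add: gz' P.smult_assoc[symmetric])
  qed (use z' in auto)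
  obtain i m p where i: "i \<in> mod_hom R K (free_module R m)"
    and p: "p \<in> mod_hom R (free_module R m) K" and pi: "\<forall>x\<in>carrier K. p (i x) = x"
    by (rule fg_projectiveE[OF K])
  note F = free_module_left_module[of m]
  have nth: "i z' s \<in> carrier R" for s by (rule free_module_nth[OF mod_hom_closed[OF i z']])
  have "\<exists>w\<in>carrier K. z' = arr \<odot>\<^bsub>K\<^esub> w"
  proof (rule projective_radical[OF K' i p pi z'])
    fix s j assume j: "j \<in> {1..n}"
    show "cf (i z' s) (j, 0) = 0"
    proof (cases "j \<in> E1")
      case True
      have "bp j (L j - 1) \<otimes> i z' s = \<zero>"
        using soc[OF True] mod_hom_smult[OF i bp_closed z', of j "L j - 1"] mod_hom_zero[OF K' F i]
        by (simp add: fun_eq_iff)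
      then have "cf (bp j (L j - 1) \<otimes> i z' s) (j, L j - 1) = 0" by (simp add: cf_zero)
      then show ?thesis using nth[of s] j L_ge2[OF j] by (simp add: cf_bp_mult cyc_id)
    next
      case False
      have "i z' s = chi E1 \<otimes> i z' s"
        using e1 mod_hom_smult[OF i chi_closed z', of E1] by (simp add: fun_eq_iff)
      then have "cf (i z' s) (j, 0) = cf (chi E1 \<otimes> i z' s) (j, 0)" by simp
      then show ?thesis using nth[of s] j False by (simp add: cf_chi_mult cyc_id)
    qed
  qed
  then obtain w where w: "w \<in> carrier K" "z' = arr \<odot>\<^bsub>K\<^esub> w" by blast
  have "z = z' \<oplus>\<^bsub>K\<^esub> arr \<odot>\<^bsub>K\<^esub> v"
    using z v(1) by (simp add: z'_def K.M.minus_eq K.M.a_assoc K.M.l_neg)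
  then have "z = arr \<odot>\<^bsub>K\<^esub> (w \<oplus>\<^bsub>K\<^esub> v)" using w v(1) by (simp add: K.smult_r_distr)
  then show ?thesis using w(1) v(1) by blast
qed

lemma second_syzygy_projective:
  assumes E: "E \<subseteq> {1..n}" "\<And>i. i \<in> E \<Longrightarrow> L i \<le> L (cyc n (i + 1))"
    "\<And>i. i \<in> {1..n} \<Longrightarrow> cyc n (i + L i - 1) \<in> E"
    and K: "fg_projective R K" and P: "fg_projective R P" and Q: "fg_projective R Q"
    and g: "g \<in> mod_hom R K P" "inj_on g (carrier K)" and f: "f \<in> mod_hom R P Q"
    and exact: "g ` carrier K = a_kernel P Q f"
  shows "fg_projective R (Q\<lparr>carrier := f ` carrier P\<rparr>)"
proof -
  note K' = fg_projective_left_module[OF K] and P' = fg_projective_left_module[OF P]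
    and Q' = fg_projective_left_module[OF Q]
  interpret K: left_module R K by (rule K')
  interpret P: left_module R P by (rule P')
  interpret Q: left_module R Q by (rule Q')
  obtain i m p where i: "i \<in> mod_hom R P (free_module R m)"
    and p: "p \<in> mod_hom R (free_module R m) P" and pi: "\<forall>x\<in>carrier P. p (i x) = x"
    by (rule fg_projectiveE[OF P])
  have ig: "(\<lambda>x. i (g x)) \<in> mod_hom R K (free_module R m)" by (rule mod_hom_comp[OF g(1) i])
  have refl: "\<exists>w\<in>carrier K. z = arr \<odot>\<^bsub>K\<^esub> w"
    if z: "z \<in> carrier K" and 0: "\<forall>s<m. \<forall>j\<in>{1..n}. cf (i (g z) s) (j, 0) = 0" for z
  proof -
    have "\<exists>y\<in>carrier P. g z = arr \<odot>\<^bsub>P\<^esub> y"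
      by (rule projective_radical[OF P' i p pi mod_hom_closed[OF g(1) z]]) (use 0 in auto)
    then show ?thesis
      using kernel_reflects_radical[OF E K P' Q g f exact z] by blast
  qed
  obtain \<rho> where \<rho>: "\<rho> \<in> mod_hom R (free_module R m) K" "\<And>z. z \<in> carrier K \<Longrightarrow> \<rho> (i (g z)) = z"
    using split_mono[OF K' ig refl] by blast
  \<comment> \<open>The map \<open>h\<close> is a projection of \<open>P\<close> along the kernel of \<open>f\<close>; it factors through a section of \<open>f\<close>.\<close>
  define h where "h y = y \<ominus>\<^bsub>P\<^esub> g (\<rho> (i y))" for y
  have id: "(\<lambda>y. y) \<in> mod_hom R P P" by (rule mod_homI) simp_all
  have g\<rho>: "(\<lambda>y. g (\<rho> (i y))) \<in> mod_hom R P P"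
    by (rule mod_hom_comp[OF mod_hom_comp[OF i \<rho>(1)] g(1)])
  have h: "h \<in> mod_hom R P P"
    unfolding h_def by (rule mod_hom_difference[OF P' id g\<rho>])
  have fh: "f (h y) = f y" if "y \<in> carrier P" for y
  proof -
    have "\<rho> (i y) \<in> carrier K" by (rule mod_hom_closed[OF mod_hom_comp[OF i \<rho>(1)] that])
    then have "g (\<rho> (i y)) \<in> a_kernel P Q f" unfolding exact[symmetric] by (rule imageI)
    then have "f (g (\<rho> (i y))) = \<zero>\<^bsub>Q\<^esub>" by (simp add: a_kernel_def')
    then show ?thesis
      using mod_hom_diff[OF P' Q' f that mod_hom_closed[OF g\<rho> that]] mod_hom_closed[OF f that]
      by (simp add: h_def Q.M.minus_eq)
  qed
  have h_cong: "h x = h y" if "x \<in> carrier P" "y \<in> carrier P" "f x = f y" for x y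
  proof -
    have "f (x \<ominus>\<^bsub>P\<^esub> y) = \<zero>\<^bsub>Q\<^esub>"
      using that mod_hom_closed[OF f] by (simp add: mod_hom_diff[OF P' Q' f] Q.M.minus_eq Q.M.r_neg)
    then have "x \<ominus>\<^bsub>P\<^esub> y \<in> g ` carrier K" unfolding exact using that by (simp add: a_kernel_def')
    then obtain v where v: "v \<in> carrier K" "x \<ominus>\<^bsub>P\<^esub> y = g v" by blast
    have "h (g v) = \<zero>\<^bsub>P\<^esub>"
      using v(1) mod_hom_closed[OF g(1)] by (simp add: h_def \<rho>(2) P.M.minus_eq P.M.r_neg)
    then have "h x \<ominus>\<^bsub>P\<^esub> h y = \<zero>\<^bsub>P\<^esub>" using mod_hom_diff[OF P' P' h that(1,2)] v(2) by simp
    moreover have "(h x \<ominus>\<^bsub>P\<^esub> h y) \<oplus>\<^bsub>P\<^esub> h y = h x"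
      using that mod_hom_closed[OF h] by (simp add: P.M.minus_eq P.M.a_assoc P.M.l_neg)
    ultimately show ?thesis using mod_hom_closed[OF h that(2)] by simp
  qed
  let ?C = "Q\<lparr>carrier := f ` carrier P\<rparr>"
  define s where "s c = h (SOME y. y \<in> carrier P \<and> f y = c)" for c
  have s: "s (f y) = h y" if "y \<in> carrier P" for y
  proof -
    have "(SOME x. x \<in> carrier P \<and> f x = f y) \<in> carrier P \<and> f (SOME x. x \<in> carrier P \<and> f x = f y) = f y"
      by (rule someI[of _ y]) (use that in simp)
    then show ?thesis unfolding s_def using that by (intro h_cong) auto
  qed
  have sC: "s \<in> mod_hom R ?C P"
  proof (rule mod_homI)
    fix x y assume "x \<in> carrier ?C" "y \<in> carrier ?C"
    then obtain a b where "a \<in> carrier P" "b \<in> carrier P" "x = f a" "y = f b" by auto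
    then show "s (x \<oplus>\<^bsub>?C\<^esub> y) = s x \<oplus>\<^bsub>P\<^esub> s y"
      using mod_hom_add[OF f, of a b] mod_hom_add[OF h, of a b] s[of "a \<oplus>\<^bsub>P\<^esub> b"] by (simp add: s)
  next
    fix a x assume "a \<in> carrier R" "x \<in> carrier ?C"
    moreover from this obtain y where "y \<in> carrier P" "x = f y" by auto
    ultimately show "s (a \<odot>\<^bsub>?C\<^esub> x) = a \<odot>\<^bsub>P\<^esub> s x"
      using mod_hom_smult[OF f, of a y] mod_hom_smult[OF h, of a y] s[of "a \<odot>\<^bsub>P\<^esub> y"] by (simp add: s)
  qed (use s mod_hom_closed[OF h] in auto)
  have fC: "f \<in> mod_hom R P ?C"
    using f by (auto simp: mod_hom_def)
  have "left_module R ?C"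
    by (rule Q.submodule_as_module[OF mod_hom_image_submodule[OF P' Q' f]])
      (rule P.submoduleI; simp)
  moreover have "\<forall>c\<in>carrier ?C. f (p (i (s c))) = c"
    using pi s fh mod_hom_closed[OF h] by auto
  ultimately show ?thesis
    unfolding fg_projective_def
    by (intro conjI exI[of _ m] bexI[OF _ mod_hom_comp[OF sC i]] bexI[OF _ mod_hom_comp[OF p fC]])
qed

end


section \<open>Quotient modules\<close>

context
  fixes R :: "('r, 'q) ring_scheme" and M :: "('r, 'a) module" and N
  assumes M: "left_module R M" and N: "submodule N R M"
begin

interpretation M: left_module R M by (rule M)

interpretation N: abelian_subgroup N M
  by (rule abelian_subgroupI3)
    (use submodule.axioms(1)[OF N] M.M.abelian_group_axioms in
      \<open>auto intro: additive_subgroup.intro\<close>)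

lemma quotient_module_coset:
  shows "carrier (quotient_module M N) = (\<lambda>x. N +>\<^bsub>M\<^esub> x) ` carrier M"
    and "\<zero>\<^bsub>quotient_module M N\<^esub> = N"
    and "x \<in> carrier M \<Longrightarrow> y \<in> carrier M \<Longrightarrow>
      (N +>\<^bsub>M\<^esub> x) \<oplus>\<^bsub>quotient_module M N\<^esub> (N +>\<^bsub>M\<^esub> y) = N +>\<^bsub>M\<^esub> (x \<oplus>\<^bsub>M\<^esub> y)"
    and "x \<in> carrier M \<Longrightarrow> N +>\<^bsub>M\<^esub> x = N \<longleftrightarrow> x \<in> N"
    and "a \<in> carrier R \<Longrightarrow> x \<in> carrier M \<Longrightarrow>
      a \<odot>\<^bsub>quotient_module M N\<^esub> (N +>\<^bsub>M\<^esub> x) = N +>\<^bsub>M\<^esub> (a \<odot>\<^bsub>M\<^esub> x)"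
proof -
  show "carrier (quotient_module M N) = (\<lambda>x. N +>\<^bsub>M\<^esub> x) ` carrier M"
    by (auto simp: quotient_module_def A_RCOSETS_def')
  show "\<zero>\<^bsub>quotient_module M N\<^esub> = N" by (simp add: quotient_module_def)
  show "(N +>\<^bsub>M\<^esub> x) \<oplus>\<^bsub>quotient_module M N\<^esub> (N +>\<^bsub>M\<^esub> y) = N +>\<^bsub>M\<^esub> (x \<oplus>\<^bsub>M\<^esub> y)"
    if "x \<in> carrier M" "y \<in> carrier M"
    using that by (simp add: quotient_module_def N.a_rcos_sum)
  show "N +>\<^bsub>M\<^esub> x = N \<longleftrightarrow> x \<in> N" if "x \<in> carrier M"
  proof
    assume "N +>\<^bsub>M\<^esub> x = N"
    with N.a_rcos_self[OF that] show "x \<in> N" by (simp only:)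
  next
    assume "x \<in> N"
    with M.M.a_coset_join2[OF that N.a_subgroup] show "N +>\<^bsub>M\<^esub> x = N" by (simp only:)
  qed
  show "a \<odot>\<^bsub>quotient_module M N\<^esub> (N +>\<^bsub>M\<^esub> x) = N +>\<^bsub>M\<^esub> (a \<odot>\<^bsub>M\<^esub> x)"
    if a: "a \<in> carrier R" and x: "x \<in> carrier M"
  proof -
    have "N +>\<^bsub>M\<^esub> (a \<odot>\<^bsub>M\<^esub> y) = N +>\<^bsub>M\<^esub> (a \<odot>\<^bsub>M\<^esub> x)" if y: "y \<in> N +>\<^bsub>M\<^esub> x" for y
    proof -
      obtain h where h: "h \<in> N" "y = h \<oplus>\<^bsub>M\<^esub> x" using y by (auto simp: a_r_coset_def')
      have hM: "h \<in> carrier M" using h(1) submodule_closed(1)[OF N] by auto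
      have "a \<odot>\<^bsub>M\<^esub> y = a \<odot>\<^bsub>M\<^esub> h \<oplus>\<^bsub>M\<^esub> a \<odot>\<^bsub>M\<^esub> x" using a x hM h(2) by (simp add: M.smult_r_distr)
      moreover have "a \<odot>\<^bsub>M\<^esub> h \<in> N" by (rule submodule_closed(5)[OF N a h(1)])
      ultimately have "a \<odot>\<^bsub>M\<^esub> y \<in> N +>\<^bsub>M\<^esub> (a \<odot>\<^bsub>M\<^esub> x)" unfolding a_r_coset_def' by blast
      then show ?thesis using M.M.a_repr_independence[OF _ _ N.a_subgroup] a x by simp
    qed
    then have "(\<Union>y\<in>N +>\<^bsub>M\<^esub> x. N +>\<^bsub>M\<^esub> (a \<odot>\<^bsub>M\<^esub> y)) = (\<Union>y\<in>N +>\<^bsub>M\<^esub> x. N +>\<^bsub>M\<^esub> (a \<odot>\<^bsub>M\<^esub> x))"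
      by (rule SUP_cong[OF refl])
    also have "\<dots> = N +>\<^bsub>M\<^esub> (a \<odot>\<^bsub>M\<^esub> x)" using N.a_rcos_self[OF x] by (intro UN_constant_eq) auto
    finally show ?thesis by (simp add: quotient_module_def)
  qed
qed

lemma quotient_left_module: "left_module R (quotient_module M N)"
proof -
  note q = quotient_module_coset
  have zero: "\<zero>\<^bsub>quotient_module M N\<^esub> = N +>\<^bsub>M\<^esub> \<zero>\<^bsub>M\<^esub>"
    using q(4)[of "\<zero>\<^bsub>M\<^esub>"] submodule_closed(2)[OF N] by (simp add: q(2))
  have "abelian_group (quotient_module M N)"
  proof (rule abelian_groupI, goal_cases)
    case (1 x y)
    then show ?case by (auto simp: q(1,3))
  next
    case 2
    then show ?case unfolding zero by (simp add: q(1))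
  next
    case (3 x y z)
    then show ?case by (auto simp: q(1,3) M.M.a_assoc)
  next
    case (4 x y)
    then show ?case by (auto simp: q(1,3) M.M.a_comm)
  next
    case (5 x)
    then show ?case unfolding zero by (auto simp: q(1,3))
  next
    case (6 x)
    then obtain y where y: "y \<in> carrier M" "x = N +>\<^bsub>M\<^esub> y" by (auto simp: q(1))
    show ?case
      unfolding zero y(2) using y(1)
      by (intro bexI[of _ "N +>\<^bsub>M\<^esub> \<ominus>\<^bsub>M\<^esub> y"]) (simp_all add: q(1,3) M.M.l_neg)
  qed
  then show ?thesis
    by (intro left_module.intro left_module_axioms.intro M.R.ring_axioms)
      (auto simp: quotient_module_coset(1,3,5) M.smult_l_distr M.smult_r_distr M.smult_assoc)
qed

end


section \<open>Projective dimension\<close>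

text \<open>The existence of a projective resolution of length at most \<open>l\<close>.\<close>

definition pd_le :: "('r, 'q) ring_scheme \<Rightarrow> nat \<Rightarrow> ('r, 'a) module \<Rightarrow> bool"
  where "pd_le R l M \<longleftrightarrow>
    (\<exists>P d \<epsilon>. proj_resolution R M P d \<epsilon> \<and> (\<forall>i>l. carrier (P i) = {\<zero>\<^bsub>P i\<^esub>}))"

lemma pd_le_mono:
  assumes "pd_le R l M" "l \<le> l'"
  shows "pd_le R l' M"
proof -
  obtain P d \<epsilon> where "proj_resolution R M P d \<epsilon>" and 0: "\<forall>i>l. carrier (P i) = {\<zero>\<^bsub>P i\<^esub>}"
    using assms(1) unfolding pd_le_def by (elim exE conjE)
  moreover have "\<forall>i>l'. carrier (P i) = {\<zero>\<^bsub>P i\<^esub>}" using 0 assms(2) by simp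
  ultimately show ?thesis unfolding pd_le_def by (intro exI conjI)
qed

lemma pdim_finite_iff: "pdim R M < \<infinity> \<longleftrightarrow> (\<exists>l. pd_le R l M)"
  unfolding pdim_def pd_le_def[symmetric]
proof
  assume "Inf {enat l |l. pd_le R l M} < \<infinity>"
  then have "{enat l |l. pd_le R l M} \<noteq> {}" by (metis Inf_empty less_irrefl top_enat_def)
  then show "\<exists>l. pd_le R l M" by auto
next
  assume "\<exists>l. pd_le R l M"
  then obtain l where "pd_le R l M" ..
  then have "Inf {enat l |l. pd_le R l M} \<le> enat l" by (intro Inf_lower) auto
  then show "Inf {enat l |l. pd_le R l M} < \<infinity>" by (rule le_less_trans) simp
qed

lemma pdim_le_iff: "pdim R M \<le> enat l \<longleftrightarrow> pd_le R l M"
proof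
  assume *: "pdim R M \<le> enat l"
  then have "pdim R M < \<infinity>" by (rule le_less_trans) simp
  then have ne: "{enat l |l. pd_le R l M} \<noteq> {}" using pdim_finite_iff[of R M] by auto
  have "pdim R M = Inf {enat l |l. pd_le R l M}" by (simp add: pdim_def pd_le_def)
  also have "\<dots> \<in> {enat l |l. pd_le R l M}"
    using ne by (auto simp: Inf_enat_def intro: LeastI)
  finally obtain l' where "pdim R M = enat l'" "pd_le R l' M" by blast
  then show "pd_le R l M" using * pd_le_mono[of R l' M l] by simp
next
  assume "pd_le R l M"
  then show "pdim R M \<le> enat l" unfolding pdim_def pd_le_def[symmetric] by (intro Inf_lower) auto
qed

lemma zero_submodule:
  assumes "left_module R M"
  shows "submodule {\<zero>\<^bsub>M\<^esub>} R M"
proof -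
  interpret M: left_module R M by fact
  show ?thesis by (rule M.submoduleI) auto
qed

lemma zero_module_projective:
  assumes "left_module R M"
  shows "fg_projective R (M\<lparr>carrier := {\<zero>\<^bsub>M\<^esub>}\<rparr>)"
  by (rule fg_projective_trivial[OF left_module.submodule_as_module[OF assms zero_submodule[OF assms]]])
    simp

lemma pd_le_0:
  fixes P :: "('r, nat \<Rightarrow> 'r) module"
  assumes P: "fg_projective R P"
  shows "pd_le R 0 P"
proof -
  interpret P: left_module R P by (rule fg_projective_left_module[OF P])
  define Q where "Q i = (if i = 0 then P else P\<lparr>carrier := {\<zero>\<^bsub>P\<^esub>}\<rparr>)" for i :: nat
  have Q: "fg_projective R (Q i)" for i
    using P zero_module_projective[OF P.left_module_axioms] by (simp add: Q_def)
  have id: "(\<lambda>x. x) \<in> mod_hom R P P" by (rule mod_homI) simp_all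
  have z: "(\<lambda>_. \<zero>\<^bsub>P\<^esub>) \<in> mod_hom R (Q (Suc i)) (Q i)" for i
    by (rule mod_homI) (simp_all add: Q_def)
  have "proj_resolution R P Q (\<lambda>_ _. \<zero>\<^bsub>P\<^esub>) (\<lambda>x. x)"
    unfolding proj_resolution_def
    by (intro conjI allI Q z) (auto simp: Q_def id a_kernel_def')
  moreover have "\<forall>i>0. carrier (Q i) = {\<zero>\<^bsub>Q i\<^esub>}" by (simp add: Q_def)
  ultimately show ?thesis unfolding pd_le_def by (intro exI conjI)
qed

text \<open>An extension by one step of a resolution of the kernel of \<open>P \<rightarrow> M\<close>.\<close>

lemma pd_le_Suc:
  fixes P :: "('r, nat \<Rightarrow> 'r) module" and K :: "('r, 'b) module" and M :: "('r, 'a) module"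
  assumes K: "left_module R K" "pd_le R l K" and P: "fg_projective R P"
    and \<epsilon>: "\<epsilon> \<in> mod_hom R P M" "\<epsilon> ` carrier P = carrier M"
    and \<iota>: "\<iota> \<in> mod_hom R K P" "inj_on \<iota> (carrier K)" "\<iota> ` carrier K = a_kernel P M \<epsilon>"
  shows "pd_le R (Suc l) M"
proof -
  obtain Q d \<eta> where Q: "proj_resolution R K Q d \<eta>" and Q0: "\<forall>i>l. carrier (Q i) = {\<zero>\<^bsub>Q i\<^esub>}"
    using K(2) unfolding pd_le_def by (elim exE conjE)
  note P' = fg_projective_left_module[OF P]
  have \<eta>: "\<eta> \<in> mod_hom R (Q 0) K" "\<eta> ` carrier (Q 0) = carrier K"
    "d 0 ` carrier (Q 1) = a_kernel (Q 0) K \<eta>"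
    using Q by (auto simp only: proj_resolution_def)
  have ker: "a_kernel (Q 0) P (\<lambda>x. \<iota> (\<eta> x)) = a_kernel (Q 0) K \<eta>"
  proof -
    have "\<iota> (\<eta> x) = \<zero>\<^bsub>P\<^esub> \<longleftrightarrow> \<eta> x = \<zero>\<^bsub>K\<^esub>" if "x \<in> carrier (Q 0)" for x
    proof -
      interpret K: left_module R K by (rule K(1))
      show ?thesis
        using inj_on_eq_iff[OF \<iota>(2) mod_hom_closed[OF \<eta>(1) that] K.M.zero_closed]
          mod_hom_zero[OF K(1) P' \<iota>(1)] by simp
    qed
    then show ?thesis unfolding a_kernel_def' by blast
  qed
  let ?P = "case_nat P Q" and ?d = "case_nat (\<lambda>x. \<iota> (\<eta> x)) d"
  have "proj_resolution R M ?P ?d \<epsilon>"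
    unfolding proj_resolution_def
  proof (intro conjI allI)
    show "fg_projective R (?P i)" for i
      using P Q by (cases i) (simp_all add: proj_resolution_def)
    show "\<epsilon> \<in> mod_hom R (?P 0) M" using \<epsilon>(1) by simp
    show "?d i \<in> mod_hom R (?P (Suc i)) (?P i)" for i
      using Q mod_hom_comp[OF \<eta>(1) \<iota>(1)] by (cases i) (simp_all add: proj_resolution_def)
    show "\<epsilon> ` carrier (?P 0) = carrier M" using \<epsilon>(2) by simp
    show "?d 0 ` carrier (?P 1) = a_kernel (?P 0) M \<epsilon>"
      using \<iota>(3) \<eta>(2) by (simp add: image_image[symmetric])
    show "?d (Suc i) ` carrier (?P (Suc (Suc i))) = a_kernel (?P (Suc i)) (?P i) (?d i)" for i
      using Q \<eta>(3) ker by (cases i) (simp_all add: proj_resolution_def)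
  qed
  moreover have "\<forall>i>Suc l. carrier (?P i) = {\<zero>\<^bsub>?P i\<^esub>}"
  proof (intro allI impI)
    fix i assume "i > Suc l"
    then show "carrier (?P i) = {\<zero>\<^bsub>?P i\<^esub>}" using Q0 by (cases i) auto
  qed
  ultimately show ?thesis unfolding pd_le_def by (intro exI conjI)
qed

text \<open>Suppose that the image of a map between projectives is projective whenever its kernel is.  Then projective
  resolutions of length at least two can be shortened, by truncation at this image.\<close>

lemma pd_le_shorten:
  fixes R :: "('r, 'q) ring_scheme" and M :: "('r, 'a) module"
  assumes syz: "\<And>(K :: ('r, nat \<Rightarrow> 'r) module) (P :: ('r, nat \<Rightarrow> 'r) module)
      (Q :: ('r, nat \<Rightarrow> 'r) module) g f. fg_projective R K \<Longrightarrow> fg_projective R P \<Longrightarrow>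
      fg_projective R Q \<Longrightarrow> g \<in> mod_hom R K P \<Longrightarrow> inj_on g (carrier K) \<Longrightarrow>
      f \<in> mod_hom R P Q \<Longrightarrow> g ` carrier K = a_kernel P Q f \<Longrightarrow>
      fg_projective R (Q\<lparr>carrier := f ` carrier P\<rparr>)"
    and M: "pd_le R (Suc (Suc l)) M"
  shows "pd_le R (Suc l) M"
proof -
  obtain P d \<epsilon> where res: "proj_resolution R M P d \<epsilon>"
    and P0: "\<forall>i>Suc (Suc l). carrier (P i) = {\<zero>\<^bsub>P i\<^esub>}"
    using M unfolding pd_le_def by (elim exE conjE)
  have proj: "fg_projective R (P i)" for i using res by (simp add: proj_resolution_def)
  have mod: "left_module R (P i)" for i by (rule fg_projective_left_module[OF proj])
  have \<epsilon>: "\<epsilon> \<in> mod_hom R (P 0) M" "\<epsilon> ` carrier (P 0) = carrier M"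
    using res by (simp_all add: proj_resolution_def)
  have d: "d i \<in> mod_hom R (P (Suc i)) (P i)" for i using res by (simp add: proj_resolution_def)
  have ex0: "d 0 ` carrier (P 1) = a_kernel (P 0) M \<epsilon>" using res by (simp add: proj_resolution_def)
  have exS: "d (Suc i) ` carrier (P (Suc (Suc i))) = a_kernel (P (Suc i)) (P i) (d i)" for i
    using res by (simp add: proj_resolution_def)
  have dz: "d i \<zero>\<^bsub>P (Suc i)\<^esub> = \<zero>\<^bsub>P i\<^esub>" for i by (rule mod_hom_zero[OF mod mod d])
  have zc: "\<zero>\<^bsub>P i\<^esub> \<in> carrier (P i)" for i
  proof -
    interpret left_module R "P i" by (rule mod)
    show ?thesis by simp
  qed
  have inj: "inj_on (d (Suc l)) (carrier (P (Suc (Suc l))))"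
  proof (rule mod_hom_injective[OF mod mod d])
    fix x assume "x \<in> carrier (P (Suc (Suc l)))" "d (Suc l) x = \<zero>\<^bsub>P (Suc l)\<^esub>"
    then have "x \<in> d (Suc (Suc l)) ` carrier (P (Suc (Suc (Suc l))))"
      unfolding exS by (simp add: a_kernel_def')
    then show "x = \<zero>\<^bsub>P (Suc (Suc l))\<^esub>" using P0 dz by simp
  qed
  define C where "C = (P l)\<lparr>carrier := d l ` carrier (P (Suc l))\<rparr>"
  define Z where "Z = (P (Suc (Suc l)))\<lparr>carrier := {\<zero>\<^bsub>P (Suc (Suc l))\<^esub>}\<rparr>"
  have C: "fg_projective R C"
    unfolding C_def by (rule syz[OF proj proj proj d inj d exS])
  have Z: "fg_projective R Z" unfolding Z_def by (rule zero_module_projective[OF mod])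
  have C_hom: "(\<lambda>x. x) \<in> mod_hom R C (P l)"
    by (rule mod_homI) (use mod_hom_closed[OF d] in \<open>auto simp: C_def\<close>)
  have zC: "\<zero>\<^bsub>P l\<^esub> \<in> carrier C"
    using imageI[OF zc[of "Suc l"], of "d l"] by (simp add: C_def dz)
  define P' where "P' = P(Suc l := C, Suc (Suc l) := Z)"
  define d' where "d' = d(l := (\<lambda>x. x), Suc l := (\<lambda>_. \<zero>\<^bsub>P l\<^esub>))"
  have P'_other: "P' i = P i" if "i \<noteq> Suc l" "i \<noteq> Suc (Suc l)" for i using that by (simp add: P'_def)
  have d'_other: "d' i = d i" if "i \<noteq> l" "i \<noteq> Suc l" for i using that by (simp add: d'_def)
  have P'_new: "P' (Suc l) = C" "P' (Suc (Suc l)) = Z" by (simp_all add: P'_def)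
  have d'_new: "d' l = (\<lambda>x. x)" "d' (Suc l) = (\<lambda>_. \<zero>\<^bsub>P l\<^esub>)" by (simp_all add: d'_def)
  have C_im: "(\<lambda>x. x) ` carrier C = d l ` carrier (P (Suc l))" by (simp add: C_def)
  have "proj_resolution R M P' d' \<epsilon>"
    unfolding proj_resolution_def
  proof (intro conjI allI)
    show "fg_projective R (P' i)" for i using proj C Z by (simp add: P'_def)
    show "\<epsilon> \<in> mod_hom R (P' 0) M" "\<epsilon> ` carrier (P' 0) = carrier M" using \<epsilon> by (simp_all add: P'_def)
    show "d' i \<in> mod_hom R (P' (Suc i)) (P' i)" for i
    proof -
      consider "i = l" | "i = Suc l" | "i = Suc (Suc l)" | "i \<noteq> l" "i \<noteq> Suc l" "i \<noteq> Suc (Suc l)" by blast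
      then show ?thesis
      proof cases
        case 1
        then show ?thesis using C_hom P'_other[of l] by (simp add: P'_new d'_new)
      next
        case 2
        interpret left_module R C by (rule fg_projective_left_module[OF C])
        have z: "\<zero>\<^bsub>C\<^esub> = \<zero>\<^bsub>P l\<^esub>" by (simp add: C_def)
        have "(\<lambda>_. \<zero>\<^bsub>C\<^esub>) \<in> mod_hom R Z C" by (rule mod_homI) simp_all
        then show ?thesis unfolding 2 P'_new d'_new z .
      next
        case 3
        have eq: "P' (Suc i) = P (Suc i)" using 3 by (simp add: P'_def)
        have "d i \<in> mod_hom R (P (Suc i)) Z"
          by (rule mod_homI)
            (use d[of i] P0 3 dz[of "Suc (Suc l)"] in \<open>auto simp: mod_hom_def Z_def\<close>)
        then show ?thesis using 3 d'_other[of i] eq by (simp add: P'_new)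
      next
        case 4
        then show ?thesis using d[of i] by (simp add: P'_other d'_other)
      qed
    qed
    show "d' 0 ` carrier (P' 1) = a_kernel (P' 0) M \<epsilon>"
    proof (cases l)
      case 0
      then show ?thesis using ex0 C_im P'_other[of 0] by (simp add: P'_def d'_def)
    next
      case (Suc m)
      then show ?thesis using ex0 by (simp add: P'_def d'_def)
    qed
    show "d' (Suc i) ` carrier (P' (Suc (Suc i))) = a_kernel (P' (Suc i)) (P' i) (d' i)" for i
    proof -
      consider "Suc i = l" | "i = l" | "i = Suc l" | "i = Suc (Suc l)" | "Suc i \<noteq> l" "i \<noteq> l" "i \<noteq> Suc l" "i \<noteq> Suc (Suc l)"
        by blast
      then show ?thesis
      proof cases
        case 1
        then have "P' (Suc i) = P (Suc i)" "P' i = P i" "d' i = d i"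
          by (auto simp: P'_def d'_def)
        then show ?thesis using exS[of i] C_im unfolding 1 by (simp add: P'_new d'_new)
      next
        case 2
        have "P' l = P l" by (simp add: P'_def)
        then show ?thesis
          unfolding 2 P'_new d'_new using zC by (auto simp: a_kernel_def' Z_def)
      next
        case 3
        have *: "P' (Suc (Suc (Suc l))) = P (Suc (Suc (Suc l)))" "d' (Suc (Suc l)) = d (Suc (Suc l))"
          by (simp_all add: P'_def d'_def)
        show ?thesis
          unfolding 3 P'_new d'_new * using P0 dz
          by (auto simp: a_kernel_def' Z_def C_def)
      next
        case 4
        then have "P' (Suc (Suc i)) = P (Suc (Suc i))" "P' (Suc i) = P (Suc i)" "d' (Suc i) = d (Suc i)"
          "d' i = d i" "P' i = Z"
          by (simp_all add: P'_def d'_def)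
        then show ?thesis using exS[of i] 4 by (simp add: a_kernel_def' Z_def)
      next
        case 5
        then have "P' (Suc (Suc i)) = P (Suc (Suc i))" "P' (Suc i) = P (Suc i)" "d' (Suc i) = d (Suc i)"
          "d' i = d i" "P' i = P i"
          by (auto simp: P'_def d'_def)
        then show ?thesis using exS[of i] by simp
      qed
    qed
  qed
  moreover have "\<forall>i>Suc l. carrier (P' i) = {\<zero>\<^bsub>P' i\<^esub>}"
    using P0 by (auto simp: P'_def Z_def)
  ultimately show ?thesis unfolding pd_le_def by (intro exI conjI)
qed


section \<open>Uniserial modules\<close>

context nakayama_coeffs
begin

text \<open>Elements of the ring as functions on \<open>nat\<close>, the type in which modules are represented.\<close>

definition emb :: "'r \<Rightarrow> nat \<Rightarrow> 'r"
  where "emb x = (\<lambda>s. if s = 0 then x else \<zero>)"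

lemma emb_simps [simp]: "emb x 0 = x" "s > 0 \<Longrightarrow> emb x s = \<zero>"
  by (simp_all add: emb_def)

text \<open>The uniserial module of length \<open>t\<close> with top \<open>S\<^sub>a\<close>, for \<open>t \<le> L a\<close>: it consists of the combinations of the
  paths of length less than \<open>t\<close> starting at \<open>a\<close>, with longer paths set to zero in the action of the ring.
  The combination is placed at the index 0, and the other values are zero.  In particular \<open>uni a (L a)\<close> is \<open>P\<^sub>a\<close>, and \<open>uni a 1\<close> is \<open>S\<^sub>a\<close>.\<close>

definition uni :: "nat \<Rightarrow> nat \<Rightarrow> ('r, nat \<Rightarrow> 'r) module"
  where "uni a t =
    \<lparr>carrier = {y. y 0 \<in> carrier R \<and> (\<forall>i l. cf (y 0) (i, l) \<noteq> 0 \<longrightarrow> i = a \<and> l < t) \<and> (\<forall>s>0. y s = \<zero>)},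
     mult = undefined, one = undefined, zero = (\<lambda>s. \<zero>), add = (\<lambda>x y s. x s \<oplus> y s),
     smult = (\<lambda>r y. emb (mk (\<lambda>(i, l). if l < t then cf (r \<otimes> y 0) (i, l) else 0)))\<rparr>"

text \<open>The element of \<open>uni a t\<close> with coefficients \<open>h\<close>, and conversely the coefficients of an element.\<close>

definition uvec :: "nat \<Rightarrow> nat \<Rightarrow> (nat \<Rightarrow> 'k) \<Rightarrow> nat \<Rightarrow> 'r"
  where "uvec a t h = emb (mk (\<lambda>(i, l). if i = a \<and> l < t then h l else 0))"

definition uc :: "nat \<Rightarrow> (nat \<Rightarrow> 'r) \<Rightarrow> nat \<Rightarrow> 'k"
  where "uc a y l = cf (y 0) (a, l)"

lemma uni_carrier:
  "y \<in> carrier (uni a t) \<longleftrightarrow>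
    y 0 \<in> carrier R \<and> (\<forall>i l. cf (y 0) (i, l) \<noteq> 0 \<longrightarrow> i = a \<and> l < t) \<and> (\<forall>s>0. y s = \<zero>)"
  by (simp add: uni_def)

lemma uni_simps:
  "\<zero>\<^bsub>uni a t\<^esub> = (\<lambda>s. \<zero>)" "x \<oplus>\<^bsub>uni a t\<^esub> y = (\<lambda>s. x s \<oplus> y s)"
  "r \<odot>\<^bsub>uni a t\<^esub> y = emb (mk (\<lambda>(i, l). if l < t then cf (r \<otimes> y 0) (i, l) else 0))"
  by (simp_all add: uni_def)

lemma uni_nth: "y \<in> carrier (uni a t) \<Longrightarrow> y s \<in> carrier R"
  by (cases "s = 0") (simp_all add: uni_carrier)

lemma uni_cf_zero:
  assumes "y \<in> carrier (uni a t)" "\<not> (i = a \<and> l < t)"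
  shows "cf (y 0) (i, l) = 0"
  using assms unfolding uni_carrier by blast

lemma uc_outside: "y \<in> carrier (uni a t) \<Longrightarrow> t \<le> l \<Longrightarrow> uc a y l = 0"
  by (simp add: uc_def uni_cf_zero)

lemma uni_eqI:
  assumes x: "x \<in> carrier (uni a t)" and y: "y \<in> carrier (uni a t)"
    and eq: "\<And>l. l < t \<Longrightarrow> uc a x l = uc a y l"
  shows "x = y"
proof
  fix s
  show "x s = y s"
  proof (cases "s = 0")
    case True
    have "x 0 = y 0"
    proof (rule cf_eqI)
      show "x 0 \<in> carrier R" "y 0 \<in> carrier R" using x y by (simp_all add: uni_carrier)
      fix i l
      show "cf (x 0) (i, l) = cf (y 0) (i, l)"
      proof (cases "i = a \<and> l < t")
        case True
        then show ?thesis using eq[of l] by (simp add: uc_def)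
      next
        case False
        then have "cf (x 0) (i, l) = 0" "cf (y 0) (i, l) = 0" using uni_cf_zero[OF x] uni_cf_zero[OF y] by simp_all
        then show ?thesis by simp
      qed
    qed
    then show ?thesis using True by simp
  next
    case False
    then show ?thesis using x y by (simp add: uni_carrier)
  qed
qed

lemma uvec_closed [simp]: "uvec a t h \<in> carrier (uni a t)"
  by (auto simp: uni_carrier uvec_def cf_mk split: if_splits)

lemma uc_uvec: "a \<in> {1..n} \<Longrightarrow> t \<le> L a \<Longrightarrow> uc a (uvec a t h) l = (if l < t then h l else 0)"
  by (auto simp: uc_def uvec_def cf_mk)

lemma uc_add: "x \<in> carrier (uni a t) \<Longrightarrow> y \<in> carrier (uni a t) \<Longrightarrow> uc a (x \<oplus>\<^bsub>uni a t\<^esub> y) l = uc a x l + uc a y l"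
  by (simp add: uc_def uni_simps cf_add uni_nth)

lemma uc_zero: "uc a \<zero>\<^bsub>uni a t\<^esub> l = 0"
  by (simp add: uc_def uni_simps cf_zero)

lemma uc_smult:
  assumes "a \<in> {1..n}" "t \<le> L a" "r \<in> carrier R" "y \<in> carrier (uni a t)"
  shows "uc a (r \<odot>\<^bsub>uni a t\<^esub> y) l = (if l < t then cf (r \<otimes> y 0) (a, l) else 0)"
  using assms by (simp add: uc_def uni_simps cf_mk)

lemma cf_uni_cong:
  assumes a: "a \<in> {1..n}" "l < L a" and r: "r \<in> carrier R" and x: "x \<in> carrier R" "y \<in> carrier R"
    and eq: "\<And>m. m \<le> l \<Longrightarrow> cf x (a, m) = cf y (a, m)"
  shows "cf (r \<otimes> x) (a, l) = cf (r \<otimes> y) (a, l)"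
  using assms by (simp add: cf_mult)

lemma uni_smult_closed:
  assumes "a \<in> {1..n}" "t \<le> L a" "r \<in> carrier R" "y \<in> carrier (uni a t)"
  shows "r \<odot>\<^bsub>uni a t\<^esub> y \<in> carrier (uni a t)"
proof -
  have "cf (r \<otimes> y 0) (i, l) = 0" if "i \<noteq> a" for i l
  proof (cases "i \<in> {1..n} \<and> l < L i")
    case True
    have "cf (y 0) (i, m) = 0" for m using uni_cf_zero[OF assms(4)] that by simp
    then show ?thesis using True assms uni_nth[OF assms(4)] by (simp add: cf_mult)
  qed (use assms uni_nth[OF assms(4)] in \<open>simp add: cf_outside\<close>)
  then show ?thesis
    unfolding uni_carrier uni_simps by (auto simp: cf_mk split: if_splits)
qed

lemma uni_left_module:
  assumes a: "a \<in> {1..n}" and t: "t \<le> L a"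
  shows "left_module R (uni a t)"
proof -
  let ?U = "uni a t"
  note nth = uni_nth
  note sc = uni_smult_closed[OF a t]
  have add: "x \<oplus>\<^bsub>?U\<^esub> y \<in> carrier ?U" if x: "x \<in> carrier ?U" and y: "y \<in> carrier ?U" for x y
  proof -
    have "i = a \<and> l < t" if "cf (x 0 \<oplus> y 0) (i, l) \<noteq> 0" for i l
    proof (rule ccontr)
      assume "\<not> (i = a \<and> l < t)"
      then have "cf (x 0) (i, l) = 0" "cf (y 0) (i, l) = 0" using uni_cf_zero[OF x] uni_cf_zero[OF y] by simp_all
      then show False using that nth[OF x] nth[OF y] by (simp add: cf_add)
    qed
    then show ?thesis using x y by (simp add: uni_carrier uni_simps)
  qed
  have zero: "\<zero>\<^bsub>?U\<^esub> \<in> carrier ?U" by (simp add: uni_carrier uni_simps cf_zero)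
  have "abelian_group ?U"
  proof (rule abelian_groupI, goal_cases)
    case (1 x y)
    then show ?case by (rule add)
  next
    case 2
    then show ?case by (rule zero)
  next
    case (3 x y z)
    then show ?case using nth[OF 3(1)] nth[OF 3(2)] nth[OF 3(3)] by (simp add: uni_simps a_assoc)
  next
    case (4 x y)
    then show ?case using nth[OF 4(1)] nth[OF 4(2)] by (simp add: uni_simps a_comm)
  next
    case (5 x)
    then show ?case using nth[OF 5] by (simp add: uni_simps)
  next
    case (6 x)
    let ?y = "uvec a t (\<lambda>l. - uc a x l)"
    have "?y \<oplus>\<^bsub>?U\<^esub> x = \<zero>\<^bsub>?U\<^esub>"
      using 6 a t by (intro uni_eqI[OF add zero]) (simp_all add: uc_add uc_zero uc_uvec)
    then show ?case by (intro bexI[of _ ?y]) simp_all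
  qed
  moreover have "left_module_axioms R ?U"
  proof (rule left_module_axioms.intro, goal_cases)
    case (1 r x)
    then show ?case by (rule sc)
  next
    case (2 r s x)
    show ?case
      by (rule uni_eqI[OF sc add[OF sc sc]])
        (use 2 sc nth[OF 2(3)] a t in \<open>simp_all add: uc_smult uc_add cf_add l_distr\<close>)
  next
    case (3 r x y)
    have "(x \<oplus>\<^bsub>?U\<^esub> y) 0 = x 0 \<oplus> y 0" by (simp add: uni_simps(2))
    then show ?case
      by (intro uni_eqI[OF sc[OF _ add] add[OF sc sc]])
        (use 3 sc add nth[OF 3(2)] nth[OF 3(3)] a t in \<open>simp_all add: uc_smult uc_add cf_add r_distr\<close>)
  next
    case (4 r s x)
    show ?case
    proof (rule uni_eqI[OF sc sc[OF _ sc]])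
      fix l assume l: "l < t"
      have "cf (r \<otimes> (s \<otimes> x 0)) (a, l) = cf (r \<otimes> (s \<odot>\<^bsub>?U\<^esub> x) 0) (a, l)"
      proof (rule cf_uni_cong)
        show "(s \<odot>\<^bsub>?U\<^esub> x) 0 \<in> carrier R" by (rule nth[OF sc[OF 4(2,3)]])
        fix m assume "m \<le> l"
        then show "cf (s \<otimes> x 0) (a, m) = cf ((s \<odot>\<^bsub>?U\<^esub> x) 0) (a, m)"
          using uc_smult[OF a t 4(2,3), of m] l by (simp add: uc_def)
      qed (use 4 a t l nth[OF 4(3)] in auto)
      then show "uc a ((r \<otimes> s) \<odot>\<^bsub>?U\<^esub> x) l = uc a (r \<odot>\<^bsub>?U\<^esub> (s \<odot>\<^bsub>?U\<^esub> x)) l"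
        using 4 sc nth[OF 4(3)] a t l by (simp add: uc_smult m_assoc)
    qed (use 4 in auto)
  next
    case (5 x)
    show ?case
      by (rule uni_eqI[OF sc 5]) (use 5 nth[OF 5] a t in \<open>simp_all add: uc_smult, simp add: uc_def\<close>)
  qed
  ultimately show ?thesis by (intro left_module.intro ring_axioms)
qed

lemma uc_diff:
  assumes a: "a \<in> {1..n}" and t: "t \<le> L a" and x: "x \<in> carrier (uni a t)" "y \<in> carrier (uni a t)"
  shows "uc a (x \<ominus>\<^bsub>uni a t\<^esub> y) l = uc a x l - uc a y l"
proof -
  interpret left_module R "uni a t" by (rule uni_left_module[OF a t])
  have "(x \<ominus>\<^bsub>uni a t\<^esub> y) \<oplus>\<^bsub>uni a t\<^esub> y = x"
    using x by (simp add: M.minus_eq M.a_assoc M.l_neg)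
  then show ?thesis
    using uc_add[of "x \<ominus>\<^bsub>uni a t\<^esub> y" a t y l] x by (simp add: eq_diff_eq)
qed

lemma uc_arr:
  assumes "a \<in> {1..n}" "t \<le> L a" "y \<in> carrier (uni a t)"
  shows "uc a (arr \<odot>\<^bsub>uni a t\<^esub> y) l = (if 0 < l \<and> l < t then uc a y (l - 1) else 0)"
  using assms(1,2) unfolding uc_smult[OF assms(1,2) arr_closed assms(3)]
  by (auto simp: cf_arr_mult uni_nth[OF assms(3)] uc_def)

lemma uc_diag:
  assumes "a \<in> {1..n}" "t \<le> L a" "y \<in> carrier (uni a t)"
  shows "uc a (diag g \<odot>\<^bsub>uni a t\<^esub> y) l = g (cyc n (a + l)) * uc a y l"
  using uc_outside[OF assms(3), of l] unfolding uc_smult[OF assms(1,2) diag_closed assms(3)]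
  by (auto simp: cf_diag_mult uni_nth[OF assms(3)] uc_def)

text \<open>The composition series of \<open>uni a t\<close>.\<close>

definition ufil :: "nat \<Rightarrow> nat \<Rightarrow> nat \<Rightarrow> (nat \<Rightarrow> 'r) set"
  where "ufil a t s = {y \<in> carrier (uni a t). \<forall>l<s. uc a y l = 0}"

lemma ufil_submodule:
  assumes a: "a \<in> {1..n}" and t: "t \<le> L a"
  shows "submodule (ufil a t s) R (uni a t)"
proof -
  interpret left_module R "uni a t" by (rule uni_left_module[OF a t])
  show ?thesis
  proof (rule submoduleI)
    fix r x assume r: "r \<in> carrier R" and x: "x \<in> ufil a t s"
    have x': "x \<in> carrier (uni a t)" using x by (simp add: ufil_def)
    have "cf (r \<otimes> x 0) (a, l) = 0" if "l < s" "l < t" for l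
    proof -
      have "cf (x 0) (a, m) = 0" if "m \<le> l" for m
        using x that \<open>l < s\<close> by (simp add: ufil_def uc_def)
      then show ?thesis using r uni_nth[OF x', of 0] a t that by (simp add: cf_mult)
    qed
    then show "r \<odot>\<^bsub>uni a t\<^esub> x \<in> ufil a t s"
      using smult_closed[OF r x'] r x' a t by (simp add: ufil_def uc_smult)
  qed (auto simp: ufil_def uc_add uc_zero)
qed

lemma ufil_last: "a \<in> {1..n} \<Longrightarrow> t \<le> L a \<Longrightarrow> ufil a t t = {\<zero>\<^bsub>uni a t\<^esub>}"
proof -
  assume a: "a \<in> {1..n}" and t: "t \<le> L a"
  interpret left_module R "uni a t" by (rule uni_left_module[OF a t])
  have "y = \<zero>\<^bsub>uni a t\<^esub>" if "y \<in> ufil a t t" for y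
    using that by (intro uni_eqI[of _ a t]) (auto simp: ufil_def uc_zero)
  then show ?thesis using submodule_closed(2)[OF ufil_submodule[OF a t, of t]] by blast
qed

text \<open>A nonzero element generates the term of the composition series given by its shortest path.\<close>

lemma ufil_generated:
  assumes a: "a \<in> {1..n}" and t: "t \<le> L a" and H: "submodule H R (uni a t)"
    and y: "y \<in> H" "y \<in> ufil a t s" "uc a y s \<noteq> 0" and s: "s \<le> t"
  shows "ufil a t s \<subseteq> H"
  using s y
proof (induction s arbitrary: y rule: inc_induct)
  case base
  then show ?case using ufil_last[OF a t] submodule_closed(2)[OF H] by simp
next
  case (step s)
  interpret left_module R "uni a t" by (rule uni_left_module[OF a t])
  note H' = submodule_closed[OF H]
  have yU: "y \<in> carrier (uni a t)" using step.prems by (simp add: ufil_def)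
  have next_sub: "ufil a t (Suc s) \<subseteq> H"
  proof (cases "Suc s < t")
    case True
    show ?thesis
    proof (rule step.IH)
      show "arr \<odot>\<^bsub>uni a t\<^esub> y \<in> H" using step.prems by (intro H'(5)) auto
      show "arr \<odot>\<^bsub>uni a t\<^esub> y \<in> ufil a t (Suc s)"
        using step.prems yU a t smult_closed[OF arr_closed yU] by (auto simp: ufil_def uc_arr)
      show "uc a (arr \<odot>\<^bsub>uni a t\<^esub> y) (Suc s) \<noteq> 0"
        using step.prems yU a t True by (simp add: uc_arr)
    qed
  next
    case False
    then have "Suc s = t" using step.hyps by simp
    then show ?thesis using ufil_last[OF a t] H'(2) by simp
  qed
  show ?case
  proof
    fix z assume z: "z \<in> ufil a t s"
    then have zU: "z \<in> carrier (uni a t)" by (simp add: ufil_def)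
    define w where "w = diag (\<lambda>_. uc a z s / uc a y s) \<odot>\<^bsub>uni a t\<^esub> y"
    have w: "w \<in> H" unfolding w_def using step.prems by (intro H'(5)) auto
    have wU: "w \<in> carrier (uni a t)" using w H'(1) by blast
    have w_uc: "uc a w l = uc a z s / uc a y s * uc a y l" for l
      unfolding w_def by (rule uc_diag[OF a t yU])
    have "uc a (z \<ominus>\<^bsub>uni a t\<^esub> w) l = 0" if "l < Suc s" for l
      using that z zU wU step.prems a t by (auto simp: uc_diff w_uc ufil_def less_Suc_eq)
    then have "z \<ominus>\<^bsub>uni a t\<^esub> w \<in> ufil a t (Suc s)" using zU wU by (simp add: ufil_def)
    then have "(z \<ominus>\<^bsub>uni a t\<^esub> w) \<oplus>\<^bsub>uni a t\<^esub> w \<in> H" using next_sub w H'(3) by blast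
    then show "z \<in> H" using zU wU by (simp add: M.minus_eq M.a_assoc M.l_neg)
  qed
qed

lemma uc_leading:
  assumes "y \<in> carrier (uni a t)" "y \<noteq> \<zero>\<^bsub>uni a t\<^esub>" "\<zero>\<^bsub>uni a t\<^esub> \<in> carrier (uni a t)"
  obtains s where "s < t" "uc a y s \<noteq> 0" "y \<in> ufil a t s"
proof -
  have "\<exists>l. uc a y l \<noteq> 0" using uni_eqI[OF assms(1,3)] assms(2) by (auto simp: uc_zero)
  then obtain s where s: "uc a y s \<noteq> 0" "\<And>l. l < s \<Longrightarrow> uc a y l = 0"
    using exists_least_iff[of "\<lambda>l. uc a y l \<noteq> 0"] by auto
  show thesis
    by (rule that[of s]) (use s assms(1) uc_outside[OF assms(1), of s] in \<open>auto simp: ufil_def not_le[symmetric]\<close>)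
qed

lemma uni_uniserial:
  assumes a: "a \<in> {1..n}" and t: "t \<le> L a"
  shows "uniserial_module R (uni a t)"
proof -
  interpret left_module R "uni a t" by (rule uni_left_module[OF a t])
  have "K \<subseteq> H" if H: "submodule H R (uni a t)" and K: "submodule K R (uni a t)" and "\<not> H \<subseteq> K" for H K
  proof
    note H' = submodule_closed[OF H] and K' = submodule_closed[OF K]
    obtain y where y: "y \<in> H" "y \<notin> K" using \<open>\<not> H \<subseteq> K\<close> by blast
    fix z assume z: "z \<in> K"
    show "z \<in> H"
    proof (cases "z = \<zero>\<^bsub>uni a t\<^esub>")
      case True
      then show ?thesis using H'(2) by simp
    next
      case False
      have yU: "y \<in> carrier (uni a t)" and zU: "z \<in> carrier (uni a t)" using y z H'(1) K'(1) by auto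
      have "y \<noteq> \<zero>\<^bsub>uni a t\<^esub>" using y K'(2) by auto
      then obtain s where s: "s < t" "uc a y s \<noteq> 0" "y \<in> ufil a t s"
        using uc_leading[OF yU _ M.zero_closed] by blast
      obtain u where u: "u < t" "uc a z u \<noteq> 0" "z \<in> ufil a t u"
        using uc_leading[OF zU False M.zero_closed] by blast
      have "s \<le> u"
      proof (rule ccontr)
        assume "\<not> s \<le> u"
        then have "y \<in> ufil a t u" using s(3) by (auto simp: ufil_def)
        moreover have "ufil a t u \<subseteq> K" using ufil_generated[OF a t K z u(3,2)] u(1) by simp
        ultimately show False using y(2) by blast
      qed
      then have "z \<in> ufil a t s" using u(3) by (auto simp: ufil_def)
      moreover have "ufil a t s \<subseteq> H" using ufil_generated[OF a t H y(1) s(3,2)] s(1) by simp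
      ultimately show ?thesis by blast
    qed
  qed
  then show ?thesis unfolding uniserial_module_def using left_module_axioms by blast
qed

lemma ufil_factor_simple:
  assumes a: "a \<in> {1..n}" and t: "t \<le> L a" and s: "s < t"
  defines "Q \<equiv> quotient_module ((uni a t)\<lparr>carrier := ufil a t s\<rparr>) (ufil a t (Suc s))"
  shows "simple_module R Q \<and> (\<exists>x\<in>carrier Q. chi {cyc n (a + s)} \<odot>\<^bsub>Q\<^esub> x \<noteq> \<zero>\<^bsub>Q\<^esub>)"
proof -
  interpret U: left_module R "uni a t" by (rule uni_left_module[OF a t])
  define F where "F = (uni a t)\<lparr>carrier := ufil a t s\<rparr>"
  define N where "N = ufil a t (Suc s)"
  have F: "left_module R F"
    unfolding F_def by (rule U.submodule_as_module[OF ufil_submodule[OF a t]])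
  interpret F: left_module R F by (rule F)
  have FU: "carrier F \<subseteq> carrier (uni a t)" by (auto simp: F_def ufil_def)
  have Fs: "\<zero>\<^bsub>F\<^esub> = \<zero>\<^bsub>uni a t\<^esub>" "x \<oplus>\<^bsub>F\<^esub> y = x \<oplus>\<^bsub>uni a t\<^esub> y" "r \<odot>\<^bsub>F\<^esub> x = r \<odot>\<^bsub>uni a t\<^esub> x" for x y r
    by (simp_all add: F_def)
  note N' = submodule_closed[OF ufil_submodule[OF a t, of "Suc s"], folded N_def]
  have N: "submodule N R F"
    by (rule F.submoduleI) (use N' in \<open>auto simp: Fs F_def N_def ufil_def\<close>)
  have Q: "Q = quotient_module F N" by (simp add: Q_def F_def N_def)
  note q = quotient_module_coset[OF F N, folded Q]
  have QM: "left_module R Q" unfolding Q by (rule quotient_left_module[OF F N])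
  interpret Q: left_module R Q by (rule QM)
  have N_iff: "x \<in> N \<longleftrightarrow> uc a x s = 0" if "x \<in> carrier F" for x
    using that by (auto simp: F_def N_def ufil_def less_Suc_eq)
  define e where "e = uvec a t (\<lambda>l. if l = s then 1 else 0)"
  have eU: "e \<in> carrier (uni a t)" by (simp add: e_def)
  have e: "e \<in> carrier F" "uc a e s = 1"
    using a t s by (auto simp: e_def F_def ufil_def uc_uvec)
  have eN: "e \<notin> N" using N_iff[OF e(1)] e(2) by simp
  have "N +>\<^bsub>F\<^esub> e \<noteq> \<zero>\<^bsub>Q\<^esub>" using q(4)[OF e(1)] eN q(2) by simp
  moreover have eQ: "N +>\<^bsub>F\<^esub> e \<in> carrier Q" using q(1) e(1) by simp
  ultimately have nontriv: "carrier Q \<noteq> {\<zero>\<^bsub>Q\<^esub>}" by blast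
  have generated: "carrier Q \<subseteq> H" if H: "submodule H R Q" and X: "X \<in> H" "X \<noteq> \<zero>\<^bsub>Q\<^esub>" for H X
  proof
    note H' = submodule_closed[OF H]
    obtain x where x: "x \<in> carrier F" "X = N +>\<^bsub>F\<^esub> x" using X(1) H'(1) q(1) by auto
    have x0: "uc a x s \<noteq> 0" using N_iff[OF x(1)] q(4)[OF x(1)] X(2) x(2) q(2) by simp
    fix Z assume "Z \<in> carrier Q"
    then obtain z where z: "z \<in> carrier F" "Z = N +>\<^bsub>F\<^esub> z" using q(1) by auto
    define r where "r = diag (\<lambda>_. uc a z s / uc a x s)"
    have r: "r \<in> carrier R" by (simp add: r_def)
    have xU: "x \<in> carrier (uni a t)" and zU: "z \<in> carrier (uni a t)" using x z FU by auto
    define v where "v = z \<ominus>\<^bsub>uni a t\<^esub> r \<odot>\<^bsub>uni a t\<^esub> x"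
    have vU: "v \<in> carrier (uni a t)" unfolding v_def using r xU zU by (intro U.M.minus_closed U.smult_closed)
    have "uc a v l = 0" if "l \<le> s" for l
    proof -
      have "uc a v l = uc a z l - uc a z s / uc a x s * uc a x l"
        unfolding v_def using uc_diff[OF a t zU U.smult_closed[OF r xU]] uc_diag[OF a t xU]
        by (simp add: r_def)
      moreover have "uc a z l = 0 \<and> uc a x l = 0" if "l < s"
        using x(1) z(1) that by (simp add: F_def ufil_def)
      ultimately show ?thesis using x0 that by (cases "l = s") auto
    qed
    then have vN: "v \<in> N" using vU by (simp add: N_def ufil_def less_Suc_eq_le)
    then have vF: "v \<in> carrier F" using submodule_closed(1)[OF N] by blast
    have "z = r \<odot>\<^bsub>F\<^esub> x \<oplus>\<^bsub>F\<^esub> v"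
      unfolding Fs v_def using r xU zU
      by (simp add: U.M.minus_eq U.M.a_assoc U.M.a_comm[of "r \<odot>\<^bsub>uni a t\<^esub> x"] U.M.l_neg)
    then have "Z = (r \<odot>\<^bsub>Q\<^esub> X) \<oplus>\<^bsub>Q\<^esub> (N +>\<^bsub>F\<^esub> v)"
      using r x z vF by (simp add: q(3,5))
    also have "N +>\<^bsub>F\<^esub> v = \<zero>\<^bsub>Q\<^esub>" using q(4)[OF vF] vN q(2) by simp
    also have "r \<odot>\<^bsub>Q\<^esub> X \<oplus>\<^bsub>Q\<^esub> \<zero>\<^bsub>Q\<^esub> = r \<odot>\<^bsub>Q\<^esub> X"
      using H'(1,5) r X(1) by (intro Q.M.r_zero) blast
    finally show "Z \<in> H" using H'(5)[OF r X(1)] by simp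
  qed
  have "H = {\<zero>\<^bsub>Q\<^esub>} \<or> H = carrier Q" if H: "submodule H R Q" for H
  proof (cases "H \<subseteq> {\<zero>\<^bsub>Q\<^esub>}")
    case True
    then show ?thesis using submodule_closed(2)[OF H] by blast
  next
    case False
    then show ?thesis using generated[OF H] submodule_closed(1)[OF H] by blast
  qed
  then have simple: "simple_module R Q"
    unfolding simple_module_def using QM nontriv by blast
  have "chi {cyc n (a + s)} \<odot>\<^bsub>uni a t\<^esub> e = e"
  proof (rule uni_eqI[OF U.smult_closed[OF chi_closed eU] eU])
    fix l
    show "uc a (chi {cyc n (a + s)} \<odot>\<^bsub>uni a t\<^esub> e) l = uc a e l"
      unfolding chi_def uc_diag[OF a t eU] using uc_uvec[OF a t] by (simp add: e_def)
  qed
  then have "chi {cyc n (a + s)} \<odot>\<^bsub>Q\<^esub> (N +>\<^bsub>F\<^esub> e) = N +>\<^bsub>F\<^esub> e"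
    using q(5)[OF chi_closed e(1), of "{cyc n (a + s)}"] by (simp add: Fs)
  then have "chi {cyc n (a + s)} \<odot>\<^bsub>Q\<^esub> (N +>\<^bsub>F\<^esub> e) \<noteq> \<zero>\<^bsub>Q\<^esub>" using \<open>N +>\<^bsub>F\<^esub> e \<noteq> \<zero>\<^bsub>Q\<^esub>\<close> by simp
  with eQ simple show ?thesis by blast
qed


section \<open>Exact sequences of uniserial modules\<close>

lemma cf_mult_uni_zero:
  assumes "r \<in> carrier R" "y \<in> carrier (uni a t)" "i \<noteq> a"
  shows "cf (r \<otimes> y 0) (i, l) = 0"
proof (cases "i \<in> {1..n} \<and> l < L i")
  case True
  have "cf (y 0) (i, m) = 0" for m using uni_cf_zero[OF assms(2)] assms(3) by simp
  then show ?thesis using True assms uni_nth[OF assms(2)] by (simp add: cf_mult)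
qed (use assms uni_nth[OF assms(2)] in \<open>simp add: cf_outside\<close>)

lemma uni_projective:
  assumes a: "a \<in> {1..n}"
  shows "fg_projective R (uni a (L a))"
proof -
  let ?U = "uni a (L a)"
  interpret U: left_module R ?U by (rule uni_left_module[OF a order_refl])
  have sm: "r \<odot>\<^bsub>?U\<^esub> y = (\<lambda>s. r \<otimes> y s)" if r: "r \<in> carrier R" and y: "y \<in> carrier ?U" for r y
  proof
    fix s
    have "mk (\<lambda>(i, l). if l < L a then cf (r \<otimes> y 0) (i, l) else 0) = r \<otimes> y 0"
    proof (rule cf_eqI)
      fix i l assume "i \<in> {1..n}" "l < L i"
      then show "cf (mk (\<lambda>(i, l). if l < L a then cf (r \<otimes> y 0) (i, l) else 0)) (i, l) = cf (r \<otimes> y 0) (i, l)"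
        using cf_mult_uni_zero[OF r y, of i l] by (cases "i = a") (auto simp: cf_mk)
    qed (use r uni_nth[OF y] in auto)
    moreover have "y s = \<zero>" if "s > 0" using y that by (simp add: uni_carrier)
    ultimately show "(r \<odot>\<^bsub>?U\<^esub> y) s = r \<otimes> y s" using r by (cases "s = 0") (simp_all add: uni_simps)
  qed
  have i: "(\<lambda>y. y) \<in> mod_hom R ?U (free_module R 1)"
  proof (rule mod_homI)
    fix y assume y: "y \<in> carrier ?U"
    show "y \<in> carrier (free_module R 1)" using uni_nth[OF y] y by (simp add: uni_carrier)
  qed (simp_all add: uni_simps(2) sm)
  have emb_cl: "emb (x \<otimes> chi {a}) \<in> carrier ?U" if x: "x \<in> carrier R" for x
  proof -
    have "i = a \<and> l < L a" if "cf (x \<otimes> chi {a}) (i, l) \<noteq> 0" for i l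
    proof -
      have "i = a" using that x by (simp add: cf_mult_chi split: if_splits)
      then show ?thesis using cf_supp[OF _ that] x by simp
    qed
    then show ?thesis using x by (simp add: uni_carrier)
  qed
  have p: "(\<lambda>y. emb (y 0 \<otimes> chi {a})) \<in> mod_hom R (free_module R 1) ?U"
  proof (rule mod_homI)
    fix x y assume x: "x \<in> carrier (free_module R 1)"
    note x0 = free_module_nth[OF x, of 0]
    show "emb (x 0 \<otimes> chi {a}) \<in> carrier ?U" by (rule emb_cl[OF x0])
    show "emb ((r \<odot>\<^bsub>free_module R 1\<^esub> x) 0 \<otimes> chi {a}) = r \<odot>\<^bsub>?U\<^esub> emb (x 0 \<otimes> chi {a})"
      if "r \<in> carrier R" for r
      unfolding sm[OF that emb_cl[OF x0]] using that x0 by (simp add: emb_def m_assoc fun_eq_iff)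
    assume y: "y \<in> carrier (free_module R 1)"
    show "emb ((x \<oplus>\<^bsub>free_module R 1\<^esub> y) 0 \<otimes> chi {a}) =
        emb (x 0 \<otimes> chi {a}) \<oplus>\<^bsub>?U\<^esub> emb (y 0 \<otimes> chi {a})"
      using x0 free_module_nth[OF y, of 0] by (simp add: uni_simps(2) emb_def l_distr fun_eq_iff)
  qed
  have pi: "\<forall>y\<in>carrier ?U. emb (y 0 \<otimes> chi {a}) = y"
  proof
    fix y assume y: "y \<in> carrier ?U"
    show "emb (y 0 \<otimes> chi {a}) = y"
      by (rule uni_eqI[OF emb_cl[OF uni_nth[OF y]] y]) (simp add: uc_def cf_mult_chi uni_nth[OF y])
  qed
  show ?thesis
    unfolding fg_projective_def
    by (intro conjI U.left_module_axioms exI[of _ 1] bexI[OF _ i] bexI[OF _ p] pi)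
qed

lemma L_steps: "a \<in> {1..n} \<Longrightarrow> L a \<le> L (cyc n (a + s)) + s"
proof (induction s)
  case (Suc s)
  have "L (cyc n (a + s)) \<le> Suc (L (cyc n (cyc n (a + s) + 1)))" by (rule L_step[OF cyc_mem[OF n_pos]])
  then show ?case using Suc cyc_add_left[OF n_pos, of "a + s" 1] by simp
qed (simp add: cyc_id)

text \<open>The projection \<open>uni a t \<rightarrow> uni a s\<close> and the inclusion of its kernel.\<close>

definition upr :: "nat \<Rightarrow> nat \<Rightarrow> (nat \<Rightarrow> 'r) \<Rightarrow> nat \<Rightarrow> 'r"
  where "upr a s y = uvec a s (uc a y)"

definition uinc :: "nat \<Rightarrow> nat \<Rightarrow> nat \<Rightarrow> (nat \<Rightarrow> 'r) \<Rightarrow> nat \<Rightarrow> 'r"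
  where "uinc a s t y = uvec a t (\<lambda>l. if s \<le> l then uc (cyc n (a + s)) y (l - s) else 0)"

context
  fixes a s t
  assumes a: "a \<in> {1..n}" and s: "s \<le> t" and t: "t \<le> L a"
begin

lemma uc_upr: "uc a (upr a s y) l = (if l < s then uc a y l else 0)"
  unfolding upr_def by (rule uc_uvec[OF a le_trans[OF s t]])

lemma upr_closed: "upr a s y \<in> carrier (uni a s)"
  by (simp add: upr_def)

lemma upr_hom: "upr a s \<in> mod_hom R (uni a t) (uni a s)"
proof -
  note s' = le_trans[OF s t]
  interpret T: left_module R "uni a t" by (rule uni_left_module[OF a t])
  interpret S: left_module R "uni a s" by (rule uni_left_module[OF a s'])
  show ?thesis
  proof (rule mod_homI)
    fix x y assume x: "x \<in> carrier (uni a t)"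
    show "upr a s x \<in> carrier (uni a s)" by (rule upr_closed)
    show "upr a s (x \<oplus>\<^bsub>uni a t\<^esub> y) = upr a s x \<oplus>\<^bsub>uni a s\<^esub> upr a s y" if "y \<in> carrier (uni a t)"
      using x that by (intro uni_eqI[of _ a s] S.M.a_closed upr_closed)
        (simp_all add: uc_upr uc_add upr_closed)
    show "upr a s (r \<odot>\<^bsub>uni a t\<^esub> x) = r \<odot>\<^bsub>uni a s\<^esub> upr a s x" if r: "r \<in> carrier R" for r
    proof (rule uni_eqI[OF upr_closed S.smult_closed[OF r upr_closed]])
      fix l assume l: "l < s"
      have "cf (r \<otimes> x 0) (a, l) = cf (r \<otimes> upr a s x 0) (a, l)"
      proof (rule cf_uni_cong)
        show "cf (x 0) (a, m) = cf (upr a s x 0) (a, m)" if "m \<le> l" for m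
          using uc_upr[of x m] that l by (simp add: uc_def)
      qed (use a l s' r uni_nth[OF x] uni_nth[OF upr_closed] in auto)
      then show "uc a (upr a s (r \<odot>\<^bsub>uni a t\<^esub> x)) l = uc a (r \<odot>\<^bsub>uni a s\<^esub> upr a s x) l"
        using l s uc_smult[OF a t r x] uc_smult[OF a s' r upr_closed] by (simp add: uc_upr)
    qed
  qed
qed

lemma upr_surj: "upr a s ` carrier (uni a t) = carrier (uni a s)"
proof
  show "upr a s ` carrier (uni a t) \<subseteq> carrier (uni a s)" using upr_closed by blast
  show "carrier (uni a s) \<subseteq> upr a s ` carrier (uni a t)"
  proof
    fix z assume z: "z \<in> carrier (uni a s)"
    have "z = upr a s (uvec a t (uc a z))"
      by (rule uni_eqI[OF z upr_closed]) (use s in \<open>simp add: uc_upr uc_uvec[OF a t]\<close>)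
    then show "z \<in> upr a s ` carrier (uni a t)" by (rule image_eqI[OF _ uvec_closed])
  qed
qed

lemma upr_kernel: "a_kernel (uni a t) (uni a s) (upr a s) = ufil a t s"
proof -
  interpret S: left_module R "uni a s" by (rule uni_left_module[OF a le_trans[OF s t]])
  have "upr a s x = \<zero>\<^bsub>uni a s\<^esub> \<longleftrightarrow> (\<forall>l<s. uc a x l = 0)" for x
  proof
    assume eq: "upr a s x = \<zero>\<^bsub>uni a s\<^esub>"
    show "\<forall>l<s. uc a x l = 0"
    proof (intro allI impI)
      fix l assume "l < s"
      then show "uc a x l = 0" using uc_upr[of x l] uc_zero[of a s l] by (simp add: eq)
    qed
  next
    assume "\<forall>l<s. uc a x l = 0"
    then show "upr a s x = \<zero>\<^bsub>uni a s\<^esub>"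
      by (intro uni_eqI[OF upr_closed S.M.zero_closed]) (simp add: uc_upr uc_zero)
  qed
  then show ?thesis by (simp add: a_kernel_def' ufil_def)
qed

lemma uc_uinc: "uc a (uinc a s t y) l = (if s \<le> l \<and> l < t then uc (cyc n (a + s)) y (l - s) else 0)"
  unfolding uinc_def by (simp add: uc_uvec[OF a t])

lemma uinc_closed: "uinc a s t y \<in> carrier (uni a t)"
  by (simp add: uinc_def)

lemma uinc_bound: "cyc n (a + s) \<in> {1..n}" "t - s \<le> L (cyc n (a + s))"
  using cyc_mem[OF n_pos, of "a + s"] L_steps[OF a, of s] t by auto

lemma uinc_hom: "uinc a s t \<in> mod_hom R (uni (cyc n (a + s)) (t - s)) (uni a t)"
proof -
  let ?b = "cyc n (a + s)"
  note b = uinc_bound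
  interpret T: left_module R "uni a t" by (rule uni_left_module[OF a t])
  interpret S: left_module R "uni ?b (t - s)" by (rule uni_left_module[OF b])
  show ?thesis
  proof (rule mod_homI)
    fix x y assume x: "x \<in> carrier (uni ?b (t - s))"
    show "uinc a s t x \<in> carrier (uni a t)" by (rule uinc_closed)
    show "uinc a s t (x \<oplus>\<^bsub>uni ?b (t - s)\<^esub> y) = uinc a s t x \<oplus>\<^bsub>uni a t\<^esub> uinc a s t y"
      if "y \<in> carrier (uni ?b (t - s))"
      using x that by (intro uni_eqI[of _ a t] T.M.a_closed uinc_closed)
        (simp_all add: uc_uinc uc_add[of _ a t] uc_add[of _ ?b "t - s"] uinc_closed)
    show "uinc a s t (r \<odot>\<^bsub>uni ?b (t - s)\<^esub> x) = r \<odot>\<^bsub>uni a t\<^esub> uinc a s t x" if r: "r \<in> carrier R" for r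
    proof (rule uni_eqI[OF uinc_closed T.smult_closed[OF r uinc_closed]])
      fix l assume l: "l < t"
      let ?f = "\<lambda>m. cf r (cyc n (a + m), l - m) * uc a (uinc a s t x) m"
      have eq: "uc a (r \<odot>\<^bsub>uni a t\<^esub> uinc a s t x) l = (\<Sum>m\<le>l. ?f m)"
        using l t a r uni_nth[OF uinc_closed[of x], of 0] uc_smult[OF a t r uinc_closed[of x], of l]
        by (simp add: cf_mult uc_def)
      show "uc a (uinc a s t (r \<odot>\<^bsub>uni ?b (t - s)\<^esub> x)) l = uc a (r \<odot>\<^bsub>uni a t\<^esub> uinc a s t x) l"
      proof (cases "s \<le> l")
        case True
        have "(\<Sum>m\<le>l. ?f m) = (\<Sum>m\<in>{0 + s..(l - s) + s}. ?f m)"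
          using True by (intro sum.mono_neutral_right) (auto simp: uc_uinc)
        also have "\<dots> = (\<Sum>m\<in>{0..l - s}. ?f (m + s))" by (rule sum.shift_bounds_cl_nat_ivl)
        also have "\<dots> = (\<Sum>m\<le>l - s. cf r (cyc n (?b + m), l - s - m) * cf (x 0) (?b, m))"
        proof (rule sum.cong)
          fix m assume m: "m \<in> {..l - s}"
          have "cyc n (a + (m + s)) = cyc n (?b + m)"
            using cyc_add_left[OF n_pos, of "a + s" m] by (simp add: ac_simps)
          then show "?f (m + s) = cf r (cyc n (?b + m), l - s - m) * cf (x 0) (?b, m)"
            using m l True by (auto simp: uc_uinc) (auto simp: uc_def add.commute)
        qed auto
        also have "\<dots> = cf (r \<otimes> x 0) (?b, l - s)"
          using l b r uni_nth[OF x, of 0] True by (simp add: cf_mult)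
        also have "\<dots> = uc ?b (r \<odot>\<^bsub>uni ?b (t - s)\<^esub> x) (l - s)"
          using diff_less_mono[OF l True] uc_smult[OF b r x, of "l - s"] by simp
        finally show ?thesis unfolding eq using l True by (simp add: uc_uinc)
      next
        case False
        then have "(\<Sum>m\<le>l. ?f m) = 0" by (intro sum.neutral) (auto simp: uc_uinc)
        then show ?thesis unfolding eq using False by (simp add: uc_uinc)
      qed
    qed
  qed
qed

lemma uinc_inj: "inj_on (uinc a s t) (carrier (uni (cyc n (a + s)) (t - s)))"
proof (rule inj_onI)
  fix x y assume x: "x \<in> carrier (uni (cyc n (a + s)) (t - s))"
    and y: "y \<in> carrier (uni (cyc n (a + s)) (t - s))" and eq: "uinc a s t x = uinc a s t y"
  show "x = y"
  proof (rule uni_eqI[OF x y])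
    fix l assume "l < t - s"
    then have "l + s < t" by simp
    then show "uc (cyc n (a + s)) x l = uc (cyc n (a + s)) y l"
      using uc_uinc[of x "l + s"] uc_uinc[of y "l + s"] eq by simp
  qed
qed

lemma uinc_image: "uinc a s t ` carrier (uni (cyc n (a + s)) (t - s)) = ufil a t s"
proof
  show "uinc a s t ` carrier (uni (cyc n (a + s)) (t - s)) \<subseteq> ufil a t s"
    using uinc_closed by (auto simp: ufil_def uc_uinc)
  show "ufil a t s \<subseteq> uinc a s t ` carrier (uni (cyc n (a + s)) (t - s))"
  proof
    fix z assume z: "z \<in> ufil a t s"
    then have zU: "z \<in> carrier (uni a t)" by (simp add: ufil_def)
    have "z = uinc a s t (uvec (cyc n (a + s)) (t - s) (\<lambda>l. uc a z (l + s)))"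
      by (rule uni_eqI[OF zU uinc_closed])
        (use z in \<open>auto simp: uc_uinc uc_uvec[OF uinc_bound] ufil_def\<close>)
    then show "z \<in> uinc a s t ` carrier (uni (cyc n (a + s)) (t - s))" by (rule image_eqI[OF _ uvec_closed])
  qed
qed

end

lemma uni_pd_le_Suc:
  assumes a: "a \<in> {1..n}" and s: "s \<le> L a" and pd: "pd_le R l (uni (cyc n (a + s)) (L a - s))"
  shows "pd_le R (Suc l) (uni a s)"
proof (rule pd_le_Suc[OF _ pd uni_projective[OF a]])
  note 1 = a s order_refl[of "L a"]
  show "left_module R (uni (cyc n (a + s)) (L a - s))" by (rule uni_left_module[OF uinc_bound[OF 1]])
  show "upr a s \<in> mod_hom R (uni a (L a)) (uni a s)" by (rule upr_hom[OF 1])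
  show "upr a s ` carrier (uni a (L a)) = carrier (uni a s)" by (rule upr_surj[OF 1])
  show "uinc a s (L a) \<in> mod_hom R (uni (cyc n (a + s)) (L a - s)) (uni a (L a))" by (rule uinc_hom[OF 1])
  show "inj_on (uinc a s (L a)) (carrier (uni (cyc n (a + s)) (L a - s)))" by (rule uinc_inj[OF 1])
  show "uinc a s (L a) ` carrier (uni (cyc n (a + s)) (L a - s)) = a_kernel (uni a (L a)) (uni a s) (upr a s)"
    unfolding upr_kernel[OF 1] by (rule uinc_image[OF 1])
qed

lemma uni_fin_gen:
  assumes a: "a \<in> {1..n}" and t: "t \<le> L a" "0 < t"
  shows "fin_gen R (uni a t)"
proof -
  define g where "g = uvec a t (\<lambda>l. if l = 0 then 1 else 0)"
  have g: "g \<in> carrier (uni a t)" "uc a g 0 \<noteq> 0" using a t by (auto simp: g_def uc_uvec)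
  have "H = carrier (uni a t)" if H: "submodule H R (uni a t)" and gH: "{g} \<subseteq> H" for H
  proof -
    have "ufil a t 0 \<subseteq> H"
      by (rule ufil_generated[OF a t(1) H]) (use g gH in \<open>auto simp: ufil_def\<close>)
    then show ?thesis using submodule_closed(1)[OF H] by (auto simp: ufil_def)
  qed
  moreover have "finite {g}" "{g} \<subseteq> carrier (uni a t)" using g by auto
  ultimately show ?thesis unfolding fin_gen_def by blast
qed


section \<open>Lower bounds for projective dimensions\<close>

text \<open>\<open>S\<^sub>a\<close> is not projective if it is not in the socle of a projective module.\<close>

lemma simple_not_projective:
  assumes a: "a \<in> {1..n}" "a \<notin> E" and E: "\<And>i. i \<in> {1..n} \<Longrightarrow> cyc n (i + L i - 1) \<in> E"
  shows "\<not> pd_le R 0 (uni a 1)"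
proof
  assume "pd_le R 0 (uni a 1)"
  then obtain P d \<epsilon> where res: "proj_resolution R (uni a 1) P d \<epsilon>"
    and P0: "\<forall>i>0. carrier (P i) = {\<zero>\<^bsub>P i\<^esub>}"
    unfolding pd_le_def by (elim exE conjE)
  have L1: "1 \<le> L a" using L_ge2[OF a(1)] by simp
  note UM = uni_left_module[OF a(1) L1]
  interpret U: left_module R "uni a 1" by (rule UM)
  have proj: "fg_projective R (P i)" for i using res by (simp add: proj_resolution_def)
  note mod = fg_projective_left_module[OF proj]
  interpret P: left_module R "P 0" by (rule mod)
  have \<epsilon>: "\<epsilon> \<in> mod_hom R (P 0) (uni a 1)" "\<epsilon> ` carrier (P 0) = carrier (uni a 1)"
    and d: "d 0 \<in> mod_hom R (P 1) (P 0)" and ex: "d 0 ` carrier (P 1) = a_kernel (P 0) (uni a 1) \<epsilon>"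
    using res by (simp_all add: proj_resolution_def)
  have inj: "y = \<zero>\<^bsub>P 0\<^esub>" if "y \<in> carrier (P 0)" "\<epsilon> y = \<zero>\<^bsub>uni a 1\<^esub>" for y
  proof -
    have "y \<in> d 0 ` carrier (P 1)" unfolding ex using that by (simp add: a_kernel_def')
    then show ?thesis using P0 mod_hom_zero[OF mod mod d] by simp
  qed
  define x where "x = uvec a 1 (\<lambda>_. 1)"
  have x: "x \<in> carrier (uni a 1)" by (simp add: x_def)
  then have "x \<in> \<epsilon> ` carrier (P 0)" using \<epsilon>(2) by simp
  then obtain y where y: "y \<in> carrier (P 0)" "x = \<epsilon> y" by blast
  have "arr \<odot>\<^bsub>uni a 1\<^esub> x = \<zero>\<^bsub>uni a 1\<^esub>"
  proof (rule uni_eqI[OF U.smult_closed[OF arr_closed x] U.M.zero_closed])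
    fix l :: nat assume "l < 1"
    then show "uc a (arr \<odot>\<^bsub>uni a 1\<^esub> x) l = uc a \<zero>\<^bsub>uni a 1\<^esub> l"
      unfolding uc_arr[OF a(1) L1 x] uc_zero by simp
  qed
  then have 1: "arr \<odot>\<^bsub>P 0\<^esub> y = \<zero>\<^bsub>P 0\<^esub>"
    using y mod_hom_smult[OF \<epsilon>(1) arr_closed y(1)] by (intro inj) simp_all
  have "chi E \<odot>\<^bsub>uni a 1\<^esub> x = \<zero>\<^bsub>uni a 1\<^esub>"
  proof (rule uni_eqI[OF U.smult_closed[OF chi_closed x] U.M.zero_closed])
    fix l :: nat assume "l < 1"
    then show "uc a (chi E \<odot>\<^bsub>uni a 1\<^esub> x) l = uc a \<zero>\<^bsub>uni a 1\<^esub> l"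
      using a unfolding chi_def uc_diag[OF a(1) L1 x] by (simp add: cyc_id uc_zero)
  qed
  then have 2: "chi E \<odot>\<^bsub>P 0\<^esub> y = \<zero>\<^bsub>P 0\<^esub>"
    using y mod_hom_smult[OF \<epsilon>(1) chi_closed[of E] y(1)] by (intro inj) simp_all
  have "y = \<zero>\<^bsub>P 0\<^esub>" by (rule projective_socle[OF proj y(1) E 1 2])
  then have "x = \<zero>\<^bsub>uni a 1\<^esub>" using y(2) mod_hom_zero[OF mod UM \<epsilon>(1)] by simp
  then have "uc a x 0 = 0" by (simp add: uc_zero)
  then show False using uc_uvec[OF a(1) L1, of "\<lambda>_. 1" 0] by (simp add: x_def)
qed

text \<open>\<open>P\<^sub>a / soc P\<^sub>a\<close> has projective dimension at least 2.  Otherwise its projective resolution has the form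
  \<open>P 1 \<rightarrow> P 0\<close>.  A lift \<open>p\<close> of the generator to \<open>P 0\<close> is moved by the longest path \<open>\<omega>\<close> from \<open>a\<close> into the image
  of \<open>P 1\<close>, where it is annihilated by the radical and hence is in the radical of \<open>P 1\<close>.  A comparison
  map \<open>\<psi>\<close> to \<open>P\<^sub>a\<close> sends the image of \<open>P 1\<close> to the socle of \<open>P\<^sub>a\<close>, so it annihilates \<open>\<omega> p\<close>; but
  \<open>\<psi> (\<omega> p)\<close> generates the socle.\<close>

lemma uni_mod_socle_pd:
  assumes a: "a \<in> {1..n}"
  shows "\<not> pd_le R 1 (uni a (L a - 1))"
proof
  let ?M = "uni a (L a - 1)" and ?U = "uni a (L a)"
  assume "pd_le R 1 ?M"
  then obtain P d \<epsilon> where res: "proj_resolution R ?M P d \<epsilon>"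
    and P0: "\<forall>i>1. carrier (P i) = {\<zero>\<^bsub>P i\<^esub>}"
    unfolding pd_le_def by (elim exE conjE)
  have L2: "2 \<le> L a" by (rule L_ge2[OF a])
  have L1: "L a - 1 \<le> L a" by simp
  note MM = uni_left_module[OF a L1] and UM = uni_left_module[OF a order_refl]
  note pr = a L1 order_refl[of "L a"]
  interpret M: left_module R ?M by (rule MM)
  interpret U: left_module R ?U by (rule UM)
  have proj: "fg_projective R (P i)" for i using res by (simp add: proj_resolution_def)
  note mod = fg_projective_left_module[OF proj]
  interpret P0: left_module R "P 0" by (rule mod)
  interpret P1: left_module R "P 1" by (rule mod)
  have \<epsilon>: "\<epsilon> \<in> mod_hom R (P 0) ?M" "\<epsilon> ` carrier (P 0) = carrier ?M"
    and d: "d 0 \<in> mod_hom R (P 1) (P 0)" "d 1 \<in> mod_hom R (P 2) (P 1)"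
    and ex0: "d 0 ` carrier (P 1) = a_kernel (P 0) ?M \<epsilon>"
    and ex1: "d 1 ` carrier (P 2) = a_kernel (P 1) (P 0) (d 0)"
    using res unfolding proj_resolution_def
    by (simp_all add: numeral_2_eq_2)
  have inj: "y = \<zero>\<^bsub>P 1\<^esub>" if "y \<in> carrier (P 1)" "d 0 y = \<zero>\<^bsub>P 0\<^esub>" for y
  proof -
    have "y \<in> d 1 ` carrier (P 2)" unfolding ex1 using that by (simp add: a_kernel_def')
    then show ?thesis using P0 mod_hom_zero[OF mod mod d(2)] by simp
  qed
  obtain \<psi> where \<psi>: "\<psi> \<in> mod_hom R (P 0) ?U" "\<And>x. x \<in> carrier (P 0) \<Longrightarrow> upr a (L a - 1) (\<psi> x) = \<epsilon> x"
    by (rule fg_projective_lift[OF proj UM MM upr_hom[OF pr] upr_surj[OF pr] \<epsilon>(1)]) (rule that)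
  define \<omega> where "\<omega> = bp a (L a - 1)"
  have \<omega>: "\<omega> \<in> carrier R" by (simp add: \<omega>_def)
  have cf_\<omega>: "cf (\<omega> \<otimes> x) (a, l) = (if l = L a - 1 then cf x (a, 0) else 0)" if "x \<in> carrier R" for x l
    using cf_bp_mult[OF that _ a, of "L a - 1" a l] L2 a by (auto simp: \<omega>_def cyc_id)
  have "uvec a (L a - 1) (\<lambda>l. if l = 0 then 1 else 0) \<in> \<epsilon> ` carrier (P 0)" unfolding \<epsilon>(2) by simp
  then obtain p where p: "uvec a (L a - 1) (\<lambda>l. if l = 0 then 1 else 0) = \<epsilon> p" "p \<in> carrier (P 0)"
    by (rule imageE)
  note \<epsilon>p = mod_hom_closed[OF \<epsilon>(1) p(2)] and \<psi>p = mod_hom_closed[OF \<psi>(1) p(2)]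
  define x where "x = \<omega> \<odot>\<^bsub>P 0\<^esub> p"
  have x: "x \<in> carrier (P 0)" using \<omega> p(2) by (simp add: x_def)
  have "\<omega> \<odot>\<^bsub>?M\<^esub> \<epsilon> p = \<zero>\<^bsub>?M\<^esub>"
  proof (rule uni_eqI[OF M.smult_closed[OF \<omega> \<epsilon>p] M.M.zero_closed])
    fix l assume "l < L a - 1"
    then show "uc a (\<omega> \<odot>\<^bsub>?M\<^esub> \<epsilon> p) l = uc a \<zero>\<^bsub>?M\<^esub> l"
      unfolding uc_smult[OF a L1 \<omega> \<epsilon>p] uc_zero cf_\<omega>[OF uni_nth[OF \<epsilon>p]] by simp
  qed
  then have "\<epsilon> x = \<zero>\<^bsub>?M\<^esub>" using mod_hom_smult[OF \<epsilon>(1) \<omega> p(2)] by (simp add: x_def)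
  then have "x \<in> d 0 ` carrier (P 1)" unfolding ex0 using x by (simp add: a_kernel_def')
  then obtain \<kappa> where \<kappa>: "\<kappa> \<in> carrier (P 1)" "x = d 0 \<kappa>" by blast
  have "arr \<otimes> \<omega> = \<zero>"
    by (rule cf_eqI) (auto simp: cf_arr_mult cf_zero \<omega>_def cf_bp)
  then have "arr \<odot>\<^bsub>P 0\<^esub> x = \<zero>\<^bsub>P 0\<^esub>"
    using \<omega> p(2) by (simp add: x_def P0.smult_assoc[symmetric])
  then have arr\<kappa>: "arr \<odot>\<^bsub>P 1\<^esub> \<kappa> = \<zero>\<^bsub>P 1\<^esub>"
    using \<kappa>(2) mod_hom_smult[OF d(1) arr_closed \<kappa>(1)]
    by (intro inj P1.smult_closed[OF arr_closed \<kappa>(1)]) simp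
  \<comment> \<open>As no indecomposable projective is simple, \<open>\<kappa>\<close> lies in the radical of \<open>P 1\<close>.\<close>
  obtain i m q where i: "i \<in> mod_hom R (P 1) (free_module R m)"
    and q: "q \<in> mod_hom R (free_module R m) (P 1)" and qi: "\<forall>x\<in>carrier (P 1). q (i x) = x"
    by (rule fg_projectiveE[OF proj])
  have "\<exists>y\<in>carrier (P 1). \<kappa> = arr \<odot>\<^bsub>P 1\<^esub> y"
  proof (rule projective_radical[OF mod i q qi \<kappa>(1)])
    fix s j assume j: "j \<in> {1..n}"
    have nth: "i \<kappa> s \<in> carrier R" by (rule free_module_nth[OF mod_hom_closed[OF i \<kappa>(1)]])
    have "arr \<odot>\<^bsub>free_module R m\<^esub> i \<kappa> = (\<lambda>_. \<zero>)"
      using mod_hom_smult[OF i arr_closed \<kappa>(1)] arr\<kappa> mod_hom_zero[OF mod free_module_left_module i]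
      by simp
    then have "arr \<otimes> i \<kappa> s = \<zero>" by (simp add: fun_eq_iff)
    then have "cf (arr \<otimes> i \<kappa> s) (j, 1) = 0" by (simp add: cf_zero)
    then show "cf (i \<kappa> s) (j, 0) = 0" using L_ge2[OF j] by (simp add: cf_arr_mult[OF nth])
  qed
  then obtain \<kappa>' where \<kappa>': "\<kappa>' \<in> carrier (P 1)" "\<kappa> = arr \<odot>\<^bsub>P 1\<^esub> \<kappa>'" by blast
  define y where "y = d 0 \<kappa>'"
  have y: "y \<in> carrier (P 0)" unfolding y_def by (rule mod_hom_closed[OF d(1) \<kappa>'(1)])
  have xy: "x = arr \<odot>\<^bsub>P 0\<^esub> y" using \<kappa>(2) \<kappa>' mod_hom_smult[OF d(1) arr_closed \<kappa>'(1)] by (simp add: y_def)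
  note \<psi>y = mod_hom_closed[OF \<psi>(1) y]
  have "y \<in> a_kernel (P 0) ?M \<epsilon>" unfolding ex0[symmetric] y_def using \<kappa>'(1) by (rule imageI)
  then have "upr a (L a - 1) (\<psi> y) = \<zero>\<^bsub>?M\<^esub>" using \<psi>(2)[OF y] by (simp add: a_kernel_def')
  then have "\<psi> y \<in> ufil a (L a) (L a - 1)"
    unfolding upr_kernel[OF pr, symmetric] using \<psi>y by (simp add: a_kernel_def')
  then have "uc a (arr \<odot>\<^bsub>?U\<^esub> \<psi> y) (L a - 1) = 0"
    using L2 unfolding uc_arr[OF a order_refl \<psi>y] by (simp add: ufil_def)
  then have "uc a (\<psi> x) (L a - 1) = 0" using mod_hom_smult[OF \<psi>(1) arr_closed y] by (simp add: xy)
  moreover have "uc a (\<psi> x) (L a - 1) = 1"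
  proof -
    have "uc a (\<psi> x) (L a - 1) = uc a (\<omega> \<odot>\<^bsub>?U\<^esub> \<psi> p) (L a - 1)"
      using mod_hom_smult[OF \<psi>(1) \<omega> p(2)] by (simp add: x_def)
    also have "\<dots> = uc a (\<psi> p) 0"
      unfolding uc_smult[OF a order_refl \<omega> \<psi>p] cf_\<omega>[OF uni_nth[OF \<psi>p]]
      using L2 by (simp add: uc_def)
    also have "\<dots> = uc a (upr a (L a - 1) (\<psi> p)) 0" unfolding uc_upr[OF pr] using L2 by simp
    also have "\<dots> = 1" unfolding \<psi>(2)[OF p(2)] p(1)[symmetric] uc_uvec[OF a L1] using L2 by simp
    finally show ?thesis .
  qed
  ultimately show False by simp
qed


section \<open>Finitistic dimension\<close>

lemma fin_dim_eq_1:
  assumes E: "E \<subseteq> {1..n}" "\<And>i. i \<in> E \<Longrightarrow> L i \<le> L (cyc n (i + 1))"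
    "\<And>i. i \<in> {1..n} \<Longrightarrow> cyc n (i + L i - 1) \<in> E"
    and a: "a \<in> {1..n}" "a \<notin> E" "L (cyc n (a + 1)) = L a - 1"
  shows "fin_dim R = 1"
proof (rule antisym)
  have short: "pd_le R 1 M" if "pd_le R (Suc l) M" for l and M :: "('r, nat \<Rightarrow> 'r) module"
    using that
  proof (induction l)
    case (Suc l)
    have "pd_le R (Suc l) M" by (rule pd_le_shorten[OF second_syzygy_projective[OF E] Suc.prems])
    then show ?case by (rule Suc.IH)
  qed simp
  show "fin_dim R \<le> 1"
    unfolding fin_dim_def
  proof (rule Sup_least)
    fix x assume "x \<in> {pdim R M |M :: ('r, nat \<Rightarrow> 'r) module. left_module R M \<and> fin_gen R M \<and> pdim R M < \<infinity>}"
    then obtain M :: "('r, nat \<Rightarrow> 'r) module" where M: "x = pdim R M" "pdim R M < \<infinity>" by blast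
    then obtain l where "pd_le R l M" using pdim_finite_iff by blast
    then have "pd_le R (Suc l) M" by (rule pd_le_mono) simp
    then have "pd_le R 1 M" by (rule short)
    then show "x \<le> 1" using pdim_le_iff[of R M 1] M(1) by (simp add: one_enat_def)
  qed
  have L1: "1 \<le> L a" using L_ge2[OF a(1)] by simp
  have "pd_le R (Suc 0) (uni a 1)"
    using uni_pd_le_Suc[OF a(1) L1 pd_le_0] uni_projective[OF cyc_mem[OF n_pos, of "a + 1"]] a(3)
    by simp
  then have "pdim R (uni a 1) < \<infinity>" unfolding pdim_finite_iff by blast
  moreover have "left_module R (uni a 1)" by (rule uni_left_module[OF a(1) L1])
  moreover have "fin_gen R (uni a 1)" by (rule uni_fin_gen[OF a(1) L1]) simp
  ultimately have "pdim R (uni a 1) \<le> fin_dim R" unfolding fin_dim_def by (intro Sup_upper) blast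
  moreover have "\<not> pdim R (uni a 1) \<le> enat 0"
    unfolding pdim_le_iff by (rule simple_not_projective[OF a(1,2) E(3)])
  ultimately show "1 \<le> fin_dim R" by (metis ileI1 not_le one_eSuc order_trans zero_enat_def)
qed

text \<open>The second assumption on \<open>b\<close> says that \<open>P\<^sub>b\<^sub>+\<^sub>1\<close> is the radical of \<open>P\<^sub>b\<close>; then \<open>P\<^sub>a / soc P\<^sub>a\<close> has
  projective dimension 2.\<close>

lemma fin_dim_not_le_1:
  assumes a: "a \<in> {1..n}" and b: "b = cyc n (a + L a - 1)" "L (cyc n (b + 1)) = L b - 1"
  shows "\<not> fin_dim R \<le> 1"
proof
  assume le: "fin_dim R \<le> 1"
  have bn: "b \<in> {1..n}" unfolding b(1) by (rule cyc_mem[OF n_pos])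
  have L1: "1 \<le> L b" "0 < L a - 1" using L_ge2[OF bn] L_ge2[OF a] by auto
  have b': "b = cyc n (a + (L a - 1))" "L a - (L a - 1) = 1" using b(1) L_ge2[OF a] by auto
  have "pd_le R (Suc 0) (uni b 1)"
    using uni_pd_le_Suc[OF bn L1(1) pd_le_0] uni_projective[OF cyc_mem[OF n_pos, of "b + 1"]] b(2)
    by simp
  then have "pd_le R (Suc (Suc 0)) (uni a (L a - 1))"
    using uni_pd_le_Suc[OF a, of "L a - 1" "Suc 0"] b' by simp
  then have "pdim R (uni a (L a - 1)) < \<infinity>" unfolding pdim_finite_iff by blast
  moreover have "left_module R (uni a (L a - 1))" by (rule uni_left_module[OF a]) simp
  moreover have "fin_gen R (uni a (L a - 1))" by (rule uni_fin_gen[OF a _ L1(2)]) simp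
  ultimately have "pdim R (uni a (L a - 1)) \<le> fin_dim R" unfolding fin_dim_def by (intro Sup_upper) blast
  then have "pdim R (uni a (L a - 1)) \<le> enat 1" using le by (simp add: one_enat_def)
  then show False unfolding pdim_le_iff using uni_mod_socle_pd[OF a] by simp
qed


section \<open>The top of a uniserial module\<close>

text \<open>The module \<open>M\<close> is generated by an element at the vertex \<open>i\<close>.  For a nonzero module with simple top this
  says that the top is \<open>S\<^sub>i\<close>.\<close>

definition top_at :: "('r, 'a) module \<Rightarrow> nat \<Rightarrow> bool"
  where "top_at M i \<longleftrightarrow> (\<exists>x\<in>carrier M. \<forall>H. submodule H R M \<and> chi {i} \<odot>\<^bsub>M\<^esub> x \<in> H \<longrightarrow> H = carrier M)"

lemma top_at_iso:
  assumes M: "left_module R M" and N: "left_module R N" and iso: "mod_iso R M N" and i: "top_at N i"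
  shows "top_at M i"
proof -
  obtain h where h: "h \<in> mod_hom R M N" "bij_betw h (carrier M) (carrier N)"
    using iso by (auto simp: mod_iso_def)
  obtain x where x: "x \<in> carrier N"
    "\<And>H. submodule H R N \<Longrightarrow> chi {i} \<odot>\<^bsub>N\<^esub> x \<in> H \<Longrightarrow> H = carrier N"
    using i unfolding top_at_def by blast
  have im: "h ` carrier M = carrier N" and inj: "inj_on h (carrier M)" using h(2) by (simp_all add: bij_betw_def)
  obtain y where y: "y \<in> carrier M" "x = h y" using x(1) unfolding im[symmetric] by blast
  have "H = carrier M" if H: "submodule H R M" and yH: "chi {i} \<odot>\<^bsub>M\<^esub> y \<in> H" for H
  proof -
    have "chi {i} \<odot>\<^bsub>N\<^esub> x \<in> h ` H"
      using imageI[OF yH, of h] mod_hom_smult[OF h(1) chi_closed y(1), of "{i}"] y(2) by simp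
    then have "h ` H = h ` carrier M"
      unfolding im by (rule x(2)[OF mod_hom_image_submodule[OF M N h(1) H]])
    then show ?thesis using inj_on_image_eq_iff[OF inj submodule_closed(1)[OF H]] by simp
  qed
  then show ?thesis unfolding top_at_def using y(1) by blast
qed

lemma arr_image_submodule:
  assumes M: "left_module R M"
  shows "submodule ((\<lambda>x. arr \<odot>\<^bsub>M\<^esub> x) ` carrier M) R M"
proof -
  interpret M: left_module R M by (rule M)
  show ?thesis
  proof (rule M.submoduleI)
    show "(\<lambda>x. arr \<odot>\<^bsub>M\<^esub> x) ` carrier M \<subseteq> carrier M" by auto
    show "\<zero>\<^bsub>M\<^esub> \<in> (\<lambda>x. arr \<odot>\<^bsub>M\<^esub> x) ` carrier M" by (rule image_eqI[of _ _ "\<zero>\<^bsub>M\<^esub>"]) simp_all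
    fix x y assume "x \<in> (\<lambda>x. arr \<odot>\<^bsub>M\<^esub> x) ` carrier M" "y \<in> (\<lambda>x. arr \<odot>\<^bsub>M\<^esub> x) ` carrier M"
    then obtain u v where "u \<in> carrier M" "v \<in> carrier M" "x = arr \<odot>\<^bsub>M\<^esub> u" "y = arr \<odot>\<^bsub>M\<^esub> v" by blast
    then show "x \<oplus>\<^bsub>M\<^esub> y \<in> (\<lambda>x. arr \<odot>\<^bsub>M\<^esub> x) ` carrier M"
      by (intro image_eqI[of _ _ "u \<oplus>\<^bsub>M\<^esub> v"]) (simp_all add: M.smult_r_distr)
  next
    fix r x assume r: "r \<in> carrier R" and "x \<in> (\<lambda>x. arr \<odot>\<^bsub>M\<^esub> x) ` carrier M"
    then obtain u where u: "u \<in> carrier M" "x = arr \<odot>\<^bsub>M\<^esub> u" by blast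
    obtain r' where r': "r' \<in> carrier R" "r \<otimes> arr = arr \<otimes> r'" by (rule mult_arr_factor[OF r])
    have "r \<odot>\<^bsub>M\<^esub> x = arr \<odot>\<^bsub>M\<^esub> (r' \<odot>\<^bsub>M\<^esub> u)"
      using u r r' by (simp add: M.smult_assoc[symmetric])
    then show "r \<odot>\<^bsub>M\<^esub> x \<in> (\<lambda>x. arr \<odot>\<^bsub>M\<^esub> x) ` carrier M" using u(1) r'(1)
      by (intro image_eqI[of _ _ "r' \<odot>\<^bsub>M\<^esub> u"]) simp_all
  qed
qed

lemma arr_image_proper:
  assumes M: "left_module R M" and nz: "carrier M \<noteq> {\<zero>\<^bsub>M\<^esub>}"
  shows "(\<lambda>x. arr \<odot>\<^bsub>M\<^esub> x) ` carrier M \<noteq> carrier M"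
proof
  assume eq: "(\<lambda>x. arr \<odot>\<^bsub>M\<^esub> x) ` carrier M = carrier M"
  interpret M: left_module R M by (rule M)
  have pow: "\<exists>y\<in>carrier M. x = (arr [^] t) \<odot>\<^bsub>M\<^esub> y" if "x \<in> carrier M" for x and t :: nat
    using that
  proof (induction t arbitrary: x)
    case 0
    then show ?case by (intro bexI[of _ x]) simp_all
  next
    case (Suc t)
    have "x \<in> (\<lambda>x. arr \<odot>\<^bsub>M\<^esub> x) ` carrier M" using Suc.prems eq by simp
    then obtain z where z: "z \<in> carrier M" "x = arr \<odot>\<^bsub>M\<^esub> z" by blast
    obtain y where y: "y \<in> carrier M" "z = (arr [^] t) \<odot>\<^bsub>M\<^esub> y" using Suc.IH[OF z(1)] by blast
    have "x = (arr [^] Suc t) \<odot>\<^bsub>M\<^esub> y"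
      using z(2) y by (simp only: nat_pow_Suc2[OF arr_closed] M.smult_assoc arr_closed nat_pow_closed)
    then show ?case using y(1) by blast
  qed
  obtain D :: nat where D: "arr [^] D = \<zero>" by (rule arr_nilpotent)
  have "x = \<zero>\<^bsub>M\<^esub>" if x: "x \<in> carrier M" for x
    using pow[OF x, of D] D by auto
  then show False using nz M.M.zero_closed by blast
qed

text \<open>If \<open>e\<^sub>j y\<close> generates \<open>M\<close>, the elements \<open>m\<close> with \<open>e\<^sub>j m\<close> in the radical form a proper submodule.  It
  contains all elements \<open>e\<^sub>i x\<close> with \<open>i \<noteq> j\<close>, so none of these generates \<open>M\<close>.\<close>

lemma top_at_unique:
  assumes M: "left_module R M" and nz: "carrier M \<noteq> {\<zero>\<^bsub>M\<^esub>}"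
    and i: "top_at M i" and j: "top_at M j"
  shows "i = j"
proof (rule ccontr)
  assume ij: "i \<noteq> j"
  interpret M: left_module R M by (rule M)
  define J where "J = (\<lambda>x. arr \<odot>\<^bsub>M\<^esub> x) ` carrier M"
  have J: "submodule J R M" "J \<noteq> carrier M"
    unfolding J_def using arr_image_submodule[OF M] arr_image_proper[OF M nz] by auto
  note J' = submodule_closed[OF J(1)]
  obtain x where x: "x \<in> carrier M"
    "\<And>H. submodule H R M \<Longrightarrow> chi {i} \<odot>\<^bsub>M\<^esub> x \<in> H \<Longrightarrow> H = carrier M"
    using i unfolding top_at_def by blast
  obtain y where y: "y \<in> carrier M"
    "\<And>H. submodule H R M \<Longrightarrow> chi {j} \<odot>\<^bsub>M\<^esub> y \<in> H \<Longrightarrow> H = carrier M"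
    using j unfolding top_at_def by blast
  define H where "H = {m \<in> carrier M. chi {j} \<odot>\<^bsub>M\<^esub> m \<in> J}"
  have "submodule H R M"
  proof (rule M.submoduleI)
    fix r m assume r: "r \<in> carrier R" and m: "m \<in> H"
    then have mM: "m \<in> carrier M" "chi {j} \<odot>\<^bsub>M\<^esub> m \<in> J" by (simp_all add: H_def)
    define c where "c = chi {j} \<otimes> r \<ominus> r \<otimes> chi {j}"
    have c: "c \<in> carrier R" using r by (simp add: c_def)
    obtain c' where c': "c' \<in> carrier R" "c = arr \<otimes> c'"
      by (rule radical_factor[OF c]) (use r in \<open>simp_all add: c_def cf_minus cf_mult0\<close>)
    have "chi {j} \<odot>\<^bsub>M\<^esub> (r \<odot>\<^bsub>M\<^esub> m) = c \<odot>\<^bsub>M\<^esub> m \<oplus>\<^bsub>M\<^esub> r \<odot>\<^bsub>M\<^esub> (chi {j} \<odot>\<^bsub>M\<^esub> m)"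
    proof -
      have "chi {j} \<otimes> r = c \<oplus> r \<otimes> chi {j}" using r by (simp add: c_def minus_eq a_assoc l_neg)
      then have "(chi {j} \<otimes> r) \<odot>\<^bsub>M\<^esub> m = c \<odot>\<^bsub>M\<^esub> m \<oplus>\<^bsub>M\<^esub> (r \<otimes> chi {j}) \<odot>\<^bsub>M\<^esub> m"
        using r c mM(1) by (simp add: M.smult_l_distr)
      then show ?thesis using r mM(1) by (simp add: M.smult_assoc)
    qed
    moreover have "c \<odot>\<^bsub>M\<^esub> m \<in> J"
      unfolding J_def using c' mM(1) by (intro image_eqI[of _ _ "c' \<odot>\<^bsub>M\<^esub> m"]) (simp_all add: M.smult_assoc)
    ultimately show "r \<odot>\<^bsub>M\<^esub> m \<in> H" using J'(3) J'(5)[OF r mM(2)] r mM(1) by (simp add: H_def)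
  qed (use J' in \<open>auto simp: H_def M.smult_r_distr\<close>)
  moreover have "chi {i} \<odot>\<^bsub>M\<^esub> x \<in> H"
  proof -
    have "chi {j} \<otimes> chi {i} = \<zero>" by (rule cf_eqI) (use ij in \<open>auto simp: cf_mult_chi cf_chi cf_zero\<close>)
    then show ?thesis using x(1) J'(2) by (simp add: H_def M.smult_assoc[symmetric])
  qed
  ultimately have "H = carrier M" by (rule x(2))
  then have "y \<in> H" using y(1) by (simp only:)
  then have "chi {j} \<odot>\<^bsub>M\<^esub> y \<in> J" by (simp add: H_def)
  then show False using y(2)[OF J(1)] J(2) by simp
qed

lemma uniserial_top_at:
  assumes M: "uniserial_module R M" and N: "submodule N R M"
    and simple: "simple_module R (quotient_module M N)"
    and X: "X \<in> carrier (quotient_module M N)"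
      "chi {i} \<odot>\<^bsub>quotient_module M N\<^esub> X \<noteq> \<zero>\<^bsub>quotient_module M N\<^esub>"
  shows "top_at M i" "carrier M \<noteq> {\<zero>\<^bsub>M\<^esub>}"
proof -
  have M': "left_module R M" using M by (simp add: uniserial_module_def)
  interpret M: left_module R M by (rule M')
  let ?Q = "quotient_module M N"
  note q = quotient_module_coset[OF M' N]
  have Q: "left_module R ?Q" by (rule quotient_left_module[OF M' N])
  have \<kappa>: "(\<lambda>x. N +>\<^bsub>M\<^esub> x) \<in> mod_hom R M ?Q" by (rule mod_homI) (simp_all add: q)
  obtain x where x: "x \<in> carrier M" "X = N +>\<^bsub>M\<^esub> x" using X(1) unfolding q(1) by blast
  have ex: "chi {i} \<odot>\<^bsub>M\<^esub> x \<in> carrier M" using x(1) by simp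
  have exN: "chi {i} \<odot>\<^bsub>M\<^esub> x \<notin> N"
    using X(2) q(5)[OF chi_closed x(1), of "{i}"] q(4)[OF ex] q(2) x(2) by simp
  then show "carrier M \<noteq> {\<zero>\<^bsub>M\<^esub>}" using ex submodule_closed(2)[OF N] by auto
  have "H = carrier M" if H: "submodule H R M" and xH: "chi {i} \<odot>\<^bsub>M\<^esub> x \<in> H" for H
  proof
    show "H \<subseteq> carrier M" by (rule submodule_closed(1)[OF H])
    have NH: "N \<subseteq> H" using M H N xH exN unfolding uniserial_module_def by blast
    have "submodule ((\<lambda>x. N +>\<^bsub>M\<^esub> x) ` H) R ?Q" by (rule mod_hom_image_submodule[OF M' Q \<kappa> H])
    then have "(\<lambda>x. N +>\<^bsub>M\<^esub> x) ` H = {\<zero>\<^bsub>?Q\<^esub>} \<or> (\<lambda>x. N +>\<^bsub>M\<^esub> x) ` H = carrier ?Q"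
      using simple unfolding simple_module_def by blast
    moreover have "N +>\<^bsub>M\<^esub> (chi {i} \<odot>\<^bsub>M\<^esub> x) \<noteq> \<zero>\<^bsub>?Q\<^esub>" using q(4)[OF ex] exN q(2) by simp
    ultimately have im: "(\<lambda>x. N +>\<^bsub>M\<^esub> x) ` H = carrier ?Q" using imageI[OF xH, of "\<lambda>x. N +>\<^bsub>M\<^esub> x"] by auto
    show "carrier M \<subseteq> H"
    proof
      fix m assume m: "m \<in> carrier M"
      have "N +>\<^bsub>M\<^esub> m \<in> (\<lambda>x. N +>\<^bsub>M\<^esub> x) ` H" unfolding im q(1) using m by (rule imageI)
      then obtain h where h: "h \<in> H" "N +>\<^bsub>M\<^esub> m = N +>\<^bsub>M\<^esub> h" by blast
      have hM: "h \<in> carrier M" using h(1) submodule_closed(1)[OF H] by blast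
      interpret Q: left_module R ?Q by (rule Q)
      have "N +>\<^bsub>M\<^esub> (m \<ominus>\<^bsub>M\<^esub> h) = \<zero>\<^bsub>?Q\<^esub>"
        using mod_hom_diff[OF M' Q \<kappa> m hM] h(2) mod_hom_closed[OF \<kappa> hM]
        by (simp add: Q.M.minus_eq Q.M.r_neg)
      then have "m \<ominus>\<^bsub>M\<^esub> h \<in> N" using q(4)[of "m \<ominus>\<^bsub>M\<^esub> h"] q(2) m hM by simp
      then have "(m \<ominus>\<^bsub>M\<^esub> h) \<oplus>\<^bsub>M\<^esub> h \<in> H" using NH h(1) submodule_closed(3)[OF H] by blast
      then show "m \<in> H" using m hM by (simp add: M.M.minus_eq M.M.a_assoc M.M.l_neg)
    qed
  qed
  then show "top_at M i" unfolding top_at_def using x(1) by blast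
qed

end


section \<open>The path algebra of the cyclic quiver\<close>

lemma path_algebra_simps:
  "f \<in> carrier (path_algebra K n) \<longleftrightarrow> finite {p. f p \<noteq> 0} \<and> {p. f p \<noteq> 0} \<subseteq> {1..n} \<times> UNIV"
  "(f \<otimes>\<^bsub>path_algebra K n\<^esub> g) (i, l) = (\<Sum>m\<le>l. f (cyc n (i + m), l - m) * g (i, m))"
  "\<one>\<^bsub>path_algebra K n\<^esub> = (\<lambda>(i, l). if i \<in> {1..n} \<and> l = 0 then 1 else 0)"
  "\<zero>\<^bsub>path_algebra K n\<^esub> = (\<lambda>p. 0)" "f \<oplus>\<^bsub>path_algebra K n\<^esub> g = (\<lambda>p. f p + g p)"
  by (simp_all add: path_algebra_def)

lemma path_algebra_mult_nonzero:
  assumes "(f \<otimes>\<^bsub>path_algebra K n\<^esub> g) (i, l) \<noteq> 0"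
  obtains m where "m \<le> l" "f (cyc n (i + m), l - m) \<noteq> 0" "g (i, m) \<noteq> 0"
proof -
  have "\<exists>m\<in>{..l}. f (cyc n (i + m), l - m) * g (i, m) \<noteq> 0"
    using assms unfolding path_algebra_simps by (rule contrapos_np) (auto intro: sum.neutral)
  then show thesis using that by auto
qed

lemma path_algebra_mult_closed:
  assumes f: "f \<in> carrier (path_algebra K n)" and g: "g \<in> carrier (path_algebra K n)"
  shows "f \<otimes>\<^bsub>path_algebra K n\<^esub> g \<in> carrier (path_algebra K n)"
proof -
  let ?h = "f \<otimes>\<^bsub>path_algebra K n\<^esub> g"
  let ?A = "(\<lambda>((j :: nat, u), (i :: nat, m)). (i, u + m)) ` ({p. f p \<noteq> 0} \<times> {p. g p \<noteq> 0})"
  have sub: "{p. ?h p \<noteq> 0} \<subseteq> ?A \<inter> ({1..n} \<times> UNIV)"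
  proof
    fix p assume p: "p \<in> {p. ?h p \<noteq> 0}"
    obtain i l where il: "p = (i, l)" by (cases p)
    obtain m where m: "m \<le> l" "f (cyc n (i + m), l - m) \<noteq> 0" "g (i, m) \<noteq> 0"
      by (rule path_algebra_mult_nonzero[where f = f and g = g and K = K and n = n and i = i and l = l])
        (use p il in simp)
    have "(i, m) \<in> {1..n} \<times> UNIV" using m(3) g unfolding path_algebra_simps by blast
    moreover have "p \<in> ?A"
      unfolding il using m by (intro image_eqI[of _ _ "((cyc n (i + m), l - m), (i, m))"]) auto
    ultimately show "p \<in> ?A \<inter> ({1..n} \<times> UNIV)" by (auto simp: il)
  qed
  have "finite ({p. f p \<noteq> 0} \<times> {p. g p \<noteq> 0})"
    using f g unfolding path_algebra_simps by (intro finite_cartesian_product) simp_all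
  then have "finite ?A" by (rule finite_imageI)
  then have "finite {p. ?h p \<noteq> 0}" by (rule finite_subset[OF subset_trans[OF sub Int_lower1]])
  then show ?thesis
    unfolding path_algebra_simps(1) using subset_trans[OF sub Int_lower2] by (rule conjI)
qed

lemma path_algebra_assoc:
  assumes n: "n \<ge> 1"
  shows "(f \<otimes>\<^bsub>path_algebra K n\<^esub> g) \<otimes>\<^bsub>path_algebra K n\<^esub> h = f \<otimes>\<^bsub>path_algebra K n\<^esub> (g \<otimes>\<^bsub>path_algebra K n\<^esub> h)"
proof
  fix p :: "nat \<times> nat"
  obtain i l where p: "p = (i, l)" by (cases p)
  define T where "T m m' = f (cyc n (i + m + m'), l - m - m') * g (cyc n (i + m), m') * h (i, m)" for m m'
  have "((f \<otimes>\<^bsub>path_algebra K n\<^esub> g) \<otimes>\<^bsub>path_algebra K n\<^esub> h) p = (\<Sum>m\<le>l. \<Sum>m'\<le>l - m. T m m')"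
    unfolding p path_algebra_simps T_def sum_distrib_right
    by (simp add: cyc_add_left[OF n])
  also have "\<dots> = (\<Sum>(m, m')\<in>(SIGMA m:{..l}. {..l - m}). T m m')"
    by (rule sum.Sigma) auto
  also have "(SIGMA m:{..l}. {..l - m}) = {(m, m'). m + m' \<le> l}" by auto
  also have "(\<Sum>(m, m')\<in>{(m, m'). m + m' \<le> l}. T m m') = (\<Sum>k\<le>l. \<Sum>m\<le>k. T m (k - m))"
    by (rule sum.triangle_reindex_eq)
  also have "\<dots> = (f \<otimes>\<^bsub>path_algebra K n\<^esub> (g \<otimes>\<^bsub>path_algebra K n\<^esub> h)) p"
    unfolding p path_algebra_simps T_def sum_distrib_left
    by (intro sum.cong refl) (simp add: mult.assoc)
  finally show "((f \<otimes>\<^bsub>path_algebra K n\<^esub> g) \<otimes>\<^bsub>path_algebra K n\<^esub> h) p =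
    (f \<otimes>\<^bsub>path_algebra K n\<^esub> (g \<otimes>\<^bsub>path_algebra K n\<^esub> h)) p" .
qed

lemma path_algebra_ring:
  assumes n: "n \<ge> 1"
  shows "ring (path_algebra K n)"
proof (rule ringI)
  let ?P = "path_algebra K n"
  have supp: "f p = 0" if "f \<in> carrier ?P" "fst p \<notin> {1..n}" for f :: "'a paths" and p
    using that unfolding path_algebra_simps by (cases p) auto
  show "abelian_group ?P"
  proof (rule abelian_groupI)
    fix f g assume f: "f \<in> carrier ?P" and g: "g \<in> carrier ?P"
    have sub: "{p. f p + g p \<noteq> 0} \<subseteq> {p. f p \<noteq> 0} \<union> {p. g p \<noteq> 0}" by auto
    have "finite {p. f p + g p \<noteq> 0}"
      using f g unfolding path_algebra_simps by (intro finite_subset[OF sub]) simp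
    moreover have "{p. f p + g p \<noteq> 0} \<subseteq> {1..n} \<times> UNIV"
      using f g unfolding path_algebra_simps by (intro subset_trans[OF sub]) simp
    ultimately show "f \<oplus>\<^bsub>?P\<^esub> g \<in> carrier ?P" unfolding path_algebra_simps by (rule conjI)
  next
    fix f assume f: "f \<in> carrier ?P"
    show "\<exists>g\<in>carrier ?P. g \<oplus>\<^bsub>?P\<^esub> f = \<zero>\<^bsub>?P\<^esub>"
      by (rule bexI[of _ "\<lambda>p. - f p"]) (use f in \<open>auto simp: path_algebra_simps\<close>)
  qed (auto simp: path_algebra_simps ac_simps)
  have sub: "{p. (\<lambda>(i, l). if i \<in> {1..n} \<and> l = (0 :: nat) then 1 else (0 :: 'a)) p \<noteq> 0} \<subseteq> {1..n} \<times> {0 :: nat}"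
    by (auto split: if_splits)
  have "finite {p. (\<lambda>(i, l). if i \<in> {1..n} \<and> l = (0 :: nat) then 1 else (0 :: 'a)) p \<noteq> 0}"
    by (rule finite_subset[OF sub]) simp
  moreover have "{p. (\<lambda>(i, l). if i \<in> {1..n} \<and> l = (0 :: nat) then 1 else (0 :: 'a)) p \<noteq> 0} \<subseteq> {1..n} \<times> UNIV"
    using sub by blast
  ultimately have one: "\<one>\<^bsub>?P\<^esub> \<in> carrier ?P"
    unfolding path_algebra_simps by (rule conjI)
  show "Group.monoid ?P"
  proof (rule Group.monoidI)
    fix f assume f: "f \<in> carrier ?P"
    show "\<one>\<^bsub>?P\<^esub> \<otimes>\<^bsub>?P\<^esub> f = f"
    proof
      fix p :: "nat \<times> nat"
      obtain i l where p: "p = (i, l)" by (cases p)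
      have "(\<one>\<^bsub>?P\<^esub> \<otimes>\<^bsub>?P\<^esub> f) p = (\<Sum>m\<le>l. if m = l then f (i, l) else 0)"
        unfolding p path_algebra_simps using cyc_mem[OF n] by (intro sum.cong refl) auto
      then show "(\<one>\<^bsub>?P\<^esub> \<otimes>\<^bsub>?P\<^esub> f) p = f p" by (simp add: p)
    qed
    show "f \<otimes>\<^bsub>?P\<^esub> \<one>\<^bsub>?P\<^esub> = f"
    proof
      fix p :: "nat \<times> nat"
      obtain i l where p: "p = (i, l)" by (cases p)
      have "(f \<otimes>\<^bsub>?P\<^esub> \<one>\<^bsub>?P\<^esub>) p = (\<Sum>m\<le>l. if m = 0 then f (i, l) else 0)"
        unfolding p path_algebra_simps(2) path_algebra_simps(3) using supp[OF f, of p]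
        by (intro sum.cong refl) (auto simp: p cyc_id)
      then show "(f \<otimes>\<^bsub>?P\<^esub> \<one>\<^bsub>?P\<^esub>) p = f p" by (simp add: p)
    qed
  qed (use one path_algebra_mult_closed path_algebra_assoc[OF n] in auto)
qed (auto simp: fun_eq_iff path_algebra_simps(2) path_algebra_simps(5) distrib_left distrib_right sum.distrib)


section \<open>Ideals generated by paths\<close>

text \<open>\<open>contains_path n B i l\<close>: the path of length \<open>l\<close> starting at \<open>i\<close> has a subpath in \<open>B\<close>, where
  a path is given by its starting vertex and its length.\<close>

definition contains_path :: "nat \<Rightarrow> (nat \<times> nat) set \<Rightarrow> nat \<Rightarrow> nat \<Rightarrow> bool"
  where "contains_path n B i l \<longleftrightarrow> (\<exists>(v, c)\<in>B. \<exists>t. t + c \<le> l \<and> cyc n (i + t) = v)"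

lemma contains_path_mono: "contains_path n B i l \<Longrightarrow> l \<le> l' \<Longrightarrow> contains_path n B i l'"
  unfolding contains_path_def by (fastforce intro: le_trans)

lemma contains_path_shift:
  assumes "n \<ge> 1" "contains_path n B (cyc n (i + m)) l" "m + l \<le> l'"
  shows "contains_path n B i l'"
proof -
  obtain v c t where B: "(v, c) \<in> B" and t: "t + c \<le> l" "cyc n (cyc n (i + m) + t) = v"
    using assms(2) unfolding contains_path_def by blast
  have "cyc n (i + (m + t)) = v" "(m + t) + c \<le> l'"
    using t assms(1,3) by (simp_all add: cyc_add_left add.assoc)
  with B show ?thesis unfolding contains_path_def by blast
qed

text \<open>The multiple of the path \<open>p\<close> by the scalar \<open>c\<close>.\<close>

definition monomial :: "'k::field \<Rightarrow> nat \<times> nat \<Rightarrow> 'k paths"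
  where "monomial c p = (\<lambda>q. if q = p then c else 0)"

lemma path_monomial: "path i l = monomial 1 (i, l)"
  by (auto simp: path_def monomial_def)

lemma monomial_closed: "i \<in> {1..n} \<Longrightarrow> monomial c (i, l) \<in> carrier (path_algebra K n)"
  by (auto simp: path_algebra_simps monomial_def intro: finite_subset[of _ "{(i, l)}"])

lemma monomial_mult:
  "monomial c (cyc n (i + m), u) \<otimes>\<^bsub>path_algebra K n\<^esub> monomial d (i, m) = monomial (c * d) (i, m + u)"
proof
  fix p :: "nat \<times> nat"
  obtain j l where p: "p = (j, l)" by (cases p)
  have "(monomial c (cyc n (i + m), u) \<otimes>\<^bsub>path_algebra K n\<^esub> monomial d (i, m)) p
      = (\<Sum>m'\<le>l. if m' = m then (if j = i \<and> l - m = u then c * d else 0) else 0)"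
    unfolding p path_algebra_simps by (intro sum.cong refl) (auto simp: monomial_def)
  also have "\<dots> = monomial (c * d) (i, m + u) p"
    by (auto simp: p monomial_def)
  finally show "(monomial c (cyc n (i + m), u) \<otimes>\<^bsub>path_algebra K n\<^esub> monomial d (i, m)) p
      = monomial (c * d) (i, m + u) p" .
qed

text \<open>An ideal generated by paths is spanned by the paths that contain one of the generators.\<close>

lemma genideal_paths:
  fixes K :: "'k::field itself"
  assumes n: "n \<ge> 1" and B: "B \<subseteq> {1..n} \<times> UNIV"
  shows "genideal (path_algebra K n) ((\<lambda>(v, c). path v c) ` B) =
    {f \<in> carrier (path_algebra K n). \<forall>i l. f (i, l) \<noteq> 0 \<longrightarrow> contains_path n B i l}" (is "?G = ?I")
proof
  let ?P = "path_algebra K n"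
  let ?S = "(\<lambda>(v, c). path v c) ` B :: 'k paths set"
  interpret P: ring ?P by (rule path_algebra_ring[OF n])
  have S: "?S \<subseteq> carrier ?P" using B by (auto simp: path_monomial intro!: monomial_closed)
  show "?G \<subseteq> ?I"
  proof (rule P.genideal_minimal)
    show "?S \<subseteq> ?I"
    proof
      fix f assume "f \<in> ?S"
      then obtain v c where vc: "(v, c) \<in> B" "f = path v c" by auto
      have "contains_path n B v c"
        unfolding contains_path_def using vc(1) B
        by (intro bexI[of _ "(v, c)"]) (auto intro!: exI[of _ 0] cyc_id)
      then show "f \<in> ?I" using vc(2) S \<open>f \<in> ?S\<close> by (auto simp: path_def split: if_splits)
    qed
    show "ideal ?I ?P"
    proof (rule idealI)
      show "ring ?P" by (rule path_algebra_ring[OF n])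
      show "subgroup ?I (add_monoid ?P)"
      proof (rule subgroup.intro, goal_cases)
        case 1
        then show ?case by auto
      next
        case (2 f g)
        have "f \<oplus>\<^bsub>?P\<^esub> g \<in> carrier ?P" using 2 by simp
        moreover have "contains_path n B i l" if "(f \<oplus>\<^bsub>?P\<^esub> g) (i, l) \<noteq> 0" for i l
        proof -
          have "f (i, l) \<noteq> 0 \<or> g (i, l) \<noteq> 0" using that by (auto simp: path_algebra_simps(5))
          then show ?thesis using 2 by blast
        qed
        ultimately show ?case by simp
      next
        case 3
        then show ?case using P.zero_closed by (simp add: path_algebra_simps(4))
      next
        case (4 f)
        then have f: "f \<in> ?I" by simp
        have "\<ominus>\<^bsub>?P\<^esub> f = (\<lambda>p. - f p)"
          by (rule P.minus_equality) (use f in \<open>auto simp: path_algebra_simps\<close>)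
        then have "inv\<^bsub>add_monoid ?P\<^esub> f = (\<lambda>p. - f p)" by (simp only: a_inv_def)
        moreover have "(\<lambda>p. - f p) \<in> ?I" using f by (simp add: path_algebra_simps(1))
        ultimately show ?case by (simp only:)
      qed
    next
      fix f g assume f: "f \<in> ?I" and g: "g \<in> carrier ?P"
      have fP: "f \<in> carrier ?P" using f by simp
      have "contains_path n B i l" if gf: "(g \<otimes>\<^bsub>?P\<^esub> f) (i, l) \<noteq> 0" for i l
      proof (rule path_algebra_mult_nonzero[OF gf])
        fix m assume "m \<le> l" "f (i, m) \<noteq> 0"
        then show ?thesis using f contains_path_mono by blast
      qed
      then show "g \<otimes>\<^bsub>?P\<^esub> f \<in> ?I" using path_algebra_mult_closed[OF g fP] by blast
      have "contains_path n B i l" if fg: "(f \<otimes>\<^bsub>?P\<^esub> g) (i, l) \<noteq> 0" for i l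
      proof (rule path_algebra_mult_nonzero[OF fg])
        fix m assume "m \<le> l" "f (cyc n (i + m), l - m) \<noteq> 0"
        then show ?thesis using f contains_path_shift[OF n, of B i m "l - m" l] by auto
      qed
      then show "f \<otimes>\<^bsub>?P\<^esub> g \<in> ?I" using path_algebra_mult_closed[OF fP g] by blast
    qed
  qed
  interpret G: ideal ?G ?P by (rule P.genideal_ideal[OF S])
  have mono: "monomial d (i, l) \<in> ?G" if i: "i \<in> {1..n}" and il: "contains_path n B i l" for d i l
  proof -
    obtain v c t where vc: "(v, c) \<in> B" and t: "t + c \<le> l" "cyc n (i + t) = v"
      using il unfolding contains_path_def by blast
    have "path v c \<in> ?S" using vc by force
    then have "monomial 1 (v, c) \<in> ?G" using P.genideal_self[OF S] by (auto simp: path_monomial)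
    then have "monomial 1 (cyc n (i + t), c) \<otimes>\<^bsub>?P\<^esub> monomial 1 (i, t) \<in> ?G"
      unfolding t(2) by (rule G.I_r_closed[OF _ monomial_closed[OF i]])
    then have "monomial 1 (i, t + c) \<in> ?G" unfolding monomial_mult by simp
    then have "monomial d (cyc n (i + (t + c)), l - (t + c)) \<otimes>\<^bsub>?P\<^esub> monomial 1 (i, t + c) \<in> ?G"
      by (rule G.I_l_closed[OF _ monomial_closed[OF cyc_mem[OF n]]])
    then show ?thesis unfolding monomial_mult using t(1) by simp
  qed
  show "?I \<subseteq> ?G"
  proof
    fix f assume f: "f \<in> ?I"
    have "f \<in> ?G" if "finite A" "{p. f p \<noteq> 0} \<subseteq> A" "A \<subseteq> {1..n} \<times> UNIV" "\<And>p c. p \<in> A \<Longrightarrow> monomial c p \<in> ?G"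
      for A and f :: "'k paths"
      using that
    proof (induction A arbitrary: f rule: finite_induct)
      case empty
      then have "f = \<zero>\<^bsub>?P\<^esub>" by (auto simp: path_algebra_simps(4))
      then show ?case by simp
    next
      case (insert p A)
      have "f(p := 0) \<in> ?G"
        by (rule insert.IH) (use insert.prems in \<open>auto split: if_splits\<close>)
      then have "f(p := 0) \<oplus>\<^bsub>?P\<^esub> monomial (f p) p \<in> ?G"
        using insert.prems(3) by (intro G.a_closed) auto
      moreover have "f(p := 0) \<oplus>\<^bsub>?P\<^esub> monomial (f p) p = f"
        by (auto simp: path_algebra_simps(5) monomial_def)
      ultimately show ?case by simp
    qed
    moreover have "finite {p. f p \<noteq> 0}" "{p. f p \<noteq> 0} \<subseteq> {1..n} \<times> UNIV" using f by (auto simp: path_algebra_simps(1))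
    moreover have "monomial c p \<in> ?G" if "p \<in> {p. f p \<noteq> 0}" for p c
      using that f mono[of "fst p" "snd p" c] by (cases p) (auto simp: path_algebra_simps(1))
    ultimately show "f \<in> ?G" by blast
  qed
qed


section \<open>Coefficients in a cyclic Nakayama algebra\<close>

text \<open>The relations as paths, the lengths of the indecomposable projectives, and the coefficients of a residue
  class.  The coefficients do not depend on the representative \<open>f\<close>, since all elements of the ideal of relations vanish
  on the paths \<open>(i, l)\<close> with \<open>l < proj_len n r k len i\<close>.\<close>

definition rel_paths :: "nat \<Rightarrow> (nat \<Rightarrow> nat) \<Rightarrow> (nat \<Rightarrow> nat) \<Rightarrow> (nat \<times> nat) set"
  where "rel_paths r k len = (\<lambda>j. (k (2 * j - 1), len j)) ` {1..r}"

definition proj_len :: "nat \<Rightarrow> nat \<Rightarrow> (nat \<Rightarrow> nat) \<Rightarrow> (nat \<Rightarrow> nat) \<Rightarrow> nat \<Rightarrow> nat"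
  where "proj_len n r k len i = (LEAST l. contains_path n (rel_paths r k len) i l)"

definition nak_coeff :: "nat \<Rightarrow> nat \<Rightarrow> (nat \<Rightarrow> nat) \<Rightarrow> (nat \<Rightarrow> nat) \<Rightarrow> 'k::field paths set \<Rightarrow> 'k paths"
  where "nak_coeff n r k len X = (\<lambda>(i, l). if l < proj_len n r k len i then (SOME f. f \<in> X) (i, l) else 0)"

locale nakayama_data =
  fixes K :: "'k::field itself" and n r :: nat and k len :: "nat \<Rightarrow> nat"
  assumes irr: "irredundant_system K n r k len"
begin

abbreviation "B \<equiv> rel_paths r k len"
abbreviation "L \<equiv> proj_len n r k len"
abbreviation "cf \<equiv> nak_coeff n r k len :: 'k paths set \<Rightarrow> 'k paths"
abbreviation "A \<equiv> nakayama_algebra K n r k len"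
abbreviation "PA \<equiv> path_algebra K n"
abbreviation "J \<equiv> relation_ideal K n r k len"

text \<open>The vertex at which the \<open>j\<close>-th relation starts; it ends with the arrow at \<open>soc_ix j\<close>.\<close>

definition top_ix :: "nat \<Rightarrow> nat"
  where "top_ix j = k (2 * j - 1)"

abbreviation "soc_ix j \<equiv> k (2 * j)"

lemma n_pos: "n \<ge> 1" and r_pos: "r \<ge> 1"
  and k_mem: "m \<in> {1..2 * r} \<Longrightarrow> k m \<in> {1..n}"
  and len_ge2: "j \<in> {1..r} \<Longrightarrow> len j \<ge> 2"
  and len_end: "j \<in> {1..r} \<Longrightarrow> cyc n (top_ix j + (len j - 1)) = soc_ix j"
  and cyc_incr: "cyclically_increasing (map top_ix [1..<r + 1])"
  and irredundant: "j \<in> {1..r} \<Longrightarrow> relation K k len j \<notin> genideal PA (relation K k len ` ({1..r} - {j}))"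
  using irr unfolding irredundant_system_def top_ix_def[abs_def] by blast+

lemma top_ix_mem: "j \<in> {1..r} \<Longrightarrow> top_ix j \<in> {1..n}"
  and soc_ix_mem: "j \<in> {1..r} \<Longrightarrow> soc_ix j \<in> {1..n}"
  unfolding top_ix_def by (rule k_mem; auto)+

lemma relation_image:
  assumes "S \<subseteq> {1..r}"
  shows "relation K k len ` S = (\<lambda>(v, c). path v c) ` (\<lambda>j. (top_ix j, len j)) ` S"
    and "(\<lambda>j. (top_ix j, len j)) ` S \<subseteq> {1..n} \<times> UNIV"
proof -
  show "relation K k len ` S = (\<lambda>(v, c). path v c) ` (\<lambda>j. (top_ix j, len j)) ` S"
    by (simp add: image_image relation_def top_ix_def)
  show "(\<lambda>j. (top_ix j, len j)) ` S \<subseteq> {1..n} \<times> UNIV"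
  proof
    fix p assume "p \<in> (\<lambda>j. (top_ix j, len j)) ` S"
    then obtain j where "j \<in> S" "p = (top_ix j, len j)" by blast
    then show "p \<in> {1..n} \<times> UNIV" using top_ix_mem[of j] assms by auto
  qed
qed

lemma J_eq: "J = {f \<in> carrier PA. \<forall>i l. f (i, l) \<noteq> 0 \<longrightarrow> contains_path n B i l}"
  unfolding relation_ideal_def relation_image(1)[OF order_refl]
  using genideal_paths[OF n_pos relation_image(2)[OF order_refl]] by (simp add: rel_paths_def top_ix_def)

lemma contains_pathE:
  assumes "contains_path n B i l"
  obtains j t where "j \<in> {1..r}" "t + len j \<le> l" "cyc n (i + t) = top_ix j"
  using assms unfolding contains_path_def rel_paths_def top_ix_def by blast

lemma contains_pathI: "j \<in> {1..r} \<Longrightarrow> t + len j \<le> l \<Longrightarrow> cyc n (i + t) = top_ix j \<Longrightarrow> contains_path n B i l"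
  unfolding contains_path_def rel_paths_def top_ix_def by blast

lemma contains_path_ex: "\<exists>l. contains_path n B i l"
proof -
  have 1: "1 \<in> {1..r}" using r_pos by simp
  obtain t where "cyc n (i + t) = top_ix 1"
    using cyc_reach[OF n_pos top_ix_mem[OF 1]] by blast
  then have "contains_path n B i (t + len 1)" using contains_pathI[OF 1] by blast
  then show ?thesis ..
qed

lemma contains_path_L: "contains_path n B i (L i)"
  unfolding proj_len_def by (rule LeastI_ex[OF contains_path_ex])

lemma contains_path_iff: "contains_path n B i l \<longleftrightarrow> L i \<le> l"
proof
  show "contains_path n B i l \<Longrightarrow> L i \<le> l" unfolding proj_len_def by (rule Least_le)
  show "L i \<le> l \<Longrightarrow> contains_path n B i l" by (rule contains_path_mono[OF contains_path_L])
qed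

lemma L_ge2: "L i \<ge> 2"
proof (rule contains_pathE[OF contains_path_L])
  fix j t assume "j \<in> {1..r}" "t + len j \<le> L i"
  then show ?thesis using len_ge2[of j] by simp
qed

lemma L_shift: "L i \<le> m + L (cyc n (i + m))"
  unfolding contains_path_iff[symmetric]
  by (rule contains_path_shift[OF n_pos contains_path_L order_refl])

sublocale P: ring PA
  by (rule path_algebra_ring[OF n_pos])

sublocale J: ideal J PA
  unfolding relation_ideal_def
  by (rule P.genideal_ideal) (auto simp: relation_def path_monomial intro!: monomial_closed k_mem)

lemma A_carrier: "carrier A = (\<lambda>f. J +>\<^bsub>PA\<^esub> f) ` carrier PA"
  by (auto simp: nakayama_algebra_def FactRing_def A_RCOSETS_def')

lemma cf_coset:
  assumes f: "f \<in> carrier PA"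
  shows "cf (J +>\<^bsub>PA\<^esub> f) (i, l) = (if l < L i then f (i, l) else 0)"
proof (cases "l < L i")
  case True
  have "f \<in> J +>\<^bsub>PA\<^esub> f" by (rule J.a_rcos_self[OF f])
  then have "(SOME g. g \<in> J +>\<^bsub>PA\<^esub> f) \<in> J +>\<^bsub>PA\<^esub> f"
    by (rule someI[of "\<lambda>g. g \<in> J +>\<^bsub>PA\<^esub> f"])
  then obtain h where h: "h \<in> J" "(SOME g. g \<in> J +>\<^bsub>PA\<^esub> f) = h \<oplus>\<^bsub>PA\<^esub> f"
    by (auto simp: a_r_coset_def')
  have "h (i, l) = 0"
  proof (rule ccontr)
    assume "h (i, l) \<noteq> 0"
    then have "contains_path n B i l" using h(1) unfolding J_eq by blast
    then show False using True by (simp add: contains_path_iff)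
  qed
  then show ?thesis using True h(2) by (simp add: nak_coeff_def path_algebra_simps(5))
qed (simp add: nak_coeff_def)

lemma coset_eqI:
  assumes f: "f \<in> carrier PA" and g: "g \<in> carrier PA" and eq: "\<And>i l. l < L i \<Longrightarrow> f (i, l) = g (i, l)"
  shows "J +>\<^bsub>PA\<^esub> f = J +>\<^bsub>PA\<^esub> g"
proof -
  define h where "h = f \<ominus>\<^bsub>PA\<^esub> g"
  have h: "h \<in> carrier PA" and fh: "f = h \<oplus>\<^bsub>PA\<^esub> g"
    using f g by (simp_all add: h_def P.minus_eq P.a_assoc P.l_neg)
  have "h (i, l) = 0" if "l < L i" for i l
    using eq[OF that] fun_cong[OF fh, of "(i, l)"] by (simp add: path_algebra_simps(5))
  then have "h \<in> J" using h unfolding J_eq contains_path_iff by (auto simp: not_le[symmetric])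
  then have "f \<in> J +>\<^bsub>PA\<^esub> g" using fh by (auto simp: a_r_coset_def')
  then show ?thesis using P.a_repr_independence[OF _ g J.a_subgroup] by simp
qed

sublocale A: nakayama_coeffs A n L cf
proof (intro nakayama_coeffs.intro nakayama_coeffs_axioms.intro)
  show "ring A" unfolding nakayama_algebra_def by (rule J.quotient_is_ring)
  show "1 \<le> n" by (rule n_pos)
  show "2 \<le> L i" for i by (rule L_ge2)
  show "L i \<le> Suc (L (cyc n (i + 1)))" for i using L_shift[of i 1] by simp
  show "bij_betw cf (carrier A) {f. \<forall>i l. f (i, l) \<noteq> 0 \<longrightarrow> i \<in> {1..n} \<and> l < L i}"
  proof (rule bij_betwI')
    fix X Y assume "X \<in> carrier A" "Y \<in> carrier A"
    then obtain f g where f: "f \<in> carrier PA" "X = J +>\<^bsub>PA\<^esub> f" and g: "g \<in> carrier PA" "Y = J +>\<^bsub>PA\<^esub> g"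
      unfolding A_carrier by blast
    show "cf X = cf Y \<longleftrightarrow> X = Y"
    proof
      assume eq: "cf X = cf Y"
      show "X = Y"
        unfolding f(2) g(2)
      proof (rule coset_eqI[OF f(1) g(1)])
        fix i l assume "l < L i"
        then show "f (i, l) = g (i, l)"
          using fun_cong[OF eq, of "(i, l)"] f g by (simp add: cf_coset)
      qed
    qed simp
  next
    fix X assume "X \<in> carrier A"
    then obtain f where f: "f \<in> carrier PA" "X = J +>\<^bsub>PA\<^esub> f" unfolding A_carrier by blast
    show "cf X \<in> {f. \<forall>i l. f (i, l) \<noteq> 0 \<longrightarrow> i \<in> {1..n} \<and> l < L i}"
    proof (intro CollectI allI impI)
      fix i l assume nz: "cf X (i, l) \<noteq> 0"
      then have "l < L i" "f (i, l) \<noteq> 0" unfolding f(2) cf_coset[OF f(1)] by (auto split: if_splits)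
      then show "i \<in> {1..n} \<and> l < L i" using f(1) unfolding path_algebra_simps(1) by auto
    qed
  next
    fix f :: "'k paths" assume f: "f \<in> {f. \<forall>i l. f (i, l) \<noteq> 0 \<longrightarrow> i \<in> {1..n} \<and> l < L i}"
    have sub: "{p. f p \<noteq> 0} \<subseteq> (SIGMA i:{1..n}. {..<L i})" using f by auto
    have "finite {p. f p \<noteq> 0}" by (rule finite_subset[OF sub]) auto
    then have fP: "f \<in> carrier PA" using sub unfolding path_algebra_simps(1) by auto
    have "f = cf (J +>\<^bsub>PA\<^esub> f)"
    proof
      fix p :: "nat \<times> nat"
      show "f p = cf (J +>\<^bsub>PA\<^esub> f) p"
        using f by (cases p) (auto simp: cf_coset[OF fP])
    qed
    then show "\<exists>X\<in>carrier A. f = cf X" unfolding A_carrier using fP by blast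
  qed
  show "cf (X \<oplus>\<^bsub>A\<^esub> Y) p = cf X p + cf Y p" if XY: "X \<in> carrier A" "Y \<in> carrier A" for X Y p
  proof -
    obtain f g where f: "f \<in> carrier PA" "X = J +>\<^bsub>PA\<^esub> f" and g: "g \<in> carrier PA" "Y = J +>\<^bsub>PA\<^esub> g"
      using XY unfolding A_carrier by blast
    obtain i l where p: "p = (i, l)" by (cases p)
    have "X \<oplus>\<^bsub>A\<^esub> Y = J +>\<^bsub>PA\<^esub> (f \<oplus>\<^bsub>PA\<^esub> g)"
      using f g by (simp add: nakayama_algebra_def FactRing_def J.a_rcos_sum)
    then show ?thesis
      using f g P.a_closed[OF f(1) g(1)] by (simp add: p cf_coset path_algebra_simps(5))
  qed
  show "cf \<one>\<^bsub>A\<^esub> (i, l) = (if i \<in> {1..n} \<and> l = 0 then 1 else 0)" for i l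
    using L_ge2[of i] cf_coset[OF P.one_closed, of i l]
    by (simp add: nakayama_algebra_def FactRing_def path_algebra_simps(3))
  show "cf (X \<otimes>\<^bsub>A\<^esub> Y) (i, l) = (\<Sum>m\<le>l. cf X (cyc n (i + m), l - m) * cf Y (i, m))"
    if XY: "X \<in> carrier A" "Y \<in> carrier A" and l: "l < L i" for X Y i l
  proof -
    obtain f g where f: "f \<in> carrier PA" "X = J +>\<^bsub>PA\<^esub> f" and g: "g \<in> carrier PA" "Y = J +>\<^bsub>PA\<^esub> g"
      using XY unfolding A_carrier by blast
    have "X \<otimes>\<^bsub>A\<^esub> Y = J +>\<^bsub>PA\<^esub> (f \<otimes>\<^bsub>PA\<^esub> g)"
      using f g by (simp add: nakayama_algebra_def FactRing_def J.rcoset_mult_add)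
    then have "cf (X \<otimes>\<^bsub>A\<^esub> Y) (i, l) = (f \<otimes>\<^bsub>PA\<^esub> g) (i, l)"
      using l by (simp add: cf_coset P.m_closed f(1) g(1))
    also have "\<dots> = (\<Sum>m\<le>l. cf X (cyc n (i + m), l - m) * cf Y (i, m))"
      unfolding path_algebra_simps(2)
    proof (rule sum.cong[OF refl])
      fix m assume m: "m \<in> {..l}"
      have "l - m < L (cyc n (i + m))" using L_shift[of i m] l m by auto
      moreover have "m < L i" using l m by simp
      ultimately show "f (cyc n (i + m), l - m) * g (i, m) = cf X (cyc n (i + m), l - m) * cf Y (i, m)"
        by (simp add: f(2) g(2) cf_coset[OF f(1)] cf_coset[OF g(1)])
    qed
    finally show ?thesis .
  qed
qed

lemma vertex_idem_eq:
  assumes i: "i \<in> {1..n}"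
  shows "vertex_idem K n r k len i = A.chi {i}"
proof (rule A.cf_eqI)
  have p: "path i 0 \<in> carrier PA" unfolding path_monomial by (rule monomial_closed[OF i])
  show "vertex_idem K n r k len i \<in> carrier A"
    unfolding vertex_idem_def A_carrier using p by (rule imageI)
  fix j l assume "j \<in> {1..n}" "l < L j"
  then show "cf (vertex_idem K n r k len i) (j, l) = cf (A.chi {i}) (j, l)"
    using cf_coset[OF p, of j l] i by (auto simp: vertex_idem_def A.cf_chi path_def)
qed simp


section \<open>Combinatorics of the relations\<close>

text \<open>By irredundancy, no relation is a subpath of another one.\<close>

lemma no_subpath:
  assumes j: "j \<in> {1..r}" and j': "j' \<in> {1..r}" and "j \<noteq> j'" and t: "cyc n (top_ix j + t) = top_ix j'"
  shows "len j < t + len j'"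
proof (rule ccontr)
  assume *: "\<not> len j < t + len j'"
  let ?S = "{1..r} - {j}"
  have "contains_path n ((\<lambda>j. (top_ix j, len j)) ` ?S) (top_ix j) (len j)"
    unfolding contains_path_def
    using * t j' \<open>j \<noteq> j'\<close>
    by (intro bexI[of _ "(top_ix j', len j')"]) (auto intro!: exI[of _ t])
  then have "path (top_ix j) (len j) \<in> genideal PA (relation K k len ` ?S)"
    unfolding relation_image(1)[OF Diff_subset] genideal_paths[OF n_pos relation_image(2)[OF Diff_subset]]
    using monomial_closed[OF top_ix_mem[OF j], of 1 "len j" K]
    by (auto simp: path_monomial[symmetric]) (auto simp: path_def split: if_splits)
  then show False using irredundant[OF j] by (simp add: relation_def top_ix_def)
qed

lemma L_top_ix:
  assumes j: "j \<in> {1..r}"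
  shows "L (top_ix j) = len j"
proof (rule antisym)
  have "contains_path n B (top_ix j) (len j)"
    by (rule contains_pathI[OF j, of 0]) (simp_all add: cyc_id[OF top_ix_mem[OF j]])
  then show "L (top_ix j) \<le> len j" by (simp add: contains_path_iff)
  show "len j \<le> L (top_ix j)"
  proof (rule contains_pathE[OF contains_path_L[of "top_ix j"]])
    fix j' t assume j': "j' \<in> {1..r}" "t + len j' \<le> L (top_ix j)" "cyc n (top_ix j + t) = top_ix j'"
    then show "len j \<le> L (top_ix j)"
      using no_subpath[OF j j'(1) _ j'(3)] by (cases "j = j'") auto
  qed
qed

lemma L_top_ix_step:
  assumes j: "j \<in> {1..r}"
  shows "L (top_ix j) \<le> L (cyc n (top_ix j + 1))"
proof (rule contains_pathE[OF contains_path_L[of "cyc n (top_ix j + 1)"]])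
  fix j' t assume j': "j' \<in> {1..r}" "t + len j' \<le> L (cyc n (top_ix j + 1))"
    "cyc n (cyc n (top_ix j + 1) + t) = top_ix j'"
  then have t: "cyc n (top_ix j + (1 + t)) = top_ix j'" using n_pos by (simp add: cyc_add_left)
  show ?thesis
    using no_subpath[OF j j'(1) _ t] j'(2) L_top_ix[OF j] by (cases "j = j'") auto
qed

text \<open>\<open>P\<^sub>i\<^sub>+\<^sub>1\<close> is the radical of \<open>P\<^sub>i\<close> if no relation starts at \<open>i\<close>.\<close>

lemma L_other_step:
  assumes i: "i \<in> {1..n}" "i \<notin> top_ix ` {1..r}"
  shows "L (cyc n (i + 1)) = L i - 1"
proof (rule antisym)
  show "L i - 1 \<le> L (cyc n (i + 1))" using L_shift[of i 1] by simp
  show "L (cyc n (i + 1)) \<le> L i - 1"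
  proof (rule contains_pathE[OF contains_path_L[of i]])
    fix j t assume j: "j \<in> {1..r}" "t + len j \<le> L i" "cyc n (i + t) = top_ix j"
    have "t \<noteq> 0" using j(1,3) i by (auto simp: cyc_id)
    then obtain t' where t': "t = Suc t'" using not0_implies_Suc by blast
    have "contains_path n B (cyc n (i + 1)) (L i - 1)"
      by (rule contains_pathI[OF j(1), of t']) (use j(2,3) n_pos in \<open>simp_all add: t' cyc_add_left\<close>)
    then show ?thesis by (simp add: contains_path_iff)
  qed
qed

lemma L_attained:
  obtains j t where "j \<in> {1..r}" "t + len j = L i" "cyc n (i + t) = top_ix j"
proof (rule contains_pathE[OF contains_path_L[of i]])
  fix j t assume j: "j \<in> {1..r}" "t + len j \<le> L i" "cyc n (i + t) = top_ix j"
  have "contains_path n B i (t + len j)" by (rule contains_pathI[OF j(1) order_refl j(3)])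
  then have "t + len j = L i" using j(2) by (simp add: contains_path_iff)
  then show thesis using that j by blast
qed

lemma socle_index: "cyc n (i + L i - 1) \<in> soc_ix ` {1..r}"
proof -
  obtain j t where j: "j \<in> {1..r}" "t + len j = L i" "cyc n (i + t) = top_ix j" by (rule L_attained)
  have "i + L i - 1 = (i + t) + (len j - 1)" using j(2) len_ge2[OF j(1)] by simp
  then have "cyc n (i + L i - 1) = cyc n (cyc n (i + t) + (len j - 1))"
    using n_pos by (simp add: cyc_add_left)
  also have "\<dots> = soc_ix j" unfolding j(3) by (rule len_end[OF j(1)])
  finally show ?thesis using j(1) by simp
qed

lemma soc_ix_eq: "j \<in> {1..r} \<Longrightarrow> soc_ix j = cyc n (top_ix j + L (top_ix j) - 1)"
  using len_end[of j] L_top_ix[of j] len_ge2[of j] by simp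

lemma inj_top_ix: "inj_on top_ix {1..r}"
proof -
  obtain m where "sorted_wrt (<) (rotate m (map top_ix [1..<r + 1]))"
    using cyc_incr unfolding cyclically_increasing_def by blast
  then have "distinct (map top_ix [1..<r + 1])"
    by (simp add: strict_sorted_iff del: upt_Suc)
  moreover have "set [1..<r + 1] = {1..r}" by auto
  ultimately show ?thesis by (simp add: distinct_map del: upt_Suc)
qed

text \<open>Of two relations with the same last arrow, the shorter one would be a subpath of the longer one.\<close>

lemma inj_soc_ix: "inj_on soc_ix {1..r}"
proof -
  have False if jj: "j \<in> {1..r}" "j' \<in> {1..r}" "j \<noteq> j'" "soc_ix j = soc_ix j'" "len j \<le> len j'" for j j'
  proof -
    have "cyc n ((top_ix j' + (len j' - len j)) + (len j - 1)) = cyc n (top_ix j + (len j - 1))"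
      using len_end[OF jj(1)] len_end[OF jj(2)] jj(4,5) len_ge2[OF jj(1)] by simp
    then have "cyc n (top_ix j' + (len j' - len j)) = top_ix j"
      using cyc_add_cancel[OF n_pos] cyc_id[OF top_ix_mem[OF jj(1)]] by simp
    then have "len j' < (len j' - len j) + len j"
      using no_subpath[OF jj(2,1) _ , of "len j' - len j"] jj(3) by simp
    then show False using jj(5) by simp
  qed
  then show ?thesis by (intro inj_onI) (metis nat_le_linear)
qed

text \<open>\<open>next_in S x y\<close>: going around the cycle, \<open>y\<close> is the first element of \<open>S\<close> after \<open>x\<close>.\<close>

definition next_in :: "nat set \<Rightarrow> nat \<Rightarrow> nat \<Rightarrow> bool"
  where "next_in S x y \<longleftrightarrow> y \<in> S \<and> (\<exists>s\<ge>1. cyc n (x + s) = y \<and> (\<forall>v. 0 < v \<and> v < s \<longrightarrow> cyc n (x + v) \<notin> S))"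

lemma next_in_unique:
  assumes "next_in S x y" "next_in S x z"
  shows "y = z"
proof -
  obtain s where s: "s \<ge> 1" "cyc n (x + s) = y" "\<And>v. 0 < v \<Longrightarrow> v < s \<Longrightarrow> cyc n (x + v) \<notin> S" "y \<in> S"
    using assms(1) unfolding next_in_def by blast
  obtain t where t: "t \<ge> 1" "cyc n (x + t) = z" "\<And>v. 0 < v \<Longrightarrow> v < t \<Longrightarrow> cyc n (x + v) \<notin> S" "z \<in> S"
    using assms(2) unfolding next_in_def by blast
  have "\<not> s < t" using t(3)[of s] s by auto
  moreover have "\<not> t < s" using s(3)[of t] t by auto
  ultimately show ?thesis using s(2) t(2) by (simp add: linorder_neq_iff)
qed

text \<open>The index of the next relation in cyclic order.\<close>

definition nxt :: "nat \<Rightarrow> nat"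
  where "nxt j = (if j < r then j + 1 else 1)"

lemma nxt_mem: "nxt j \<in> {1..r}"
  using r_pos by (auto simp: nxt_def)

lemma nxt_surj: "j \<in> {1..r} \<Longrightarrow> \<exists>j'\<in>{1..r}. nxt j' = j"
proof (cases "j = 1")
  case True
  then show ?thesis using r_pos by (intro bexI[of _ r]) (simp_all add: nxt_def)
next
  case False
  moreover assume "j \<in> {1..r}"
  ultimately show ?thesis by (intro bexI[of _ "j - 1"]) (auto simp: nxt_def)
qed

lemma cyc_nxt:
  assumes "j \<in> {1..r}"
  shows "cyc (2 * r) (2 * j + 1) = 2 * nxt j - 1" "cyc (2 * r) (2 * (nxt j - 1)) = 2 * j"
proof -
  show "cyc (2 * r) (2 * j + 1) = 2 * nxt j - 1"
  proof (cases "j < r")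
    case True
    then show ?thesis using cyc_id[of "2 * j + 1" "2 * r"] by (simp add: nxt_def)
  next
    case False
    then have "j = r" using assms by simp
    then show ?thesis using r_pos by (simp add: nxt_def cyc_def)
  qed
  show "cyc (2 * r) (2 * (nxt j - 1)) = 2 * j"
  proof (cases "j < r")
    case True
    then show ?thesis using cyc_id[of "2 * j" "2 * r"] assms by (simp add: nxt_def)
  next
    case False
    then have "j = r" using assms by simp
    then show ?thesis using r_pos by (simp add: nxt_def cyc_def)
  qed
qed

text \<open>In the increasing rotation \<open>ys\<close> of the list of first arrows, the next entry is the cyclic successor, and
  the last entry is followed by the first one.\<close>

lemma next_top_ix:
  assumes j: "j \<in> {1..r}"
  shows "next_in (top_ix ` {1..r}) (top_ix j) (top_ix (nxt j))"
proof -
  define xs where "xs = map top_ix [1..<r + 1]"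
  obtain m where m: "sorted_wrt (<) (rotate m xs)"
    using cyc_incr unfolding cyclically_increasing_def xs_def by blast
  define ys where "ys = rotate m xs"
  have len_xs: "length xs = r" and len_ys: "length ys = r" by (simp_all add: xs_def ys_def)
  have xs_nth: "xs ! i = top_ix (i + 1)" if "i < r" for i
    using that by (simp add: xs_def del: upt_Suc)
  have ys_nth: "ys ! i = xs ! ((m + i) mod r)" if "i < r" for i
    using that nth_rotate[of i xs m] by (simp add: ys_def len_xs)
  have ys_set: "top_ix ` {1..r} = set ys"
  proof -
    have "set [1..<r + 1] = {1..r}" by auto
    then show ?thesis by (simp add: ys_def xs_def del: upt_Suc)
  qed
  have less: "ys ! i < ys ! i'" if "i < i'" "i' < r" for i i'
    using m that len_ys unfolding ys_def[symmetric] sorted_wrt_iff_nth_less by blast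
  have range: "ys ! i \<in> {1..n}" if "i < r" for i
  proof -
    have "ys ! i \<in> top_ix ` {1..r}" unfolding ys_set using that len_ys by simp
    then obtain j' where "j' \<in> {1..r}" "ys ! i = top_ix j'" by blast
    then show ?thesis using top_ix_mem[of j'] by simp
  qed
  obtain i where i: "i < r" "(m + i) mod r = j - 1"
  proof -
    define i where "i = (j - 1 + (r - m mod r)) mod r"
    have "m mod r < r" using r_pos by simp
    have "(m + i) mod r = (m mod r + (j - 1 + (r - m mod r))) mod r" by (simp add: i_def mod_simps)
    also have "m mod r + (j - 1 + (r - m mod r)) = j - 1 + r" using \<open>m mod r < r\<close> by simp
    also have "(j - 1 + r) mod r = (j - 1) mod r" by (rule mod_add_self2)
    also have "\<dots> = j - 1" by (rule mod_less) (use j in auto)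
    finally show thesis using that[of i] r_pos by (simp add: i_def)
  qed
  have x: "top_ix j = ys ! i" using ys_nth[OF i(1)] xs_nth[of "j - 1"] j i(2) by auto
  define i' where "i' = (if i + 1 < r then i + 1 else 0)"
  have i': "i' < r" using r_pos by (simp add: i'_def)
  have y: "top_ix (nxt j) = ys ! i'"
  proof -
    have "(m + i') mod r = (m + (i + 1)) mod r"
    proof (cases "i + 1 < r")
      case True
      then show ?thesis by (simp add: i'_def)
    next
      case False
      then have "r = i + 1" using i(1) by simp
      then show ?thesis using mod_add_self2[of m r] by (simp add: i'_def)
    qed
    also have "\<dots> = ((m + i) mod r + 1) mod r" by (simp add: mod_simps)
    also have "\<dots> = j mod r" using i(2) j by simp
    also have "\<dots> = nxt j - 1" using j by (auto simp: nxt_def)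
    finally show ?thesis using ys_nth[OF i'] xs_nth[of "nxt j - 1"] nxt_mem[of j] by auto
  qed
  have yS: "ys ! i' \<in> set ys" using i' len_ys by simp
  have "next_in (set ys) (ys ! i) (ys ! i')"
  proof (cases "i + 1 < r")
    case True
    then have i1: "i' = i + 1" by (simp add: i'_def)
    define s where "s = ys ! i' - ys ! i"
    have lt: "ys ! i < ys ! i'" using less[of i i'] i1 True by simp
    have "s \<ge> 1" "cyc n (ys ! i + s) = ys ! i'" using lt cyc_id[OF range[OF i']] by (simp_all add: s_def)
    moreover have "cyc n (ys ! i + v) \<notin> set ys" if v: "0 < v" "v < s" for v
    proof
      have "ys ! i + v \<in> {1..n}" using v range[OF i(1)] range[OF i'] by (auto simp: s_def)
      then have c: "cyc n (ys ! i + v) = ys ! i + v" by (rule cyc_id)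
      assume "cyc n (ys ! i + v) \<in> set ys"
      then obtain u where u: "u < r" "ys ! u = ys ! i + v" unfolding c in_set_conv_nth len_ys by blast
      have "\<not> u \<le> i" using less[of u i] i(1) u v by (cases "u = i") auto
      moreover have "\<not> i' \<le> u" using less[of i' u] u v by (cases "u = i'") (auto simp: s_def)
      ultimately show False using i1 by simp
    qed
    ultimately show ?thesis unfolding next_in_def using yS by blast
  next
    case False
    then have i0: "i' = 0" "i = r - 1" using i(1) by (auto simp: i'_def)
    define s where "s = n - ys ! i + ys ! i'"
    have le1: "ys ! u \<le> ys ! i" if "u < r" for u
    proof (cases "u = i")
      case False
      then have "u < i" using that i0(2) by simp
      then show ?thesis using less[of u i] i(1) by simp
    qed simp
    have le2: "ys ! i' \<le> ys ! u" if "u < r" for u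
    proof (cases "u = i'")
      case False
      then have "i' < u" using i0(1) by simp
      then show ?thesis using less[of i' u] that by simp
    qed simp
    have "s \<ge> 1" using range[OF i'] by (simp add: s_def)
    moreover have "cyc n (ys ! i + s) = ys ! i'"
    proof -
      have "ys ! i + s = ys ! i' + n" using range[OF i(1)] by (simp add: s_def)
      then show ?thesis using cyc_eq_iff[OF n_pos, of "ys ! i' + n" "ys ! i'"] cyc_id[OF range[OF i']] by simp
    qed
    moreover have "cyc n (ys ! i + v) \<notin> set ys" if v: "0 < v" "v < s" for v
    proof
      assume "cyc n (ys ! i + v) \<in> set ys"
      then obtain u where u: "u < r" "ys ! u = cyc n (ys ! i + v)" unfolding in_set_conv_nth len_ys by metis
      show False
      proof (cases "ys ! i + v \<le> n")
        case True
        then have "cyc n (ys ! i + v) = ys ! i + v" using range[OF i(1)] by (intro cyc_id) simp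
        then show False using u le1[OF u(1)] v by simp
      next
        case False
        have w: "ys ! i + v - n \<in> {1..n}" using False v range[OF i'] range[OF i(1)] by (auto simp: s_def)
        have "cyc n (ys ! i + v) = cyc n (ys ! i + v - n)"
          unfolding cyc_eq_iff[OF n_pos] using False by (simp add: le_mod_geq)
        then have "ys ! u = ys ! i + v - n" using u(2) cyc_id[OF w] by simp
        then show False using le2[OF u(1)] v False range[OF i(1)] by (simp add: s_def)
      qed
    qed
    ultimately show ?thesis unfolding next_in_def using yS by blast
  qed
  then show ?thesis unfolding ys_set x y .
qed

text \<open>The (unrolled) position of the socle of \<open>P\<^sub>x\<close> is a monotone function of \<open>x\<close>, which is constant
  between consecutive first arrows of relations.  So the socles are met in the same cyclic order as the
  first arrows.\<close>

lemma next_soc_ix: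
  assumes j: "j \<in> {1..r}"
  shows "next_in (soc_ix ` {1..r}) (soc_ix j) (soc_ix (nxt j))"
proof -
  define End where "End x = x + L (cyc n x)" for x
  have mono: "End x \<le> End y" if "x \<le> y" for x y
  proof -
    have "cyc n (cyc n x + (y - x)) = cyc n y"
      using cyc_add_left[OF n_pos, of x "y - x"] that by simp
    then show ?thesis using L_shift[of "cyc n x" "y - x"] that by (simp add: End_def)
  qed
  have End_period: "End (x + a * n) = End x + a * n" for x a
    using cyc_eq_iff[OF n_pos, of "x + a * n" x] by (simp add: End_def)
  have End_top: "End (top_ix i) = top_ix i + L (top_ix i)" if "i \<in> {1..r}" for i
    using cyc_id[OF top_ix_mem[OF that]] by (simp add: End_def)
  let ?p = "top_ix j"
  obtain s where s: "s \<ge> 1" "cyc n (?p + s) = top_ix (nxt j)"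
    "\<And>v. 0 < v \<Longrightarrow> v < s \<Longrightarrow> cyc n (?p + v) \<notin> top_ix ` {1..r}"
    using next_top_ix[OF j] unfolding next_in_def by blast
  define u where "u = End (?p + s) - End ?p"
  have "End ?p + 1 \<le> End (?p + 1)"
    using L_top_ix_step[OF j] End_top[OF j] by (simp add: End_def)
  also have "\<dots> \<le> End (?p + s)" using s(1) by (intro mono) simp
  finally have u: "u \<ge> 1" "End (?p + s) = End ?p + u" by (simp_all add: u_def)
  have End_pos: "End x \<ge> 1" for x using L_ge2[of "cyc n x"] by (simp add: End_def)
  have soc_j: "soc_ix j = cyc n (End ?p - 1)" using soc_ix_eq[OF j] End_top[OF j] by simp
  have cyc_soc: "cyc n (soc_ix j + v) = cyc n (End ?p + v - 1)" for v
    using End_pos[of ?p] n_pos by (simp add: soc_j cyc_add_left)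
  have "soc_ix (nxt j) = cyc n (top_ix (nxt j) + (L (top_ix (nxt j)) - 1))"
    using soc_ix_eq[OF nxt_mem, of j] L_ge2[of "top_ix (nxt j)"] by simp
  also have "\<dots> = cyc n ((?p + s) + (L (top_ix (nxt j)) - 1))"
    using cyc_add_left[OF n_pos, of "?p + s"] by (simp add: s(2))
  also have "(?p + s) + (L (top_ix (nxt j)) - 1) = End (?p + s) - 1"
    using L_ge2[of "top_ix (nxt j)"] by (simp add: End_def s(2))
  finally have "cyc n (soc_ix j + u) = soc_ix (nxt j)" unfolding cyc_soc u(2) by simp
  moreover have "cyc n (soc_ix j + v) \<notin> soc_ix ` {1..r}" if v: "0 < v" "v < u" for v
  proof
    assume "cyc n (soc_ix j + v) \<in> soc_ix ` {1..r}"
    then obtain i where i: "i \<in> {1..r}" "cyc n (soc_ix j + v) = soc_ix i" by auto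
    define z w where "z = End ?p + v - 1" and "w = End (top_ix i) - 1"
    have "cyc n z = cyc n w"
      using i(2) soc_ix_eq[OF i(1)] End_top[OF i(1)] unfolding cyc_soc by (simp add: z_def w_def)
    then have "z mod n = w mod n" using cyc_eq_iff[OF n_pos] by simp
    then have "(z + w * n) mod n = w mod n" by simp
    moreover have le: "w \<le> z + w * n" using n_pos by (simp add: trans_le_add2)
    ultimately have "n dvd z + w * n - w" by (simp only: mod_eq_dvd_iff_nat[OF le])
    then obtain b where "z + w * n - w = n * b" by (rule dvdE)
    then have zw: "z + w * n = w + b * n" using le by (simp add: mult.commute)
    \<comment> \<open>Shifting by full turns makes the two positions equal.\<close>
    define x where "x = top_ix i + b * n"
    have End_x: "End x = End ?p + v + w * n"
      using zw End_pos[of ?p] End_pos[of "top_ix i"] by (simp add: x_def End_period z_def w_def)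
    have "?p + w * n < x"
    proof (rule ccontr)
      assume "\<not> ?p + w * n < x"
      then have "End x \<le> End (?p + w * n)" by (intro mono) simp
      then show False using End_x v(1) by (simp add: End_period)
    qed
    moreover have "x < ?p + s + w * n"
    proof (rule ccontr)
      assume "\<not> x < ?p + s + w * n"
      then have "End (?p + s + w * n) \<le> End x" by (intro mono) simp
      then show False using End_x v(2) u(2) by (simp add: End_period)
    qed
    ultimately obtain v' where v': "x = ?p + v' + w * n" "0 < v'" "v' < s"
      by (intro that[of "x - (?p + w * n)"]) auto
    have "cyc n (?p + v') = cyc n x" using cyc_eq_iff[OF n_pos, of x "?p + v'"] by (simp add: v'(1))
    also have "\<dots> = top_ix i"
      using cyc_eq_iff[OF n_pos, of x "top_ix i"] cyc_id[OF top_ix_mem[OF i(1)]] by (simp add: x_def)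
    finally show False using s(3)[OF v'(2,3)] i(1) by simp
  qed
  ultimately show ?thesis unfolding next_in_def using u(1) nxt_mem[of j] by blast
qed


section \<open>Comparison of the three conditions\<close>

text \<open>Only the first factor of the filtration matters for the top.\<close>

lemma uniserial_from_to_top:
  assumes M: "uniserial_from_to K n r k len a b M"
  shows "left_module A M" "A.top_at M (cyc n a)" "carrier M \<noteq> {\<zero>\<^bsub>M\<^esub>}"
proof -
  define l where "l = Suc (LEAST t. cyc n (a + t) = b)"
  have us: "uniserial_module A M" using M unfolding uniserial_from_to_def by blast
  then show LM: "left_module A M" by (simp add: uniserial_module_def)
  obtain F where F: "F 0 = carrier M" "F l = {\<zero>\<^bsub>M\<^esub>}"
    "\<And>t. t < l \<Longrightarrow> submodule (F t) A M"
    "\<And>t. t < l \<Longrightarrow> is_simple_at K n r k len (cyc n (a + t)) (quotient_module (M\<lparr>carrier := F t\<rparr>) (F (Suc t)))"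
    using M unfolding uniserial_from_to_def Let_def l_def[symmetric] by blast
  have l: "0 < l" by (simp add: l_def)
  have N: "submodule (F 1) A M"
  proof (cases "1 < l")
    case True
    then show ?thesis by (rule F(3))
  next
    case False
    then have "l = 1" using l by simp
    then show ?thesis using F(2) zero_submodule[OF LM] by simp
  qed
  have "M\<lparr>carrier := F 0\<rparr> = M" by (simp add: F(1))
  then have *: "is_simple_at K n r k len (cyc n a) (quotient_module M (F 1))" using F(4)[OF l] by simp
  then have simple: "simple_module A (quotient_module M (F 1))" unfolding is_simple_at_def by blast
  obtain X where X: "X \<in> carrier (quotient_module M (F 1))"
    "A.chi {cyc n a} \<odot>\<^bsub>quotient_module M (F 1)\<^esub> X \<noteq> \<zero>\<^bsub>quotient_module M (F 1)\<^esub>"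
    using * unfolding is_simple_at_def vertex_idem_eq[OF cyc_mem[OF n_pos]] by blast
  show "A.top_at M (cyc n a)" "carrier M \<noteq> {\<zero>\<^bsub>M\<^esub>}"
    by (rule A.uniserial_top_at[OF us N simple X])+
qed

lemma uni_uniserial_from_to:
  defines "len_of a b \<equiv> Suc (LEAST t. cyc n (a + t) = b)"
  assumes len: "len_of a b \<le> L (cyc n a)"
  shows "uniserial_from_to K n r k len a b (A.uni (cyc n a) (len_of a b))"
proof -
  let ?a = "cyc n a" and ?l = "len_of a b"
  have a: "?a \<in> {1..n}" by (rule cyc_mem[OF n_pos])
  have "\<forall>t<?l. submodule (A.ufil ?a ?l t) A (A.uni ?a ?l) \<and> A.ufil ?a ?l (Suc t) \<subseteq> A.ufil ?a ?l t \<and>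
      is_simple_at K n r k len (cyc n (a + t))
        (quotient_module ((A.uni ?a ?l)\<lparr>carrier := A.ufil ?a ?l t\<rparr>) (A.ufil ?a ?l (Suc t)))"
  proof (intro allI impI conjI)
    fix t assume t: "t < ?l"
    show "submodule (A.ufil ?a ?l t) A (A.uni ?a ?l)" by (rule A.ufil_submodule[OF a len])
    show "A.ufil ?a ?l (Suc t) \<subseteq> A.ufil ?a ?l t" by (auto simp: A.ufil_def)
    have "cyc n (?a + t) = cyc n (a + t)" by (rule cyc_add_left[OF n_pos])
    then show "is_simple_at K n r k len (cyc n (a + t))
        (quotient_module ((A.uni ?a ?l)\<lparr>carrier := A.ufil ?a ?l t\<rparr>) (A.ufil ?a ?l (Suc t)))"
      using A.ufil_factor_simple[OF a len t]
      unfolding is_simple_at_def vertex_idem_eq[OF cyc_mem[OF n_pos]] by simp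
  qed
  moreover have "A.ufil ?a ?l 0 = carrier (A.uni ?a ?l)" by (simp add: A.ufil_def)
  moreover have "A.ufil ?a ?l ?l = {\<zero>\<^bsub>A.uni ?a ?l\<^esub>}" by (rule A.ufil_last[OF a len])
  ultimately show ?thesis
    unfolding uniserial_from_to_def Let_def len_of_def[symmetric]
    by (intro conjI A.uni_uniserial[OF a len] exI[of _ "A.ufil ?a ?l"])
qed

lemma base_set_eq:
  "base_set K n r k len = {iso_class A \<Delta> |\<Delta> :: ('k paths set, nat \<Rightarrow> 'k paths set) module.
    \<exists>j\<in>{1..r}. uniserial_from_to K n r k len (soc_ix j + 1) (soc_ix (nxt j)) \<Delta>}"
proof -
  have "(\<exists>j\<in>{1..r}. uniserial_from_to K n r k len (k (cyc (2 * r) (2 * (j - 1))) + 1) (k (2 * j)) \<Delta>) \<longleftrightarrow>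
      (\<exists>j\<in>{1..r}. uniserial_from_to K n r k len (soc_ix j + 1) (soc_ix (nxt j)) \<Delta>)"
    for \<Delta> :: "('k paths set, nat \<Rightarrow> 'k paths set) module"
  proof
    assume "\<exists>j\<in>{1..r}. uniserial_from_to K n r k len (k (cyc (2 * r) (2 * (j - 1))) + 1) (k (2 * j)) \<Delta>"
    then obtain j where j: "j \<in> {1..r}"
      "uniserial_from_to K n r k len (k (cyc (2 * r) (2 * (j - 1))) + 1) (k (2 * j)) \<Delta>" by blast
    obtain j' where j': "j' \<in> {1..r}" "nxt j' = j" using nxt_surj[OF j(1)] by blast
    then show "\<exists>j\<in>{1..r}. uniserial_from_to K n r k len (soc_ix j + 1) (soc_ix (nxt j)) \<Delta>"
      using j(2) cyc_nxt(2)[OF j'(1)] by (intro bexI[OF _ j'(1)]) simp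
  next
    assume "\<exists>j\<in>{1..r}. uniserial_from_to K n r k len (soc_ix j + 1) (soc_ix (nxt j)) \<Delta>"
    then obtain j where j: "j \<in> {1..r}"
      "uniserial_from_to K n r k len (soc_ix j + 1) (soc_ix (nxt j)) \<Delta>" by blast
    then show "\<exists>j\<in>{1..r}. uniserial_from_to K n r k len (k (cyc (2 * r) (2 * (j - 1))) + 1) (k (2 * j)) \<Delta>"
      using cyc_nxt(2)[OF j(1)] by (intro bexI[OF _ nxt_mem[of j]]) simp
  qed
  then show ?thesis unfolding base_set_def by simp
qed

lemma nabla_set_eq:
  "nabla_set K n r k len = {iso_class A N |N :: ('k paths set, nat \<Rightarrow> 'k paths set) module.
    \<exists>j\<in>{1..r}. uniserial_from_to K n r k len (top_ix j + 1) (top_ix (nxt j)) N}"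
proof -
  have "(\<exists>j\<in>{1..r}. uniserial_from_to K n r k len (k (2 * j - 1) + 1) (k (cyc (2 * r) (2 * j + 1))) N) \<longleftrightarrow>
      (\<exists>j\<in>{1..r}. uniserial_from_to K n r k len (top_ix j + 1) (top_ix (nxt j)) N)"
    for N :: "('k paths set, nat \<Rightarrow> 'k paths set) module"
    by (rule bex_cong[OF refl]) (simp only: cyc_nxt(1) top_ix_def)
  then show ?thesis unfolding nabla_set_def by simp
qed

lemma card_ix: "card (top_ix ` {1..r}) = card (soc_ix ` {1..r})"
  using card_image[OF inj_top_ix] card_image[OF inj_soc_ix] by simp

lemma sets_eq_if_fin_dim_1:
  assumes "fin_dim A = 1"
  shows "top_ix ` {1..r} = soc_ix ` {1..r}"
proof -
  have "soc_ix ` {1..r} \<subseteq> top_ix ` {1..r}"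
  proof (rule image_subsetI, rule ccontr)
    fix j assume j: "j \<in> {1..r}" and new: "soc_ix j \<notin> top_ix ` {1..r}"
    have "\<not> fin_dim A \<le> 1"
      by (rule A.fin_dim_not_le_1[OF top_ix_mem[OF j] soc_ix_eq[OF j] L_other_step[OF soc_ix_mem[OF j] new]])
    then show False using assms by simp
  qed
  then show ?thesis using card_subset_eq[of "top_ix ` {1..r}" "soc_ix ` {1..r}"] card_ix by simp
qed

lemma fin_dim_1_if_sets_eq:
  assumes "r < n" and eq: "top_ix ` {1..r} = soc_ix ` {1..r}"
  shows "fin_dim A = 1"
proof -
  have sub: "top_ix ` {1..r} \<subseteq> {1..n}" by (rule image_subsetI) (rule top_ix_mem)
  have "card (top_ix ` {1..r}) < card {1..n}"
    using card_image[OF inj_top_ix] \<open>r < n\<close> by simp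
  then obtain a where a: "a \<in> {1..n}" "a \<notin> top_ix ` {1..r}"
    using card_mono[of "top_ix ` {1..r}" "{1..n}"] by fastforce
  show ?thesis
  proof (rule A.fin_dim_eq_1[OF sub])
    show "L i \<le> L (cyc n (i + 1))" if "i \<in> top_ix ` {1..r}" for i
      using that L_top_ix_step by blast
    show "cyc n (i + L i - 1) \<in> top_ix ` {1..r}" for i
      unfolding eq by (rule socle_index)
  qed (use a L_other_step[OF a] in auto)
qed

lemma base_eq_nabla_if_sets_eq:
  assumes eq: "top_ix ` {1..r} = soc_ix ` {1..r}"
  shows "base_set K n r k len = nabla_set K n r k len"
proof -
  have "(\<exists>j\<in>{1..r}. Q (soc_ix j) (soc_ix (nxt j))) \<longleftrightarrow> (\<exists>j\<in>{1..r}. Q (top_ix j) (top_ix (nxt j)))" for Q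
  proof
    assume "\<exists>j\<in>{1..r}. Q (soc_ix j) (soc_ix (nxt j))"
    then obtain j where j: "j \<in> {1..r}" "Q (soc_ix j) (soc_ix (nxt j))" by blast
    then obtain i where i: "i \<in> {1..r}" "soc_ix j = top_ix i" using eq by blast
    have "soc_ix (nxt j) = top_ix (nxt i)"
      using next_in_unique[OF next_soc_ix[OF j(1)]] next_top_ix[OF i(1)] unfolding eq i(2) by blast
    then show "\<exists>j\<in>{1..r}. Q (top_ix j) (top_ix (nxt j))" using i j by auto
  next
    assume "\<exists>j\<in>{1..r}. Q (top_ix j) (top_ix (nxt j))"
    then obtain j where j: "j \<in> {1..r}" "Q (top_ix j) (top_ix (nxt j))" by blast
    then have "top_ix j \<in> soc_ix ` {1..r}" using eq by blast
    then obtain i where i: "top_ix j = soc_ix i" "i \<in> {1..r}" by (rule imageE)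
    have "top_ix (nxt j) = soc_ix (nxt i)"
      using next_in_unique[OF next_top_ix[OF j(1)]] next_soc_ix[OF i(2)] unfolding eq i(1) by blast
    then show "\<exists>j\<in>{1..r}. Q (soc_ix j) (soc_ix (nxt j))" using i j by auto
  qed
  note * = this
  show ?thesis
    unfolding base_set_eq nabla_set_eq
    by (subst *[of "\<lambda>x y. uniserial_from_to K n r k len (x + 1) y M" for M]) (rule refl)
qed

lemma nabla_exists:
  assumes j: "j \<in> {1..r}"
  shows "\<exists>M :: ('k paths set, nat \<Rightarrow> 'k paths set) module.
    uniserial_from_to K n r k len (top_ix j + 1) (top_ix (nxt j)) M"
proof -
  let ?a = "top_ix j + 1" and ?b = "top_ix (nxt j)"
  obtain s where s: "s \<ge> 1" "cyc n (top_ix j + s) = ?b"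
    "\<And>v. 0 < v \<Longrightarrow> v < s \<Longrightarrow> cyc n (top_ix j + v) \<notin> top_ix ` {1..r}"
    using next_top_ix[OF j] unfolding next_in_def by blast
  have "(LEAST t. cyc n (?a + t) = ?b) \<le> s - 1" by (rule Least_le) (use s in simp)
  then have "Suc (LEAST t. cyc n (?a + t) = ?b) \<le> s" using s(1) by simp
  also have "s \<le> L (cyc n ?a)"
  proof -
    obtain j' t where j': "j' \<in> {1..r}" "t + len j' = L (cyc n ?a)" "cyc n (cyc n ?a + t) = top_ix j'"
      by (rule L_attained)
    have "cyc n (top_ix j + Suc t) = top_ix j'" using j'(3) cyc_add_left[OF n_pos, of ?a t] by simp
    then have "\<not> Suc t < s" using s(3)[of "Suc t"] j'(1) by auto
    then show ?thesis using j'(2) len_ge2[OF j'(1)] by simp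
  qed
  finally show ?thesis using uni_uniserial_from_to by blast
qed

lemma sets_eq_if_base_eq_nabla:
  assumes eq: "base_set K n r k len = nabla_set K n r k len"
  shows "top_ix ` {1..r} = soc_ix ` {1..r}"
proof -
  have "top_ix ` {1..r} \<subseteq> soc_ix ` {1..r}"
  proof (rule image_subsetI)
    fix j assume j: "j \<in> {1..r}"
    obtain M :: "('k paths set, nat \<Rightarrow> 'k paths set) module" where
      M: "uniserial_from_to K n r k len (top_ix j + 1) (top_ix (nxt j)) M"
      using nabla_exists[OF j] by blast
    note MT = uniserial_from_to_top[OF M]
    have "iso_class A M \<in> base_set K n r k len"
      unfolding eq nabla_set_eq using M j by blast
    then obtain N :: "('k paths set, nat \<Rightarrow> 'k paths set) module" and i where
      N: "iso_class A M = iso_class A N" "i \<in> {1..r}"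
      "uniserial_from_to K n r k len (soc_ix i + 1) (soc_ix (nxt i)) N"
      unfolding base_set_eq by blast
    note NT = uniserial_from_to_top[OF N(3)]
    have "(\<lambda>x. x) \<in> mod_hom A N N" by (rule mod_homI) simp_all
    moreover have "bij_betw (\<lambda>x. x) (carrier N) (carrier N)" by (simp add: bij_betw_def)
    ultimately have "mod_iso A N N" unfolding mod_iso_def by blast
    then have "N \<in> iso_class A N" unfolding iso_class_def using NT(1) by simp
    then have "N \<in> iso_class A M" unfolding N(1) .
    then have "mod_iso A M N" unfolding iso_class_def by simp
    then have "A.top_at M (cyc n (soc_ix i + 1))" by (rule A.top_at_iso[OF MT(1) NT(1) _ NT(2)])
    then have "cyc n (top_ix j + 1) = cyc n (soc_ix i + 1)"
      by (rule A.top_at_unique[OF MT(1,3,2)])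
    then have "top_ix j = soc_ix i" by (rule cyc_inject[OF top_ix_mem[OF j] soc_ix_mem[OF N(2)]])
    then show "top_ix j \<in> soc_ix ` {1..r}" using N(2) by simp
  qed
  then show ?thesis using card_subset_eq[of "soc_ix ` {1..r}" "top_ix ` {1..r}"] card_ix by simp
qed

end

theorem proposition3p2:
  fixes K :: "'k::field itself" and n r :: nat and k len :: "nat \<Rightarrow> nat"
  assumes "irredundant_system K n r k len"
  shows "(fin_dim (nakayama_algebra K n r k len) = 1 \<longrightarrow>
      (\<lambda>i. k (2 * i - 1)) ` {1..r} = (\<lambda>i. k (2 * i)) ` {1..r}) \<and>
    (r < n \<longrightarrow>
      (\<lambda>i. k (2 * i - 1)) ` {1..r} = (\<lambda>i. k (2 * i)) ` {1..r} \<longrightarrow>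
      fin_dim (nakayama_algebra K n r k len) = 1) \<and>
    ((\<lambda>i. k (2 * i - 1)) ` {1..r} = (\<lambda>i. k (2 * i)) ` {1..r} \<longleftrightarrow>
      base_set K n r k len = nabla_set K n r k len)"
proof -
  interpret nakayama_data K n r k len by (rule nakayama_data.intro[OF assms])
  have top: "(\<lambda>i. k (2 * i - 1)) = top_ix" by (simp only: top_ix_def[abs_def])
  show ?thesis
    unfolding top
    using sets_eq_if_fin_dim_1 fin_dim_1_if_sets_eq base_eq_nabla_if_sets_eq sets_eq_if_base_eq_nabla
    by blast
qed


end
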